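(* Consider the affine surfaces on $\mathbb{R}^2$ with constant Christoffel symbols $(\Gamma_{11}{}^1,\Gamma_{11}{}^2,\Gamma_{12}{}^1,\Gamma_{12}{}^2,\Gamma_{22}{}^1,\Gamma_{22}{}^2)$ given by $\mathcal{M}_1$: $(-1,0,1,0,0,2)$; $\mathcal{M}_2^c$: $(-1,0,c,0,0,1+2c)$, where $c^2+c\ne0$; $\mathcal{M}_3^c$: $(0,0,c,0,0,1+2c)$, where $c^2+c\ne0$; $\mathcal{M}_4^c$: $(0,0,1,0,c,2)$, $c\in\mathbb{R}$; $\mathcal{M}_5^c$: $(-1,0,c,0,-1,2c)$, $c\in\mathbb{R}$. Let $\mathfrak{K}_0^{\mathcal{A}}:=\operatorname{Span}_{\mathbb{R}}\{\partial_1,\partial_2\}$. \begin{enumerate} \item If $\mathcal{M}=(\mathbb{R}^2,\nabla)$ where $\nabla$ is a non-flat torsion-free connection with constant Christoffel symbols, and if its Ricci tensor $\rho$ has rank $1$, then $\mathcal{M}$ is linearly equivalent to $\mathcal{M}_1$, $\mathcal{M}_2^c$, $\mathcal{M}_3^c$, $\mathcal{M}_4^c$, or $\mathcal{M}_5^c$ (for some admissible $c$). \item $\mathfrak{K}(\mathcal{M}_1)=\operatorname{Span}_{\mathbb{R}}\{e^{x^1}\partial_1,\,x^2e^{x^1}\partial_1\}\oplus\mathfrak{K}_0^{\mathcal{A}}\approx A_{4,9}^0$. \item $\mathfrak{K}(\mathcal{M}_2^c)=\operatorname{Span}_{\mathbb{R}}\{e^{x^1}\partial_1,\,e^{x^1+x^2}\partial_1\}\oplus\mathfrak{K}_0^{\mathcal{A}}\approx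 A_2\oplus A_2$. \item $\mathfrak{K}(\mathcal{M}_3^c)=\operatorname{Span}_{\mathbb{R}}\{e^{x^2}\partial_1,\,x^1\partial_1\}\oplus\mathfrak{K}_0^{\mathcal{A}}\approx A_2\oplus A_2$. \item $\mathfrak{K}(\mathcal{M}_4^c)=\operatorname{Span}_{\mathbb{R}}\{x^2\partial_1,\,(c\cdot(x^2)^2+2x^1)\partial_1\}\oplus\mathfrak{K}_0^{\mathcal{A}}\approx A_{4,9}^0$. \item $\mathfrak{K}(\mathcal{M}_5^c)=\operatorname{Span}_{\mathbb{R}}\{e^{x^1}\cos(x^2)\partial_1,\,e^{x^1}\sin(x^2)\partial_1\}\oplus\mathfrak{K}_0^{\mathcal{A}}\approx A_{4,12}$. \item $\mathcal{M}_1$, $\mathcal{M}_2^c$, $\mathcal{M}_3^c$, and $\mathcal{M}_4^c$ are also of Type $\mathcal{B}$; $\mathcal{M}_5^c$ is not of Type $\mathcal{B}$. \end{enumerate}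
   Context: $\nabla_{\partial_i}\partial_j=\Gamma_{ij}{}^k\partial_k$, $\partial_i=\partial_{x^i}$. $R(\xi_1,\xi_2)=\nabla_{\xi_1}\nabla_{\xi_2}-\nabla_{\xi_2}\nabla_{\xi_1}-\nabla_{[\xi_1,\xi_2]}$, $\rho(\xi_1,\xi_2)=\operatorname{Tr}\{\xi_3\mapsto R(\xi_3,\xi_1)\xi_2\}$. $X$ is affine Killing if $\mathcal{L}_X\nabla=0$; $\mathfrak{K}(\mathcal{M})$ is the Lie algebra of such fields; $\approx$ is isomorphism of real Lie algebras. Two structures with constant Christoffel symbols on $\mathbb{R}^2$ are linearly equivalent if some $T\in\operatorname{GL}(2,\mathbb{R})$ pulls one connection back to the other. A surface is of Type $\mathcal{B}$ if it is locally homogeneous (any two points are related by a germ of a $\nabla$-preserving diffeomorphism), not flat, and near each point there are local coordinates $(x^1,x^2)$ with $\Gamma_{ij}{}^k=(x^1)^{-1}C_{ij}{}^k$, $C_{ij}{}^k=C_{ji}{}^k$ constant. Lie algebras (basis $e_1,\dots,e_4$, unlisted brackets zero): $A_2\oplus A_2$: $[e_1,e_2]=e_2$, $[e_3,e_4]=e_4$. $A_{4,9}^0$: $[e_2,e_3]=e_1$, $[e_1,e_4]=e_1$, $[e_2,e_4]=e_2$. $A_{4,12}$: $[e_1,e_3]=e_1$, $[e_2,e_3]=e_2$, $[e_1,e_4]=-e_2$, $[e_2,e_4]=e_1$. *)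

theory Defs
  imports "HOL-Analysis.Analysis" "HOL-Library.Function_Algebras"
begin

text \<open>
  An affine surface is given by an open set \<open>U\<close> of the plane and the Christoffel symbols of its
  connection, \<open>\<Gamma> p i j k\<close> being the symbol with lower indices \<open>i\<close>, \<open>j\<close> and upper index \<open>k\<close> at \<open>p\<close>.
  Vector fields are total functions; on \<open>U\<close> only their values on \<open>U\<close> matter.  All derivatives
  below are taken at points of open sets.
\<close>

type_synonym christoffel = "2 \<Rightarrow> 2 \<Rightarrow> 2 \<Rightarrow> real"
type_synonym connection = "real^2 \<Rightarrow> christoffel"
type_synonym vfield = "real^2 \<Rightarrow> real^2"

instantiation "fun" :: (type, real_vector) real_vector
begin

definition scaleR_fun :: "real \<Rightarrow> ('a \<Rightarrow> 'b) \<Rightarrow> 'a \<Rightarrow> 'b" where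
  "scaleR_fun r X = (\<lambda>p. r *\<^sub>R X p)"

instance
  by standard (auto simp: scaleR_fun_def fun_eq_iff scaleR_add_right scaleR_add_left)

end


subsection \<open>Smoothness\<close>

primrec Ck_on :: "nat \<Rightarrow> 'a::real_normed_vector set \<Rightarrow> ('a \<Rightarrow> 'b::real_normed_vector) \<Rightarrow> bool" where
  "Ck_on 0 U f \<longleftrightarrow> continuous_on U f"
| "Ck_on (Suc n) U f \<longleftrightarrow>
     (\<forall>p\<in>U. f differentiable (at p)) \<and>
     (\<forall>v. Ck_on n U (\<lambda>p. frechet_derivative f (at p) v))"

definition smooth_on :: "'a::real_normed_vector set \<Rightarrow> ('a \<Rightarrow> 'b::real_normed_vector) \<Rightarrow> bool" where
  "smooth_on U f \<longleftrightarrow> (\<forall>n. Ck_on n U f)"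

definition diffeo_on :: "(real^2) set \<Rightarrow> (real^2) set \<Rightarrow> (real^2 \<Rightarrow> real^2) \<Rightarrow> bool" where
  "diffeo_on U V \<phi> \<longleftrightarrow> open U \<and> open V \<and> bij_betw \<phi> U V \<and>
     smooth_on U \<phi> \<and> smooth_on V (inv_into U \<phi>)"


subsection \<open>Connections\<close>

definition coord_field :: "2 \<Rightarrow> vfield" where
  "coord_field i = (\<lambda>p. axis i 1)"

definition bracket :: "vfield \<Rightarrow> vfield \<Rightarrow> vfield" where
  "bracket X Y = (\<lambda>p. frechet_derivative Y (at p) (X p) - frechet_derivative X (at p) (Y p))"

definition cov :: "connection \<Rightarrow> vfield \<Rightarrow> vfield \<Rightarrow> vfield" where
  "cov \<Gamma> X Y = (\<lambda>p. frechet_derivative Y (at p) (X p) +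
     (\<chi> k. \<Sum>i\<in>UNIV. \<Sum>j\<in>UNIV. \<Gamma> p i j k * X p $ i * Y p $ j))"

definition torsion_free :: "(real^2) set \<Rightarrow> connection \<Rightarrow> bool" where
  "torsion_free U \<Gamma> \<longleftrightarrow> (\<forall>X Y. smooth_on U X \<longrightarrow> smooth_on U Y \<longrightarrow>
     (\<forall>p\<in>U. cov \<Gamma> X Y p - cov \<Gamma> Y X p = bracket X Y p))"

definition affine_surface :: "(real^2) set \<Rightarrow> connection \<Rightarrow> bool" where
  "affine_surface U \<Gamma> \<longleftrightarrow> open U \<and> (\<forall>i j k. smooth_on U (\<lambda>p. \<Gamma> p i j k)) \<and> torsion_free U \<Gamma>"

definition curvature :: "connection \<Rightarrow> vfield \<Rightarrow> vfield \<Rightarrow> vfield \<Rightarrow> vfield" where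
  "curvature \<Gamma> X Y Z = (\<lambda>p. cov \<Gamma> X (cov \<Gamma> Y Z) p - cov \<Gamma> Y (cov \<Gamma> X Z) p - cov \<Gamma> (bracket X Y) Z p)"

definition flat :: "(real^2) set \<Rightarrow> connection \<Rightarrow> bool" where
  "flat U \<Gamma> \<longleftrightarrow> (\<forall>X Y Z. smooth_on U X \<longrightarrow> smooth_on U Y \<longrightarrow> smooth_on U Z \<longrightarrow>
     (\<forall>p\<in>U. curvature \<Gamma> X Y Z p = 0))"

text \<open>The curvature is tensorial, so tangent vectors may be extended to constant fields.\<close>

definition ricci :: "connection \<Rightarrow> real^2 \<Rightarrow> real^2 \<Rightarrow> real^2 \<Rightarrow> real" where
  "ricci \<Gamma> p u v = trace (matrix (\<lambda>w. curvature \<Gamma> (\<lambda>_. w) (\<lambda>_. u) (\<lambda>_. v) p))"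

definition ricci_matrix :: "connection \<Rightarrow> real^2 \<Rightarrow> real^2^2" where
  "ricci_matrix \<Gamma> p = (\<chi> i j. ricci \<Gamma> p (axis i 1) (axis j 1))"


subsection \<open>Affine maps, local homogeneity, linear equivalence\<close>

definition pushforward :: "(real^2) set \<Rightarrow> (real^2 \<Rightarrow> real^2) \<Rightarrow> vfield \<Rightarrow> vfield" where
  "pushforward U \<phi> X = (\<lambda>q. frechet_derivative \<phi> (at (inv_into U \<phi> q)) (X (inv_into U \<phi> q)))"

text \<open>A diffeomorphism \<open>\<phi>\<close> from \<open>U\<close> to \<open>V\<close> which pulls \<open>\<Delta>\<close> back to \<open>\<Gamma>\<close>.\<close>

definition affine_diffeo ::
  "(real^2) set \<Rightarrow> connection \<Rightarrow> (real^2) set \<Rightarrow> connection \<Rightarrow> (real^2 \<Rightarrow> real^2) \<Rightarrow> bool" where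
  "affine_diffeo U \<Gamma> V \<Delta> \<phi> \<longleftrightarrow> diffeo_on U V \<phi> \<and>
     (\<forall>X Y. smooth_on U X \<longrightarrow> smooth_on U Y \<longrightarrow>
       (\<forall>q\<in>V. pushforward U \<phi> (cov \<Gamma> X Y) q
              = cov \<Delta> (pushforward U \<phi> X) (pushforward U \<phi> Y) q))"

definition linearly_equivalent :: "christoffel \<Rightarrow> christoffel \<Rightarrow> bool" where
  "linearly_equivalent G H \<longleftrightarrow>
     (\<exists>T :: real^2^2. invertible T \<and> affine_diffeo UNIV (\<lambda>_. G) UNIV (\<lambda>_. H) ((*v) T))"

definition locally_homogeneous :: "(real^2) set \<Rightarrow> connection \<Rightarrow> bool" where
  "locally_homogeneous U \<Gamma> \<longleftrightarrow> (\<forall>p\<in>U. \<forall>q\<in>U. \<exists>V W \<phi>.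
     p \<in> V \<and> V \<subseteq> U \<and> q \<in> W \<and> W \<subseteq> U \<and> affine_diffeo V \<Gamma> W \<Gamma> \<phi> \<and> \<phi> p = q)"

definition type_B :: "(real^2) set \<Rightarrow> connection \<Rightarrow> bool" where
  "type_B U \<Gamma> \<longleftrightarrow> affine_surface U \<Gamma> \<and> locally_homogeneous U \<Gamma> \<and> \<not> flat U \<Gamma> \<and>
     (\<forall>p\<in>U. \<exists>V W \<phi>. \<exists>C :: christoffel.
       p \<in> V \<and> V \<subseteq> U \<and> W \<subseteq> {x. x $ 1 \<noteq> 0} \<and> (\<forall>i j k. C i j k = C j i k) \<and>
       affine_diffeo V \<Gamma> W (\<lambda>x i j k. C i j k / x $ 1) \<phi>)"


subsection \<open>Affine Killing vector fields\<close>

definition lie_derivative :: "vfield \<Rightarrow> connection \<Rightarrow> vfield \<Rightarrow> vfield \<Rightarrow> vfield" where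
  "lie_derivative X \<Gamma> Y Z = (\<lambda>p.
     bracket X (cov \<Gamma> Y Z) p - cov \<Gamma> (bracket X Y) Z p - cov \<Gamma> Y (bracket X Z) p)"

text \<open>The affine Killing fields of a connection on the whole plane.\<close>

definition killing :: "connection \<Rightarrow> vfield set" where
  "killing \<Gamma> = {X. smooth_on UNIV X \<and>
     (\<forall>Y Z. smooth_on UNIV Y \<longrightarrow> smooth_on UNIV Z \<longrightarrow> (\<forall>p. lie_derivative X \<Gamma> Y Z p = 0))}"


subsection \<open>Real Lie algebras\<close>

definition lie_algebra :: "'a::real_vector set \<Rightarrow> ('a \<Rightarrow> 'a \<Rightarrow> 'a) \<Rightarrow> bool" where
  "lie_algebra L b \<longleftrightarrow> subspace L \<and>
     (\<forall>x\<in>L. \<forall>y\<in>L. b x y \<in> L) \<and>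
     (\<forall>x\<in>L. \<forall>y\<in>L. \<forall>z\<in>L. b (x + y) z = b x z + b y z \<and> b z (x + y) = b z x + b z y) \<and>
     (\<forall>r. \<forall>x\<in>L. \<forall>y\<in>L. b (r *\<^sub>R x) y = r *\<^sub>R b x y \<and> b x (r *\<^sub>R y) = r *\<^sub>R b x y) \<and>
     (\<forall>x\<in>L. b x x = 0) \<and>
     (\<forall>x\<in>L. \<forall>y\<in>L. \<forall>z\<in>L. b x (b y z) + b y (b z x) + b z (b x y) = 0)"

definition lie_isomorphic ::
  "'a::real_vector set \<Rightarrow> ('a \<Rightarrow> 'a \<Rightarrow> 'a) \<Rightarrow> 'b::real_vector set \<Rightarrow> ('b \<Rightarrow> 'b \<Rightarrow> 'b) \<Rightarrow> bool" where
  "lie_isomorphic L b M c \<longleftrightarrow> lie_algebra L b \<and> lie_algebra M c \<and>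
     (\<exists>f. bij_betw f L M \<and>
       (\<forall>x\<in>L. \<forall>y\<in>L. f (x + y) = f x + f y) \<and>
       (\<forall>r. \<forall>x\<in>L. f (r *\<^sub>R x) = r *\<^sub>R f x) \<and>
       (\<forall>x\<in>L. \<forall>y\<in>L. f (b x y) = c (f x) (f y)))"

text \<open>
  Brackets on \<open>real^4\<close>, \<open>e\<^sub>i = axis i 1\<close>: a relation \<open>[e\<^sub>i, e\<^sub>j] = v\<close> contributes
  \<open>wedge i j x y *\<^sub>R v\<close> to \<open>[x, y]\<close>.
\<close>

definition wedge :: "4 \<Rightarrow> 4 \<Rightarrow> real^4 \<Rightarrow> real^4 \<Rightarrow> real" where
  "wedge i j x y = x $ i * y $ j - x $ j * y $ i"

definition bracket_A2_A2 :: "real^4 \<Rightarrow> real^4 \<Rightarrow> real^4" where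
  "bracket_A2_A2 x y = wedge 1 2 x y *\<^sub>R axis 2 1 + wedge 3 4 x y *\<^sub>R axis 4 1"

definition bracket_A4_9_0 :: "real^4 \<Rightarrow> real^4 \<Rightarrow> real^4" where
  "bracket_A4_9_0 x y = wedge 2 3 x y *\<^sub>R axis 1 1 + wedge 1 4 x y *\<^sub>R axis 1 1
     + wedge 2 4 x y *\<^sub>R axis 2 1"

definition bracket_A4_12 :: "real^4 \<Rightarrow> real^4 \<Rightarrow> real^4" where
  "bracket_A4_12 x y = wedge 1 3 x y *\<^sub>R axis 1 1 + wedge 2 3 x y *\<^sub>R axis 2 1
     + wedge 1 4 x y *\<^sub>R (- axis 2 1) + wedge 2 4 x y *\<^sub>R axis 1 1"

definition is_direct_sum :: "'a::real_vector set \<Rightarrow> 'a set \<Rightarrow> 'a set \<Rightarrow> bool" where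
  "is_direct_sum V A B \<longleftrightarrow> subspace A \<and> subspace B \<and> V = {a + b | a b. a \<in> A \<and> b \<in> B} \<and> A \<inter> B = {0}"


subsection \<open>The model surfaces\<close>

text \<open>\<open>const_christoffel \<Gamma>\<^sub>1\<^sub>1\<^sup>1 \<Gamma>\<^sub>1\<^sub>1\<^sup>2 \<Gamma>\<^sub>1\<^sub>2\<^sup>1 \<Gamma>\<^sub>1\<^sub>2\<^sup>2 \<Gamma>\<^sub>2\<^sub>2\<^sup>1 \<Gamma>\<^sub>2\<^sub>2\<^sup>2\<close>, symmetric in the lower indices.\<close>

definition const_christoffel :: "real \<Rightarrow> real \<Rightarrow> real \<Rightarrow> real \<Rightarrow> real \<Rightarrow> real \<Rightarrow> christoffel" where
  "const_christoffel a b c d e f i j k =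
     (if i = 1 \<and> j = 1 then (if k = 1 then a else b)
      else if i = 2 \<and> j = 2 then (if k = 1 then e else f)
      else (if k = 1 then c else d))"

definition M1 :: christoffel where
  "M1 = const_christoffel (-1) 0 1 0 0 2"

definition M2 :: "real \<Rightarrow> christoffel" where
  "M2 c = const_christoffel (-1) 0 c 0 0 (1 + 2 * c)"

definition M3 :: "real \<Rightarrow> christoffel" where
  "M3 c = const_christoffel 0 0 c 0 0 (1 + 2 * c)"

definition M4 :: "real \<Rightarrow> christoffel" where
  "M4 c = const_christoffel 0 0 1 0 c 2"

definition M5 :: "real \<Rightarrow> christoffel" where
  "M5 c = const_christoffel (-1) 0 c 0 (-1) (2 * c)"

definition K0 :: "vfield set" where
  "K0 = span {coord_field 1, coord_field 2}"

text \<open>The vector field \<open>f \<partial>\<^sub>1\<close>.\<close>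

definition times_d1 :: "(real^2 \<Rightarrow> real) \<Rightarrow> vfield" where
  "times_d1 f = (\<lambda>p. f p *\<^sub>R coord_field 1 p)"

end

theory Submission
  imports Defs
begin

text \<open>
  A connection with constant symbols is a bilinear product on the plane, and linear equivalence is
  isomorphism of products.  If the Ricci tensor has rank one, a basis whose first vector spans its
  kernel makes \<open>\<Gamma>\<^sub>1\<^sub>1\<^sup>2\<close> and \<open>\<Gamma>\<^sub>1\<^sub>2\<^sup>2\<close> vanish; rescaling and shearing the basis then leads to the five
  normal forms, according to whether \<open>\<Gamma>\<^sub>1\<^sub>1\<^sup>1\<close> vanishes and to the sign of a discriminant.

  In the normal forms the Killing equation is an overdetermined linear system of second order.
  Commuting third derivatives forces the \<open>\<partial>\<^sub>2\<close>-component to be constant, and the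
  \<open>\<partial>\<^sub>1\<close>-component is determined by its 1-jet at the origin, so that two explicit solutions
  suffice.

  A chart \<open>(y, z)\<close> of Type \<open>\<B>\<close> satisfies second-order equations with right-hand side quadratic in
  the first derivatives.  For \<open>M5 c\<close> their integrability conditions say that a constant matrix built
  from \<open>C\<close> annihilates \<open>(\<partial>\<^sub>1 y, \<partial>\<^sub>1 z)\<close>.  This forces \<open>\<partial>\<^sub>1 y = 0\<close>, and what remains is
  the contradiction that \<open>(s - c)\<^sup>2 + 1 = 0\<close> for a real number \<open>s\<close>.
\<close>

subsection \<open>Smooth functions\<close>

text \<open>One number governs the whole proof. If \<open>\<Gamma>\<^sub>1\<^sub>1\<^sup>2\<close>
  and \<open>\<Gamma>\<^sub>1\<^sub>2\<^sup>2\<close> vanish, the only Ricci component that can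
  survive is the one at (\<open>e2\<close>, \<open>e2\<close>), and it equals
  \<open>e * a + F * c - c\<^sup>2\<close>. For \<open>M2 c\<close> and \<open>M3 c\<close> it is
  \<open>c\<^sup>2 + c\<close>, which explains the admissible parameters; for \<open>M1\<close> and
  \<open>M4 c\<close> it is 1, for \<open>M5 c\<close> it is \<open>1 + c\<^sup>2\<close>. Why
  \<open>M5 c\<close> is the exception for Type B: the connections C / x1 have the Killing fields X
  = d/dx2 and Y = x1 d/dx1 + x2 d/dx2, which are independent where x1 is nonzero and satisfy [X, Y]
  = X. In the algebra of \<open>M5 c\<close> such an X lies in the derived algebra, hence is a
  multiple of d/dx1, and a field with nonzero d/dx2-part acts there with non-real eigenvalues; so Y
  would be a multiple of d/dx1 as well. A chart is only local, whereas \<open>killing\<close>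
  concerns fields on the whole plane. The proof therefore works with the integrability conditions of
  the chart itself.\<close>

definition ddir :: "'a \<Rightarrow> ('a::real_normed_vector \<Rightarrow> 'b::real_normed_vector) \<Rightarrow> 'a \<Rightarrow> 'b" where
  "ddir v f p = frechet_derivative f (at p) v"

lemma Ck_on_SucD:
  assumes "Ck_on (Suc n) U f"
  shows "p \<in> U \<Longrightarrow> f differentiable (at p)" "Ck_on n U (ddir v f)"
  using assms by (auto simp: ddir_def[abs_def])

lemma Ck_on_SucI:
  assumes "\<And>p. p \<in> U \<Longrightarrow> f differentiable (at p)" "\<And>v. Ck_on n U (ddir v f)"
  shows "Ck_on (Suc n) U f"
  using assms by (auto simp: ddir_def[abs_def])

lemma ddir_eqI: "(f has_derivative f') (at p) \<Longrightarrow> ddir v f p = f' v"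
  by (simp add: ddir_def frechet_derivative_at[symmetric])

lemma has_derivative_ddir:
  assumes "f differentiable (at p)"
  shows "(f has_derivative (\<lambda>v. ddir v f p)) (at p)"
  using assms by (simp add: ddir_def frechet_derivative_works)

lemma ddir_cong:
  assumes "open U" "p \<in> U" "\<And>q. q \<in> U \<Longrightarrow> f q = g q"
  shows "ddir v f p = ddir v g p"
proof -
  have "(f has_derivative D) (at p) \<longleftrightarrow> (g has_derivative D) (at p)" for D
    using assms has_derivative_transform_within_open[of f D p UNIV U g]
      has_derivative_transform_within_open[of g D p UNIV U f] by auto
  then show ?thesis
    by (simp add: ddir_def frechet_derivative_def)
qed

lemma differentiable_cong_open:
  assumes "open U" "p \<in> U" "\<And>q. q \<in> U \<Longrightarrow> f q = g q" "f differentiable (at p)"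
  shows "g differentiable (at p)"
  using assms has_derivative_transform_within_open[of f _ p UNIV U g]
  by (auto simp: differentiable_def)

lemma Ck_on_cong:
  assumes "open U" "\<And>q. q \<in> U \<Longrightarrow> f q = g q" "Ck_on n U f"
  shows "Ck_on n U g"
  using assms(2,3)
proof (induction n arbitrary: f g)
  case 0
  then show ?case using continuous_on_cong[of U U f g] by simp
next
  case (Suc n)
  show ?case
  proof (rule Ck_on_SucI)
    show "g differentiable (at p)" if "p \<in> U" for p
      by (rule differentiable_cong_open[OF assms(1) that Suc.prems(1) Ck_on_SucD(1)[OF Suc.prems(2) that]])
    show "Ck_on n U (ddir v g)" for v
      by (rule Suc.IH[OF _ Ck_on_SucD(2)[OF Suc.prems(2), of v]])
         (rule ddir_cong[OF assms(1) _ Suc.prems(1)])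
  qed
qed

lemma Ck_on_Suc_mono: "Ck_on (Suc n) U f \<Longrightarrow> Ck_on n U f"
proof (induction n arbitrary: f)
  case 0
  then have "f differentiable_on U"
    by (auto simp: differentiable_on_def intro: differentiable_at_withinI)
  then show ?case
    by (simp add: differentiable_imp_continuous_on)
next
  case (Suc n)
  show ?case
    by (rule Ck_on_SucI) (use Suc Ck_on_SucD in blast)+
qed

lemma Ck_on_subset: "Ck_on n U f \<Longrightarrow> V \<subseteq> U \<Longrightarrow> Ck_on n V f"
proof (induction n arbitrary: f)
  case (Suc n)
  show ?case
    by (rule Ck_on_SucI) (use Suc Ck_on_SucD in blast)+
qed (auto intro: continuous_on_subset)

lemma Ck_on_const: "Ck_on n U (\<lambda>_. c)"
proof (induction n arbitrary: c)
  case (Suc n)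
  show ?case
    by (rule Ck_on_SucI) (use Suc in \<open>auto simp: ddir_def[abs_def]\<close>)
qed simp

lemma Ck_on_bounded_linear: "bounded_linear h \<Longrightarrow> Ck_on n U h"
proof (cases n)
  case (Suc m)
  assume h: "bounded_linear h"
  have d: "(h has_derivative h) (at p)" for p
    by (rule bounded_linear_imp_has_derivative[OF h])
  have "ddir v h = (\<lambda>_. h v)" for v
    using ddir_eqI[OF d] by (auto simp: fun_eq_iff)
  then show ?thesis
    unfolding Suc using d by (intro Ck_on_SucI) (auto simp: differentiable_def intro: Ck_on_const)
qed (simp add: linear_continuous_on)

lemma Ck_on_compose_bounded_linear:
  assumes "open U" "bounded_linear h" "Ck_on n U f"
  shows "Ck_on n U (\<lambda>p. h (f p))"
  using assms(3)
proof (induction n arbitrary: f)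
  case 0
  then show ?case
    by (simp add: bounded_linear.continuous_on[OF assms(2)])
next
  case (Suc n)
  have d: "((\<lambda>p. h (f p)) has_derivative (\<lambda>v. h (ddir v f p))) (at p)" if "p \<in> U" for p
    by (rule bounded_linear.has_derivative[OF assms(2) has_derivative_ddir[OF Ck_on_SucD(1)[OF Suc.prems that]]])
  show ?case
  proof (rule Ck_on_SucI)
    show "Ck_on n U (ddir v (\<lambda>p. h (f p)))" for v
      by (rule Ck_on_cong[OF assms(1) _ Suc.IH[OF Ck_on_SucD(2)[OF Suc.prems, of v]]])
         (simp add: ddir_eqI[OF d])
  qed (use d in \<open>auto simp: differentiable_def\<close>)
qed

lemma Ck_on_add:
  assumes "open U" "Ck_on n U f" "Ck_on n U g"
  shows "Ck_on n U (\<lambda>p. f p + g p)"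
  using assms(2,3)
proof (induction n arbitrary: f g)
  case (Suc n)
  have d: "((\<lambda>p. f p + g p) has_derivative (\<lambda>v. ddir v f p + ddir v g p)) (at p)" if "p \<in> U" for p
    using Suc.prems that by (intro has_derivative_add has_derivative_ddir Ck_on_SucD(1))
  show ?case
  proof (rule Ck_on_SucI)
    show "Ck_on n U (ddir v (\<lambda>p. f p + g p))" for v
      by (rule Ck_on_cong[OF assms(1) _ Suc.IH[OF Ck_on_SucD(2)[OF Suc.prems(1), of v]
              Ck_on_SucD(2)[OF Suc.prems(2), of v]]])
         (simp add: ddir_eqI[OF d])
  qed (use d in \<open>auto simp: differentiable_def\<close>)
qed (auto intro: continuous_on_add)

lemma Ck_on_bilinear:
  assumes "open U" "bounded_bilinear b" "Ck_on n U f" "Ck_on n U g"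
  shows "Ck_on n U (\<lambda>p. b (f p) (g p))"
  using assms(3,4)
proof (induction n arbitrary: f g)
  case 0
  then show ?case by (simp add: bounded_bilinear.continuous_on[OF assms(2)])
next
  case (Suc n)
  have d: "((\<lambda>p. b (f p) (g p)) has_derivative (\<lambda>v. b (f p) (ddir v g p) + b (ddir v f p) (g p))) (at p)"
    if "p \<in> U" for p
    using Suc.prems that
    by (intro bounded_bilinear.FDERIV[OF assms(2)] has_derivative_ddir Ck_on_SucD(1))
  show ?case
  proof (rule Ck_on_SucI)
    show "Ck_on n U (ddir v (\<lambda>p. b (f p) (g p)))" for v
      by (rule Ck_on_cong[OF assms(1) _ Ck_on_add[OF assms(1)
              Suc.IH[OF Ck_on_Suc_mono[OF Suc.prems(1)] Ck_on_SucD(2)[OF Suc.prems(2), of v]]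
              Suc.IH[OF Ck_on_SucD(2)[OF Suc.prems(1), of v] Ck_on_Suc_mono[OF Suc.prems(2)]]]])
         (simp add: ddir_eqI[OF d])
  qed (use d in \<open>auto simp: differentiable_def\<close>)
qed

text \<open>The derivative of the composite is (h' o f) times \<open>ddir v f\<close>. Only
  \<open>h\<close> varies in the induction: the hypothesis is applied to h' with \<open>f\<close>
  unchanged, at one order less.\<close>

lemma Ck_on_compose_real:
  fixes h :: "real \<Rightarrow> real"
  assumes "open U" "f ` U \<subseteq> S" "Ck_on n S h" "Ck_on n U f"
  shows "Ck_on n U (\<lambda>p. h (f p))"
  using assms(3,4)
proof (induction n arbitrary: h)
  case 0
  then show ?case using assms(2) by (simp add: continuous_on_compose2)
next
  case (Suc n)
  have h: "(h has_derivative (\<lambda>v. ddir 1 h t * v)) (at t)" if "t \<in> S" for t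
  proof -
    have "h differentiable (at t)" using Suc.prems that by (auto dest: Ck_on_SucD)
    then show ?thesis
      by (metis (no_types, lifting) ddir_eqI has_field_derivative_imp_has_derivative mult.right_neutral
          real_differentiable_def)
  qed
  have d: "((\<lambda>p. h (f p)) has_derivative (\<lambda>v. ddir 1 h (f p) * ddir v f p)) (at p)"
    if "p \<in> U" for p
    using has_derivative_compose[OF has_derivative_ddir[OF Ck_on_SucD(1)[OF Suc.prems(2) that]] h[of "f p"]]
      that assms(2) by auto
  show ?case
  proof (rule Ck_on_SucI)
    show "Ck_on n U (ddir v (\<lambda>p. h (f p)))" for v
      by (rule Ck_on_cong[OF assms(1) _ Ck_on_bilinear[OF assms(1) bounded_bilinear_mult
              Suc.IH[OF Ck_on_SucD(2)[OF Suc.prems(1), of 1] Ck_on_Suc_mono[OF Suc.prems(2)]]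
              Ck_on_SucD(2)[OF Suc.prems(2), of v]]])
         (simp add: ddir_eqI[OF d])
  qed (use d in \<open>auto simp: differentiable_def\<close>)
qed

lemma smooth_on_const: "smooth_on U (\<lambda>_. c)"
  and smooth_on_bounded_linear: "bounded_linear h \<Longrightarrow> smooth_on U h"
  by (simp_all add: smooth_on_def Ck_on_const Ck_on_bounded_linear)

lemma smooth_on_cong:
  "open U \<Longrightarrow> (\<And>q. q \<in> U \<Longrightarrow> f q = g q) \<Longrightarrow> smooth_on U f \<Longrightarrow> smooth_on U g"
  unfolding smooth_on_def by (intro allI Ck_on_cong[of U f g]) auto

lemma smooth_on_compose_bounded_linear:
  "open U \<Longrightarrow> bounded_linear h \<Longrightarrow> smooth_on U f \<Longrightarrow> smooth_on U (\<lambda>p. h (f p))"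
  by (auto simp: smooth_on_def intro: Ck_on_compose_bounded_linear)

lemma smooth_on_add:
  "open U \<Longrightarrow> smooth_on U f \<Longrightarrow> smooth_on U g \<Longrightarrow> smooth_on U (\<lambda>p. f p + g p)"
  by (auto simp: smooth_on_def intro: Ck_on_add)

lemma smooth_on_minus: "open U \<Longrightarrow> smooth_on U f \<Longrightarrow> smooth_on U (\<lambda>p. - f p)"
  by (rule smooth_on_compose_bounded_linear[OF _ bounded_linear_minus[OF bounded_linear_ident]])

lemma smooth_on_diff:
  "open U \<Longrightarrow> smooth_on U f \<Longrightarrow> smooth_on U g \<Longrightarrow> smooth_on U (\<lambda>p. f p - g p)"
  using smooth_on_add[of U f "\<lambda>p. - g p"] by (simp add: smooth_on_minus)

lemma smooth_on_scaleR:
  "open U \<Longrightarrow> smooth_on U f \<Longrightarrow> smooth_on U g \<Longrightarrow> smooth_on U (\<lambda>p. f p *\<^sub>R g p)"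
  by (auto simp: smooth_on_def intro: Ck_on_bilinear[OF _ bounded_bilinear_scaleR])

lemma smooth_on_mult:
  fixes f g :: "_ \<Rightarrow> real"
  shows "open U \<Longrightarrow> smooth_on U f \<Longrightarrow> smooth_on U g \<Longrightarrow> smooth_on U (\<lambda>p. f p * g p)"
  by (auto simp: smooth_on_def intro: Ck_on_bilinear[OF _ bounded_bilinear_mult])

lemma smooth_on_power:
  fixes f :: "_ \<Rightarrow> real"
  shows "open U \<Longrightarrow> smooth_on U f \<Longrightarrow> smooth_on U (\<lambda>p. f p ^ n)"
  by (induction n) (auto intro: smooth_on_mult smooth_on_const)

lemma smooth_on_nth: "open U \<Longrightarrow> smooth_on U f \<Longrightarrow> smooth_on U (\<lambda>p. f p $ i)"
  for f :: "_ \<Rightarrow> real^'n"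
  by (rule smooth_on_compose_bounded_linear[OF _ bounded_linear_vec_nth])

lemma smooth_on_coord: "smooth_on U (\<lambda>p :: real^'n. p $ i)"
  by (rule smooth_on_bounded_linear[OF bounded_linear_vec_nth])

section \<open>Smoothness of elementary real functions\<close>

text \<open>The derivatives of exp, sin, cos, inverse and ln are expressions in functions of the
  same list, so induction on the order with this step proves each of them smooth.\<close>

lemma Ck_on_real_step:
  fixes h :: "real \<Rightarrow> real"
  assumes "open S" "\<And>t. t \<in> S \<Longrightarrow> (h has_real_derivative h' t) (at t)" "Ck_on n S h'"
  shows "Ck_on (Suc n) S h"
proof -
  have d: "(h has_derivative (\<lambda>v. v *\<^sub>R h' t)) (at t)" if "t \<in> S" for t
    using assms(2)[OF that] by (simp add: has_field_derivative_def mult_commute_abs)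
  show ?thesis
  proof (rule Ck_on_SucI)
    show "Ck_on n S (ddir v h)" for v
      by (rule Ck_on_cong[OF assms(1) _ Ck_on_compose_bounded_linear[OF assms(1)
          bounded_linear_scaleR_right[of v] assms(3)]])
        (simp add: ddir_eqI[OF d])
  qed (use d in \<open>auto simp: differentiable_def\<close>)
qed

lemma Ck_on_exp: "Ck_on n UNIV (exp :: real \<Rightarrow> real)"
proof (induction n)
  case (Suc n)
  show ?case by (rule Ck_on_real_step[OF open_UNIV DERIV_exp Suc])
qed (simp add: continuous_on_exp)

lemma Ck_on_sin_cos: "Ck_on n UNIV (sin :: real \<Rightarrow> real) \<and> Ck_on n UNIV (cos :: real \<Rightarrow> real)"
proof (induction n)
  case (Suc n)
  have m: "Ck_on n UNIV (\<lambda>t::real. - sin t)"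
    by (rule Ck_on_compose_bounded_linear[OF open_UNIV bounded_linear_minus[OF bounded_linear_ident]])
       (use Suc in simp)
  show ?case
    using Ck_on_real_step[OF open_UNIV DERIV_sin] Ck_on_real_step[OF open_UNIV DERIV_cos m] Suc
    by blast
qed (simp add: continuous_on_sin continuous_on_cos)

lemma Ck_on_inverse: "Ck_on n (-{0}) (inverse :: real \<Rightarrow> real)"
proof (induction n)
  case (Suc n)
  have o: "open (-{0::real})" by (simp add: open_Compl)
  have m: "Ck_on n (-{0}) (\<lambda>t::real. - (inverse t * inverse t))"
    by (rule Ck_on_compose_bounded_linear[OF o bounded_linear_minus[OF bounded_linear_ident]])
       (rule Ck_on_bilinear[OF o bounded_bilinear_mult Suc Suc])
  show ?case
    by (rule Ck_on_real_step[OF o _ m]) (auto intro!: derivative_eq_intros)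
qed (simp add: continuous_on_inverse)

lemma Ck_on_ln: "Ck_on n {0<..} (ln :: real \<Rightarrow> real)"
proof (cases n)
  case (Suc m)
  have m: "Ck_on m {0<..} (inverse :: real \<Rightarrow> real)"
    by (rule Ck_on_subset[OF Ck_on_inverse]) auto
  show ?thesis unfolding Suc
    by (rule Ck_on_real_step[OF open_greaterThan _ m]) (auto intro: DERIV_ln)
qed (auto intro!: continuous_intros)

lemma smooth_on_compose_real:
  fixes h :: "real \<Rightarrow> real"
  assumes "open U" "f ` U \<subseteq> S" "\<And>n. Ck_on n S h" "smooth_on U f"
  shows "smooth_on U (\<lambda>p. h (f p))"
  unfolding smooth_on_def
proof
  show "Ck_on n U (\<lambda>p. h (f p))" for n
    using Ck_on_compose_real[OF assms(1,2,3)] assms(4) unfolding smooth_on_def by blast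
qed

lemma smooth_on_exp: "open U \<Longrightarrow> smooth_on U f \<Longrightarrow> smooth_on U (\<lambda>p. exp (f p :: real))"
  by (rule smooth_on_compose_real[OF _ subset_UNIV Ck_on_exp])

lemma smooth_on_sin: "open U \<Longrightarrow> smooth_on U f \<Longrightarrow> smooth_on U (\<lambda>p. sin (f p :: real))"
  by (rule smooth_on_compose_real[OF _ subset_UNIV conjunct1[OF Ck_on_sin_cos]])

lemma smooth_on_cos: "open U \<Longrightarrow> smooth_on U f \<Longrightarrow> smooth_on U (\<lambda>p. cos (f p :: real))"
  by (rule smooth_on_compose_real[OF _ subset_UNIV conjunct2[OF Ck_on_sin_cos]])

lemma smooth_on_ln:
  assumes "open U" "\<And>p. p \<in> U \<Longrightarrow> f p > 0" "smooth_on U f"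
  shows "smooth_on U (\<lambda>p. ln (f p :: real))"
  by (rule smooth_on_compose_real[OF assms(1) _ Ck_on_ln assms(3)]) (use assms(2) in auto)

lemma smooth_on_inverse:
  assumes "open U" "\<And>p. p \<in> U \<Longrightarrow> f p \<noteq> 0" "smooth_on U f"
  shows "smooth_on U (\<lambda>p. inverse (f p :: real))"
  by (rule smooth_on_compose_real[OF assms(1) _ Ck_on_inverse assms(3)]) (use assms(2) in auto)

lemmas smooth_intros = smooth_on_const smooth_on_add smooth_on_minus smooth_on_diff smooth_on_scaleR
  smooth_on_mult smooth_on_power smooth_on_nth smooth_on_coord smooth_on_exp smooth_on_sin smooth_on_cos
  smooth_on_ln smooth_on_inverse

lemma smooth_onD: "smooth_on U f \<Longrightarrow> Ck_on n U f"
  by (simp add: smooth_on_def)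

lemma smooth_on_ddir:
  assumes "smooth_on U f"
  shows "smooth_on U (ddir v f)"
  unfolding smooth_on_def
proof
  show "Ck_on n U (ddir v f)" for n
    by (rule Ck_on_SucD(2)[OF smooth_onD[OF assms]])
qed

lemma smooth_on_differentiable: "smooth_on U f \<Longrightarrow> p \<in> U \<Longrightarrow> f differentiable (at p)"
  by (rule Ck_on_SucD(1)[OF smooth_onD])

lemma smooth_on_has_derivative:
  "smooth_on U f \<Longrightarrow> p \<in> U \<Longrightarrow> (f has_derivative (\<lambda>v. ddir v f p)) (at p)"
  by (rule has_derivative_ddir[OF smooth_on_differentiable])

lemma smooth_on_continuous: "smooth_on U f \<Longrightarrow> continuous_on U f"
  using smooth_onD[of U f 0] by simp

section \<open>Symmetry of second derivatives\<close>

lemma mean_value_ddir: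
  fixes f :: "'a::real_normed_vector \<Rightarrow> real"
  assumes "0 < h" "\<And>s. 0 \<le> s \<Longrightarrow> s \<le> h \<Longrightarrow> f differentiable (at (p + s *\<^sub>R u))"
  shows "\<exists>s. 0 < s \<and> s < h \<and> f (p + h *\<^sub>R u) - f p = h * ddir u f (p + s *\<^sub>R u)"
proof -
  have d: "((\<lambda>s. f (p + s *\<^sub>R u)) has_real_derivative ddir u f (p + s *\<^sub>R u)) (at s)"
    if "0 \<le> s" "s \<le> h" for s
  proof -
    let ?q = "p + s *\<^sub>R u"
    have f: "(f has_derivative (\<lambda>v. ddir v f ?q)) (at ?q)"
      by (rule has_derivative_ddir[OF assms(2)[OF that]])
    have a: "((\<lambda>s. p + s *\<^sub>R u) has_derivative (\<lambda>t. t *\<^sub>R u)) (at s)"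
      using has_derivative_add[OF has_derivative_const[of p]
          has_derivative_scaleR_left[OF has_derivative_ident, of u]] by simp
    have "(\<lambda>t. ddir (t *\<^sub>R u) f ?q) = (*) (ddir u f ?q)"
      using linear_cmul[OF has_derivative_linear[OF f]] by (simp add: fun_eq_iff)
    then show ?thesis
      using has_derivative_compose[OF a f] by (simp add: has_field_derivative_def)
  qed
  show ?thesis
    using MVT2[OF assms(1), of "\<lambda>s. f (p + s *\<^sub>R u)" "\<lambda>s. ddir u f (p + s *\<^sub>R u)"] d by simp
qed

text \<open>The left-hand side is symmetric in \<open>u\<close> and \<open>v\<close>, while the mean
  value theorem used twice turns it into a mixed derivative in a chosen order at a nearby
  point.\<close>

lemma second_difference:
  fixes f :: "'a::real_normed_vector \<Rightarrow> real"
  assumes U: "ball p e \<subseteq> U" and f: "smooth_on U f" and h: "0 < h" "h * (norm u + norm v) < e"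
  shows "\<exists>\<xi>. dist p \<xi> < e \<and>
    f (p + h *\<^sub>R u + h *\<^sub>R v) - f (p + h *\<^sub>R u) - f (p + h *\<^sub>R v) + f p = h * h * ddir v (ddir u f) \<xi>"
proof -
  have near: "dist p (p + s *\<^sub>R u + t *\<^sub>R v) < e" if "0 \<le> s" "s \<le> h" "0 \<le> t" "t \<le> h" for s t
  proof -
    have "norm (s *\<^sub>R u + t *\<^sub>R v) \<le> s * norm u + t * norm v"
      using norm_triangle_ineq[of "s *\<^sub>R u" "t *\<^sub>R v"] that by simp
    also have "\<dots> \<le> h * (norm u + norm v)"
      using that by (simp add: distrib_left add_mono mult_right_mono)
    finally show ?thesis using h by (simp add: dist_norm norm_minus_commute add.assoc)
       (metis add.commute minus_add_distrib norm_minus_cancel order_le_less_trans uminus_add_conv_diff)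
  qed
  then have inU: "p + s *\<^sub>R u + t *\<^sub>R v \<in> U" if "0 \<le> s" "s \<le> h" "0 \<le> t" "t \<le> h" for s t
    using that U by auto
  \<comment> \<open>The second difference is a first difference of \<open>g\<close> along
    \<open>u\<close>. After one mean value step for \<open>g\<close>, the second is taken along
    \<open>v\<close> for \<open>ddir u f\<close>.\<close>
  define g where "g = (\<lambda>x. f (x + h *\<^sub>R v) - f x)"
  have dg: "(g has_derivative (\<lambda>w. ddir w f (p + s *\<^sub>R u + h *\<^sub>R v) - ddir w f (p + s *\<^sub>R u))) (at (p + s *\<^sub>R u))"
    if "0 \<le> s" "s \<le> h" for s
  proof -
    have "((\<lambda>x. f (x + h *\<^sub>R v)) has_derivative (\<lambda>w. ddir w f (p + s *\<^sub>R u + h *\<^sub>R v))) (at (p + s *\<^sub>R u))"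
      using has_derivative_compose[of "\<lambda>x. x + h *\<^sub>R v" "\<lambda>w. w" "p + s *\<^sub>R u" UNIV f,
          OF _ smooth_on_has_derivative[OF f inU[OF that, of h]]] h
      by (simp add: has_derivative_add_const)
    then show ?thesis unfolding g_def
      by (rule has_derivative_diff)
         (use smooth_on_has_derivative[OF f inU[OF that, of 0]] h in auto)
  qed
  obtain s where s: "0 < s" "s < h" "g (p + h *\<^sub>R u) - g p = h * ddir u g (p + s *\<^sub>R u)"
    using mean_value_ddir[OF h(1), of g p u] dg by (auto simp: differentiable_def)
  obtain t where t: "0 < t" "t < h" "ddir u f (p + s *\<^sub>R u + h *\<^sub>R v) - ddir u f (p + s *\<^sub>R u)
      = h * ddir v (ddir u f) (p + s *\<^sub>R u + t *\<^sub>R v)"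
    using mean_value_ddir[OF h(1), of "ddir u f" "p + s *\<^sub>R u" v] s inU
      smooth_on_differentiable[OF smooth_on_ddir[OF f, of u]] by auto
  have "g (p + h *\<^sub>R u) - g p = h * h * ddir v (ddir u f) (p + s *\<^sub>R u + t *\<^sub>R v)"
    using s t ddir_eqI[OF dg, of s u] by simp
  then show ?thesis
    using near[of s t] s t by (intro exI[of _ "p + s *\<^sub>R u + t *\<^sub>R v"]) (auto simp: g_def algebra_simps)
qed

text \<open>Both mixed derivatives take the value of the same second difference at points close to
  \<open>p\<close>; by continuity they cannot differ at \<open>p\<close>.\<close>

lemma ddir_commute_real:
  fixes f :: "'a::real_normed_vector \<Rightarrow> real"
  assumes U: "open U" "p \<in> U" and f: "smooth_on U f"
  shows "ddir u (ddir v f) p = ddir v (ddir u f) p"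
proof (rule ccontr)
  let ?A = "ddir u (ddir v f)" and ?B = "ddir v (ddir u f)"
  assume ne: "?A p \<noteq> ?B p"
  define \<epsilon> where "\<epsilon> = \<bar>?A p - ?B p\<bar> / 2"
  have \<epsilon>: "\<epsilon> > 0" using ne by (simp add: \<epsilon>_def)
  have "isCont ?A p" "isCont ?B p"
    using U smooth_on_continuous[OF smooth_on_ddir[OF smooth_on_ddir[OF f]]]
    by (auto simp: continuous_on_eq_continuous_at)
  then obtain d1 d2 where d: "d1 > 0" "\<And>x. dist p x < d1 \<Longrightarrow> \<bar>?A x - ?A p\<bar> < \<epsilon>"
     "d2 > 0" "\<And>x. dist p x < d2 \<Longrightarrow> \<bar>?B x - ?B p\<bar> < \<epsilon>"
    using \<epsilon> unfolding continuous_at_eps_delta by (metis dist_commute dist_real_def)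
  obtain e0 where e0: "e0 > 0" "ball p e0 \<subseteq> U" using U openE by blast
  define e where "e = min e0 (min d1 d2)"
  have e: "e > 0" "ball p e \<subseteq> U" using e0 d by (auto simp: e_def)
  \<comment> \<open>The summand 1 keeps the denominator positive when \<open>u\<close> and
    \<open>v\<close> vanish and makes the bound \<open>h * (norm u + norm v) < e\<close>
    strict.\<close>
  define h where "h = e / (norm u + norm v + 1)"
  have den: "norm u + norm v + 1 > 0" by (simp add: add_nonneg_pos)
  have h: "h > 0" using e den by (simp add: h_def)
  have "h * (norm u + norm v + 1) = e" using den by (simp add: h_def)
  then have h': "h * (norm u + norm v) < e" using h by (simp add: algebra_simps)
  obtain x where x: "dist p x < e"
    "f (p + h *\<^sub>R u + h *\<^sub>R v) - f (p + h *\<^sub>R u) - f (p + h *\<^sub>R v) + f p = h * h * ?B x"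
    using second_difference[OF e(2) f h h'] by blast
  obtain y where y: "dist p y < e"
    "f (p + h *\<^sub>R v + h *\<^sub>R u) - f (p + h *\<^sub>R v) - f (p + h *\<^sub>R u) + f p = h * h * ?A y"
    using second_difference[OF e(2) f h, of v u] h' by (auto simp: add.commute)
  have e: "p + h *\<^sub>R v + h *\<^sub>R u = p + h *\<^sub>R u + h *\<^sub>R v" by simp
  have "h * h * ?B x = h * h * ?A y"
    using x(2) y(2)[unfolded e] by linarith
  then have "?B x = ?A y" using h by simp
  moreover have "\<bar>?A y - ?A p\<bar> < \<epsilon>" "\<bar>?B x - ?B p\<bar> < \<epsilon>" using x y d by (auto simp: e_def)
  ultimately show False unfolding \<epsilon>_def by (auto simp: abs_if split: if_splits)
qed

lemma ddir_bounded_linear: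
  assumes "bounded_linear h" "f differentiable (at p)"
  shows "ddir v (\<lambda>q. h (f q)) p = h (ddir v f p)"
  by (rule ddir_eqI[OF bounded_linear.has_derivative[OF assms(1) has_derivative_ddir[OF assms(2)]]])

lemma ddir_ddir_bounded_linear:
  assumes U: "open U" "p \<in> U" and f: "smooth_on U f" and h: "bounded_linear h"
  shows "ddir u (ddir v (\<lambda>q. h (f q))) p = h (ddir u (ddir v f) p)"
proof -
  have "ddir u (ddir v (\<lambda>q. h (f q))) p = ddir u (\<lambda>q. h (ddir v f q)) p"
    by (rule ddir_cong[OF U]) (rule ddir_bounded_linear[OF h smooth_on_differentiable[OF f]])
  also have "\<dots> = h (ddir u (ddir v f) p)"
    by (rule ddir_bounded_linear[OF h smooth_on_differentiable[OF smooth_on_ddir[OF f] U(2)]])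
  finally show ?thesis .
qed

lemma ddir_commute:
  fixes f :: "'a::real_normed_vector \<Rightarrow> 'b::euclidean_space"
  assumes U: "open U" "p \<in> U" and f: "smooth_on U f"
  shows "ddir u (ddir v f) p = ddir v (ddir u f) p"
proof (rule euclidean_eqI)
  fix b :: 'b
  have b: "bounded_linear (\<lambda>x. x \<bullet> b)" by (rule bounded_linear_inner_left)
  show "ddir u (ddir v f) p \<bullet> b = ddir v (ddir u f) p \<bullet> b"
    using ddir_commute_real[OF U smooth_on_compose_bounded_linear[OF U(1) b f], of u v]
    by (simp add: ddir_ddir_bounded_linear[OF U f b])
qed

subsection \<open>The plane\<close>

abbreviation "e1 \<equiv> axis 1 1 :: real^2"
abbreviation "e2 \<equiv> axis 2 1 :: real^2"

lemma plane_basis: "v = v $ 1 *\<^sub>R e1 + v $ 2 *\<^sub>R e2" for v :: "real^2"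
  by (simp add: vec_eq_iff forall_2 axis_def)

lemma axis_nth_2 [simp]:
  "e1 $ 1 = 1" "e1 $ 2 = 0" "e2 $ 1 = 0" "e2 $ 2 = 1"
  by (simp_all add: axis_def)

lemma ddir_linear:
  assumes "f differentiable (at p)"
  shows "linear (\<lambda>v. ddir v f p)"
  by (rule has_derivative_linear[OF has_derivative_ddir[OF assms]])

lemma ddir_plane:
  fixes f :: "real^2 \<Rightarrow> 'b::real_normed_vector"
  assumes "f differentiable (at p)"
  shows "ddir v f p = v $ 1 *\<^sub>R ddir e1 f p + v $ 2 *\<^sub>R ddir e2 f p"
proof -
  interpret linear "\<lambda>v. ddir v f p" by (rule ddir_linear[OF assms])
  show ?thesis
    by (subst plane_basis[of v]) (simp only: add scaleR)
qed

lemma ddir_ddir_plane: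
  fixes f :: "real^2 \<Rightarrow> 'b::real_normed_vector"
  assumes U: "open U" "p \<in> U" and f: "smooth_on U f"
  shows "ddir u (ddir v f) p = v $ 1 *\<^sub>R ddir u (ddir e1 f) p + v $ 2 *\<^sub>R ddir u (ddir e2 f) p"
proof -
  have "ddir u (ddir v f) p = ddir u (\<lambda>q. v $ 1 *\<^sub>R ddir e1 f q + v $ 2 *\<^sub>R ddir e2 f q) p"
    by (rule ddir_cong[OF U]) (rule ddir_plane[OF smooth_on_differentiable[OF f]])
  also have "\<dots> = v $ 1 *\<^sub>R ddir u (ddir e1 f) p + v $ 2 *\<^sub>R ddir u (ddir e2 f) p"
    by (rule ddir_eqI[of _ "\<lambda>u. v $ 1 *\<^sub>R ddir u (ddir e1 f) p + v $ 2 *\<^sub>R ddir u (ddir e2 f) p"])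
       (intro has_derivative_add has_derivative_scaleR_right smooth_on_has_derivative[OF smooth_on_ddir[OF f] U(2)])
  finally show ?thesis .
qed

text \<open>Leibniz rule for differentiating along a varying field: one term freezes the field at
  \<open>p\<close>, the other differentiates it. Expanding in the basis separates the point from the
  direction.\<close>

lemma has_derivative_ddir_field:
  fixes f :: "real^2 \<Rightarrow> 'b::real_normed_vector"
  assumes U: "open U" "p \<in> U" and f: "smooth_on U f" and Y: "(Y has_derivative Y') (at p)"
  shows "((\<lambda>q. ddir (Y q) f q) has_derivative (\<lambda>u. ddir u (ddir (Y p) f) p + ddir (Y' u) f p)) (at p)"
proof -
  have Yi: "((\<lambda>q. Y q $ i) has_derivative (\<lambda>u. Y' u $ i)) (at p)" for i
    by (rule bounded_linear.has_derivative[OF bounded_linear_vec_nth Y])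
  have fi: "(ddir v f has_derivative (\<lambda>u. ddir u (ddir v f) p)) (at p)" for v
    by (rule smooth_on_has_derivative[OF smooth_on_ddir[OF f] U(2)])
  have "((\<lambda>q. Y q $ 1 *\<^sub>R ddir e1 f q + Y q $ 2 *\<^sub>R ddir e2 f q) has_derivative
     (\<lambda>u. (Y p $ 1 *\<^sub>R ddir u (ddir e1 f) p + Y' u $ 1 *\<^sub>R ddir e1 f p) +
          (Y p $ 2 *\<^sub>R ddir u (ddir e2 f) p + Y' u $ 2 *\<^sub>R ddir e2 f p))) (at p)"
    by (intro has_derivative_add has_derivative_scaleR Yi fi)
  moreover have "(Y p $ 1 *\<^sub>R ddir u (ddir e1 f) p + Y' u $ 1 *\<^sub>R ddir e1 f p) +
          (Y p $ 2 *\<^sub>R ddir u (ddir e2 f) p + Y' u $ 2 *\<^sub>R ddir e2 f p)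
      = ddir u (ddir (Y p) f) p + ddir (Y' u) f p" for u
    using ddir_ddir_plane[OF U f, of u "Y p"] ddir_plane[OF smooth_on_differentiable[OF f U(2)], of "Y' u"]
    by simp
  ultimately have "((\<lambda>q. Y q $ 1 *\<^sub>R ddir e1 f q + Y q $ 2 *\<^sub>R ddir e2 f q) has_derivative
     (\<lambda>u. ddir u (ddir (Y p) f) p + ddir (Y' u) f p)) (at p)" by simp
  then show ?thesis
    by (rule has_derivative_transform_within_open[OF _ U])
       (rule ddir_plane[OF smooth_on_differentiable[OF f], symmetric])
qed

section \<open>The Killing equation and the transformation law in coordinates\<close>

definition chr :: "christoffel \<Rightarrow> real^2 \<Rightarrow> real^2 \<Rightarrow> real^2" where
  "chr G u v = (\<chi> k. \<Sum>i\<in>UNIV. \<Sum>j\<in>UNIV. G i j k * u $ i * v $ j)"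

lemma chr_nth:
  "chr G u v $ k = G 1 1 k * u $ 1 * v $ 1 + G 1 2 k * u $ 1 * v $ 2
     + (G 2 1 k * u $ 2 * v $ 1 + G 2 2 k * u $ 2 * v $ 2)"
  by (simp add: chr_def UNIV_2)

lemma bounded_bilinear_chr: "bounded_bilinear (chr G)"
proof -
  have l: "linear (\<lambda>v. chr G u v)" "linear (\<lambda>v. chr G v u)" for u
    by (rule linearI; simp add: vec_eq_iff chr_nth algebra_simps)+
  have "bilinear (chr G)" unfolding bilinear_def using l by blast
  then show ?thesis by (simp add: bilinear_conv_bounded_bilinear)
qed

interpretation chr: bounded_bilinear "chr G" for G
  by (rule bounded_bilinear_chr)

lemma cov_eq: "cov \<Gamma> X Y p = ddir (X p) Y p + chr (\<Gamma> p) (X p) (Y p)"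
  by (simp add: cov_def ddir_def chr_def)

lemma bracket_eq: "bracket X Y p = ddir (X p) Y p - ddir (Y p) X p"
  by (simp add: bracket_def ddir_def)

lemma ddir_const [simp]: "ddir v (\<lambda>_. c) p = 0"
  by (simp add: ddir_def)

lemma ddir_zero [simp]: "f differentiable (at p) \<Longrightarrow> ddir 0 f p = 0"
  using linear_0[OF ddir_linear] by blast

text \<open>All derivatives of \<open>Y\<close> and \<open>Z\<close> cancel, the second ones because
  mixed derivatives of \<open>Z\<close> commute. Thus the Lie derivative of a connection is a
  tensor, and \<open>killing_iff\<close> may test it on constant fields.\<close>

lemma lie_derivative_const:
  assumes X: "smooth_on UNIV X" and Y: "smooth_on UNIV Y" and Z: "smooth_on UNIV Z"
  shows "lie_derivative X (\<lambda>_. G) Y Z p =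
     ddir (Y p) (ddir (Z p) X) p - ddir (chr G (Y p) (Z p)) X p
     + chr G (ddir (Y p) X p) (Z p) + chr G (Y p) (ddir (Z p) X p)"
proof -
  let ?G = "\<lambda>_. G"
  have D: "(A has_derivative (\<lambda>u. ddir u A q)) (at q)" if "smooth_on UNIV A" for A :: vfield and q
    by (rule smooth_on_has_derivative[OF that]) simp
  have DD: "((\<lambda>q. ddir (A q) B q) has_derivative (\<lambda>u. ddir u (ddir (A p) B) p + ddir (ddir u A p) B p)) (at p)"
    if "smooth_on UNIV A" "smooth_on UNIV B" for A B :: vfield
    by (rule has_derivative_ddir_field[OF open_UNIV UNIV_I that(2) D[OF that(1)]])
  have lin: "linear (\<lambda>v. ddir v A p)" if "smooth_on UNIV A" for A :: vfield
    by (rule has_derivative_linear[OF D[OF that]])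
  have comm: "ddir u (ddir v A) p = ddir v (ddir u A) p" if "smooth_on UNIV A" for u v and A :: vfield
    by (rule ddir_commute[OF open_UNIV UNIV_I that])
  have "(cov ?G Y Z has_derivative (\<lambda>u. (ddir u (ddir (Y p) Z) p + ddir (ddir u Y p) Z p)
      + (chr G (Y p) (ddir u Z p) + chr G (ddir u Y p) (Z p)))) (at p)"
    unfolding cov_eq[abs_def] by (intro has_derivative_add DD Y Z chr.FDERIV D)
  then have 1: "ddir (X p) (cov ?G Y Z) p = ddir (X p) (ddir (Y p) Z) p + ddir (ddir (X p) Y p) Z p
      + (chr G (Y p) (ddir (X p) Z p) + chr G (ddir (X p) Y p) (Z p))"
    by (rule ddir_eqI)
  have "(bracket X Z has_derivative (\<lambda>u. (ddir u (ddir (X p) Z) p + ddir (ddir u X p) Z p)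
      - (ddir u (ddir (Z p) X) p + ddir (ddir u Z p) X p))) (at p)"
    unfolding bracket_eq[abs_def] by (intro has_derivative_diff DD X Z)
  then have 2: "ddir (Y p) (bracket X Z) p = ddir (Y p) (ddir (X p) Z) p + ddir (ddir (Y p) X p) Z p
      - (ddir (Y p) (ddir (Z p) X) p + ddir (ddir (Y p) Z p) X p)"
    by (rule ddir_eqI)
  show ?thesis
    unfolding lie_derivative_def bracket_eq[of X "cov ?G Y Z"] 1 unfolding cov_eq 2 bracket_eq
    by (simp add: linear_diff[OF lin[OF X]] linear_add[OF lin[OF X]] linear_diff[OF lin[OF Z]]
        chr.diff_left chr.diff_right comm[OF Z, of "X p" "Y p"])
qed

lemma killing_iff:
  "X \<in> killing (\<lambda>_. G) \<longleftrightarrow> smooth_on UNIV X \<and>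
     (\<forall>p u v. ddir u (ddir v X) p + chr G (ddir u X p) v + chr G u (ddir v X p) = ddir (chr G u v) X p)"
proof safe
  assume X: "X \<in> killing (\<lambda>_. G)"
  then show s: "smooth_on UNIV X" by (simp add: killing_def)
  fix p u v
  have "lie_derivative X (\<lambda>_. G) (\<lambda>_. u) (\<lambda>_. v) p = 0"
    using X by (simp add: killing_def smooth_on_const)
  then show "ddir u (ddir v X) p + chr G (ddir u X p) v + chr G u (ddir v X p) = ddir (chr G u v) X p"
    using lie_derivative_const[OF s smooth_on_const smooth_on_const, of G u v p] by (simp add: algebra_simps)
next
  assume X: "smooth_on UNIV X"
     "\<forall>p u v. ddir u (ddir v X) p + chr G (ddir u X p) v + chr G u (ddir v X p) = ddir (chr G u v) X p"
  have "lie_derivative X (\<lambda>_. G) Y Z p = 0" if "smooth_on UNIV Y" "smooth_on UNIV Z" for Y Z p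
    unfolding lie_derivative_const[OF X(1) that] using X(2)[rule_format, of "Y p" "Z p" p]
    by (simp add: algebra_simps)
  then show "X \<in> killing (\<lambda>_. G)" using X(1) by (simp add: killing_def)
qed

lemma ddir_inverse_diffeo:
  assumes "diffeo_on U V \<phi>" "p \<in> U"
  shows "ddir (ddir u \<phi> p) (inv_into U \<phi>) (\<phi> p) = u"
proof -
  have U: "open U" and s: "smooth_on U \<phi>" and s': "smooth_on V (inv_into U \<phi>)"
    and b: "bij_betw \<phi> U V" using assms by (auto simp: diffeo_on_def)
  have \<phi>V: "\<phi> p \<in> V" using b assms by (auto simp: bij_betw_def)
  have "((\<lambda>q. q) has_derivative (\<lambda>u. ddir (ddir u \<phi> p) (inv_into U \<phi>) (\<phi> p))) (at p)"
    by (rule has_derivative_transform_within_open[OF has_derivative_compose[OF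
          smooth_on_has_derivative[OF s assms(2)] smooth_on_has_derivative[OF s' \<phi>V]] U assms(2)])
       (use b in \<open>simp add: bij_betw_def\<close>)
  from ddir_eqI[OF this, of u] show ?thesis
    using ddir_eqI[OF has_derivative_ident, of u p] by simp
qed

text \<open>The classical transformation law of Christoffel symbols. The derivative of
  \<open>Y\<close> contributes the same term to both sides of the defining equation, so only the
  values of the fields at \<open>p\<close> matter and constant fields suffice.\<close>

lemma affine_diffeo_iff:
  "affine_diffeo U \<Gamma> V \<Delta> \<phi> \<longleftrightarrow> diffeo_on U V \<phi> \<and>
     (\<forall>p\<in>U. \<forall>u v. ddir u (ddir v \<phi>) p + chr (\<Delta> (\<phi> p)) (ddir u \<phi> p) (ddir v \<phi> p)
        = ddir (chr (\<Gamma> p) u v) \<phi> p)" (is "_ \<longleftrightarrow> _ \<and> ?eq")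
proof (cases "diffeo_on U V \<phi>")
  case True
  let ?\<psi> = "inv_into U \<phi>"
  have U: "open U" and V: "open V" and b: "bij_betw \<phi> U V" and s: "smooth_on U \<phi>" and s': "smooth_on V ?\<psi>"
    using True by (auto simp: diffeo_on_def)
  have inv: "?\<psi> (\<phi> p) = p" if "p \<in> U" for p
    using b that by (simp add: bij_betw_def)
  have \<phi>V: "\<phi> p \<in> V" if "p \<in> U" for p using b that by (auto simp: bij_betw_def)
  have D\<phi>: "(\<phi> has_derivative (\<lambda>u. ddir u \<phi> p)) (at p)" if "p \<in> U" for p
    by (rule smooth_on_has_derivative[OF s that])
  have D\<psi>: "(?\<psi> has_derivative (\<lambda>u. ddir u ?\<psi> (\<phi> p))) (at (\<phi> p))" if "p \<in> U" for p
    by (rule smooth_on_has_derivative[OF s' \<phi>V[OF that]])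
  have inv': "ddir (ddir u \<phi> p) ?\<psi> (\<phi> p) = u" if "p \<in> U" for p u
    by (rule ddir_inverse_diffeo[OF True that])
  have push: "pushforward U \<phi> A (\<phi> p) = ddir (A p) \<phi> p" if "p \<in> U" for A p
    by (simp add: pushforward_def inv[OF that] ddir_def)
  have cov: "cov \<Delta> (pushforward U \<phi> X) (pushforward U \<phi> Y) (\<phi> p) =
      ddir (ddir (X p) Y p) \<phi> p
      + (ddir (X p) (ddir (Y p) \<phi>) p + chr (\<Delta> (\<phi> p)) (ddir (X p) \<phi> p) (ddir (Y p) \<phi> p))"
    if "p \<in> U" "smooth_on U Y" for X Y p
  proof -
    have "((\<lambda>q. ddir (Y q) \<phi> q) has_derivative (\<lambda>u. ddir u (ddir (Y p) \<phi>) p + ddir (ddir u Y p) \<phi> p)) (at (?\<psi> (\<phi> p)))"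
      using has_derivative_ddir_field[OF U that(1) s smooth_on_has_derivative[OF that(2,1)]]
      by (simp add: inv[OF that(1)])
    from has_derivative_compose[OF D\<psi>[OF that(1)] this]
    have "(pushforward U \<phi> Y has_derivative (\<lambda>w. ddir (ddir w ?\<psi> (\<phi> p)) (ddir (Y p) \<phi>) p
        + ddir (ddir (ddir w ?\<psi> (\<phi> p)) Y p) \<phi> p)) (at (\<phi> p))"
      by (simp add: pushforward_def[abs_def] ddir_def)
    from ddir_eqI[OF this, of "ddir (X p) \<phi> p"] show ?thesis
      by (simp add: cov_eq push[OF that(1)] inv'[OF that(1)])
  qed
  have push_cov: "pushforward U \<phi> (cov \<Gamma> X Y) (\<phi> p) = ddir (ddir (X p) Y p) \<phi> p + ddir (chr (\<Gamma> p) (X p) (Y p)) \<phi> p"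
    if "p \<in> U" for X Y p
    using linear_add[OF has_derivative_linear[OF D\<phi>[OF that]]] by (simp add: push[OF that] cov_eq)
  have main: "pushforward U \<phi> (cov \<Gamma> X Y) (\<phi> p) = cov \<Delta> (pushforward U \<phi> X) (pushforward U \<phi> Y) (\<phi> p) \<longleftrightarrow>
      ddir (X p) (ddir (Y p) \<phi>) p + chr (\<Delta> (\<phi> p)) (ddir (X p) \<phi> p) (ddir (Y p) \<phi> p)
        = ddir (chr (\<Gamma> p) (X p) (Y p)) \<phi> p"
    if "p \<in> U" "smooth_on U Y" for X Y p
    by (subst cov[OF that], subst push_cov[OF that(1)], subst add_left_cancel) (rule eq_commute)
  have "(\<forall>X Y. smooth_on U X \<longrightarrow> smooth_on U Y \<longrightarrow> (\<forall>q\<in>V. pushforward U \<phi> (cov \<Gamma> X Y) q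
              = cov \<Delta> (pushforward U \<phi> X) (pushforward U \<phi> Y) q)) \<longleftrightarrow> ?eq" (is "?L \<longleftrightarrow> _")
  proof
    assume L: ?L
    show ?eq
    proof (intro ballI allI)
      fix p u v :: "real^2" assume p: "p \<in> U"
      show "ddir u (ddir v \<phi>) p + chr (\<Delta> (\<phi> p)) (ddir u \<phi> p) (ddir v \<phi> p) = ddir (chr (\<Gamma> p) u v) \<phi> p"
        using iffD1[OF main[OF p smooth_on_const[of U v], of "\<lambda>_. u"]]
          L[rule_format, OF smooth_on_const[of U u] smooth_on_const[of U v] \<phi>V[OF p]] by simp
    qed
  next
    assume R: ?eq
    show ?L
    proof (intro allI impI ballI)
      fix X Y :: vfield and q assume "smooth_on U X" and Y: "smooth_on U Y" and "q \<in> V"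
      then obtain p where p: "p \<in> U" "q = \<phi> p" using b by (auto simp: bij_betw_def)
      then show "pushforward U \<phi> (cov \<Gamma> X Y) q = cov \<Delta> (pushforward U \<phi> X) (pushforward U \<phi> Y) q"
        using iffD2[OF main[OF p(1) Y, of X]] R[rule_format, OF p(1), of "X p" "Y p"] by simp
    qed
  qed
  then show ?thesis unfolding affine_diffeo_def using True by simp
qed (simp add: affine_diffeo_def)

lemma inj_ddir_diffeo:
  assumes "diffeo_on U V \<phi>" "p \<in> U"
  shows "inj (\<lambda>u. ddir u \<phi> p)"
  by (rule inj_on_inverseI) (rule ddir_inverse_diffeo[OF assms])

subsection \<open>Killing fields of the models\<close>

abbreviation pd1 ("\<partial>\<^sub>1") where "\<partial>\<^sub>1 \<equiv> ddir e1"
abbreviation pd2 ("\<partial>\<^sub>2") where "\<partial>\<^sub>2 \<equiv> ddir e2"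

lemma ddir_nth:
  fixes X :: "'a::real_normed_vector \<Rightarrow> real^'n"
  assumes "X differentiable (at p)"
  shows "ddir v X p $ i = ddir v (\<lambda>q. X q $ i) p"
  by (rule ddir_bounded_linear[OF bounded_linear_vec_nth assms, symmetric])

lemma ddir_ddir_nth:
  fixes X :: "'a::real_normed_vector \<Rightarrow> real^'n"
  assumes "open U" "p \<in> U" "smooth_on U X"
  shows "ddir u (ddir v X) p $ i = ddir u (ddir v (\<lambda>q. X q $ i)) p"
  by (rule ddir_ddir_bounded_linear[OF assms bounded_linear_vec_nth, symmetric])

text \<open>For a system that prescribes all second derivatives of a function of two variables,
  these are the two third-order integrability conditions.\<close>

lemma ddir_ddir_ddir_commute:
  fixes f :: "'a::real_normed_vector \<Rightarrow> 'b::euclidean_space"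
  assumes U: "open U" "p \<in> U" and f: "smooth_on U f"
  shows "ddir v (ddir u (ddir u f)) p = ddir u (ddir u (ddir v f)) p"
    and "ddir v (ddir u (ddir v f)) p = ddir u (ddir v (ddir v f)) p"
proof -
  have "ddir v (ddir u (ddir u f)) p = ddir u (ddir v (ddir u f)) p"
    by (rule ddir_commute[OF U smooth_on_ddir[OF f]])
  also have "\<dots> = ddir u (ddir u (ddir v f)) p"
    by (rule ddir_cong[OF U]) (rule ddir_commute[OF U(1) _ f])
  finally show "ddir v (ddir u (ddir u f)) p = ddir u (ddir u (ddir v f)) p" .
  show "ddir v (ddir u (ddir v f)) p = ddir u (ddir v (ddir v f)) p"
    by (rule ddir_commute[OF U smooth_on_ddir[OF f]])
qed

lemma ddir_lincomb:
  fixes A B C :: "'a::real_normed_vector \<Rightarrow> real"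
  assumes "open U" "p \<in> U" "\<And>q. q \<in> U \<Longrightarrow> h q = k * A q + l * B q + m * C q"
    and "smooth_on U A" "smooth_on U B" "smooth_on U C"
  shows "ddir v h p = k * ddir v A p + l * ddir v B p + m * ddir v C p"
proof -
  have "ddir v h p = ddir v (\<lambda>q. k * A q + l * B q + m * C q) p"
    by (rule ddir_cong[OF assms(1-3)])
  also have "\<dots> = k * ddir v A p + l * ddir v B p + m * ddir v C p"
    by (rule ddir_eqI[of _ "\<lambda>v. k * ddir v A p + l * ddir v B p + m * ddir v C p"])
       (intro has_derivative_add has_derivative_mult_right smooth_on_has_derivative[OF _ assms(2)] assms(4-))
  finally show ?thesis .
qed

section \<open>The second-order system for the first component\<close>

text \<open>What the Killing equation of \<open>model a c e F\<close> leaves for the first component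
  once the second is constant, with \<open>h = F - 2 * c\<close>.\<close>

definition solution :: "real \<Rightarrow> real \<Rightarrow> real \<Rightarrow> (real^2 \<Rightarrow> real) \<Rightarrow> bool" where
  "solution a e h f \<longleftrightarrow> smooth_on UNIV f \<and> (\<forall>p. \<partial>\<^sub>1 (\<partial>\<^sub>1 f) p = - a * \<partial>\<^sub>1 f p \<and>
     \<partial>\<^sub>1 (\<partial>\<^sub>2 f) p = - a * \<partial>\<^sub>2 f p \<and> \<partial>\<^sub>2 (\<partial>\<^sub>2 f) p = e * \<partial>\<^sub>1 f p + h * \<partial>\<^sub>2 f p)"

lemma constant_if_partials_zero:
  fixes f :: "real^2 \<Rightarrow> real"
  assumes "smooth_on UNIV f" "\<And>p. \<partial>\<^sub>1 f p = 0" "\<And>p. \<partial>\<^sub>2 f p = 0"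
  shows "f p = f q"
proof (rule has_derivative_zero_unique[of UNIV f])
  show "(f has_derivative (\<lambda>h. 0)) (at x)" for x
  proof -
    have d: "(f has_derivative (\<lambda>v. ddir v f x)) (at x)"
      by (rule smooth_on_has_derivative[OF assms(1)]) simp
    have "ddir v f x = 0" for v
      using ddir_plane[of f x v] smooth_on_differentiable[OF assms(1)] assms(2,3) by simp
    then show ?thesis using d by simp
  qed
qed auto

text \<open>Along a ray from the origin the square of the gradient satisfies Gronwall's inequality.\<close>

lemma solution_unique:
  assumes f: "solution a e h f" and "f 0 = 0" "\<partial>\<^sub>1 f 0 = 0" "\<partial>\<^sub>2 f 0 = 0"
  shows "f p = 0"
proof -
  have sm: "smooth_on UNIV f" using f by (simp add: solution_def)
  \<comment> \<open>The right-hand sides contain only first derivatives, so along a ray the gradient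
    satisfies a closed linear system of ordinary differential equations. Once it vanishes,
    \<open>f\<close> is constant.\<close>
  have zero: "\<partial>\<^sub>1 f x = 0 \<and> \<partial>\<^sub>2 f x = 0" for x
  proof -
    define A where "A = (\<lambda>t. \<partial>\<^sub>1 f (t *\<^sub>R x))"
    define B where "B = (\<lambda>t. \<partial>\<^sub>2 f (t *\<^sub>R x))"
    have comm: "\<partial>\<^sub>2 (\<partial>\<^sub>1 f) q = \<partial>\<^sub>1 (\<partial>\<^sub>2 f) q" for q
      by (rule ddir_commute[OF open_UNIV UNIV_I sm])
    have d: "((\<lambda>t. g (t *\<^sub>R x)) has_real_derivative x $ 1 * \<partial>\<^sub>1 g (t *\<^sub>R x) + x $ 2 * \<partial>\<^sub>2 g (t *\<^sub>R x)) (at t)"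
      if g: "smooth_on UNIV g" for g t
    proof -
      have dg: "g differentiable (at (t *\<^sub>R x))" by (rule smooth_on_differentiable[OF g UNIV_I])
      have "((\<lambda>t. g (t *\<^sub>R x)) has_derivative (\<lambda>s. ddir (s *\<^sub>R x) g (t *\<^sub>R x))) (at t)"
        by (rule has_derivative_compose[of "\<lambda>t. t *\<^sub>R x" "\<lambda>s. s *\<^sub>R x" t UNIV g,
              OF has_derivative_scaleR_left[OF has_derivative_ident] has_derivative_ddir[OF dg]])
      moreover have "ddir (s *\<^sub>R x) g (t *\<^sub>R x) = (x $ 1 * \<partial>\<^sub>1 g (t *\<^sub>R x) + x $ 2 * \<partial>\<^sub>2 g (t *\<^sub>R x)) * s" for s
        using ddir_plane[OF dg, of "s *\<^sub>R x"] by (simp add: algebra_simps)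
      ultimately show ?thesis by (simp add: has_field_derivative_def)
    qed
    define A' where "A' = (\<lambda>t. - a * x $ 1 * A t - a * x $ 2 * B t)"
    define B' where "B' = (\<lambda>t. - a * x $ 1 * B t + x $ 2 * (e * A t + h * B t))"
    have dA: "(A has_real_derivative A' t) (at t)" for t
      using d[OF smooth_on_ddir[OF sm, of e1], of t] f
      by (simp add: A_def A'_def B_def solution_def comm algebra_simps)
    have dB: "(B has_real_derivative B' t) (at t)" for t
      using d[OF smooth_on_ddir[OF sm, of e2], of t] f
      by (simp add: A_def B'_def B_def solution_def algebra_simps)
    \<comment> \<open>The derivative of A^2 + B^2 is a sum of four quadratic terms; each is bounded
      by its coefficient times A^2 + B^2, or twice that, using |2AB| \<le> A^2 + B^2.\<close>
    define k where "k = 2 * \<bar>a * x $ 1\<bar> + \<bar>a * x $ 2\<bar> + \<bar>x $ 2 * e\<bar> + 2 * \<bar>x $ 2 * h\<bar>"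
    have bound: "2 * A t * A' t + 2 * B t * B' t \<le> k * (A t * A t + B t * B t)" for t
    proof -
      have u: "s * r \<le> \<bar>s\<bar> * r'" if "\<bar>r\<bar> \<le> r'" for s r r' :: real
        using mult_left_mono[OF that, of "\<bar>s\<bar>"] abs_ge_self[of "s * r"] by (simp add: abs_mult)
      let ?N = "A t * A t + B t * B t"
      have n: "\<bar>- 2 * (A t * A t + B t * B t)\<bar> \<le> 2 * ?N" "\<bar>2 * (A t * B t)\<bar> \<le> ?N"
          "\<bar>2 * (B t * B t)\<bar> \<le> 2 * ?N"
        using sum_squares_bound[of "A t" "B t"] sum_squares_bound[of "A t" "- B t"]
          zero_le_square[of "A t"] zero_le_square[of "B t"]
        by (auto simp: abs_le_iff power2_eq_square)
      have "2 * A t * A' t + 2 * B t * B' t = (a * x $ 1) * (- 2 * (A t * A t + B t * B t))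
          + (- (a * x $ 2)) * (2 * (A t * B t)) + (x $ 2 * e) * (2 * (A t * B t)) + (x $ 2 * h) * (2 * (B t * B t))"
        by (simp add: A'_def B'_def algebra_simps)
      also have "\<dots> \<le> \<bar>a * x $ 1\<bar> * (2 * ?N) + \<bar>- (a * x $ 2)\<bar> * ?N + \<bar>x $ 2 * e\<bar> * ?N + \<bar>x $ 2 * h\<bar> * (2 * ?N)"
        by (intro add_mono u n)
      also have "\<dots> = k * ?N" by (simp add: k_def algebra_simps)
      finally show ?thesis .
    qed
    \<comment> \<open>The factor exp(-kt) turns the differential inequality into monotonicity;
      \<open>?E\<close> starts at 0 and is nonnegative.\<close>
    let ?E = "\<lambda>t. exp (- (k * t)) * (A t * A t + B t * B t)"
    have "?E 1 \<le> ?E 0"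
    proof (rule DERIV_nonpos_imp_nonincreasing[of 0 1 ?E])
      fix t :: real
      have "(?E has_real_derivative exp (- (k * t)) * ((2 * A t * A' t + 2 * B t * B' t) - k * (A t * A t + B t * B t))) (at t)"
        by (rule derivative_eq_intros dA dB refl | simp add: algebra_simps)+
      moreover have "exp (- (k * t)) * ((2 * A t * A' t + 2 * B t * B' t) - k * (A t * A t + B t * B t)) \<le> 0"
        using bound[of t] by (intro mult_nonneg_nonpos) auto
      ultimately show "\<exists>y. (?E has_real_derivative y) (at t) \<and> y \<le> 0" by blast
    qed simp
    moreover have "A 0 = 0" "B 0 = 0" using assms by (simp_all add: A_def B_def)
    ultimately have "exp (- k) * (A 1 * A 1 + B 1 * B 1) \<le> 0" by simp
    then have "A 1 * A 1 + B 1 * B 1 \<le> 0"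
      by (simp add: mult_le_0_iff not_le[symmetric])
    then have "A 1 = 0 \<and> B 1 = 0" by (simp add: sum_squares_le_zero_iff)
    then show ?thesis by (simp add: A_def B_def)
  qed
  have "f p = f 0" by (rule constant_if_partials_zero[OF sm]) (use zero in auto)
  then show ?thesis using assms by simp
qed

lemma ddir_lincomb_const:
  fixes A B :: "'a::real_normed_vector \<Rightarrow> real"
  assumes "smooth_on UNIV A" "smooth_on UNIV B"
  shows "ddir v (\<lambda>q. k * A q + l * B q + m) p = k * ddir v A p + l * ddir v B p"
  using ddir_lincomb[of UNIV p "\<lambda>q. k * A q + l * B q + m" k A l B m "\<lambda>_. 1", OF _ _ _ assms smooth_on_const] by simp

lemma solution_lincomb:
  assumes "solution a e h f" "solution a e h g"
  shows "solution a e h (\<lambda>p. k * f p + l * g p + m)"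
proof -
  have s: "smooth_on UNIV f" "smooth_on UNIV g" using assms by (auto simp: solution_def)
  note d = ddir_lincomb_const[OF s]
  have "ddir v (\<lambda>p. k * f p + l * g p + m) = (\<lambda>p. k * ddir v f p + l * ddir v g p + 0)" for v
    by (rule ext) (simp add: d)
  then have dd: "ddir u (ddir v (\<lambda>p. k * f p + l * g p + m)) p = k * ddir u (ddir v f) p + l * ddir u (ddir v g) p" for u v p
    using ddir_lincomb_const[OF smooth_on_ddir[OF s(1)] smooth_on_ddir[OF s(2)], of u k v l v 0 p] by simp
  show ?thesis
    unfolding solution_def dd d
    using assms s by (simp add: solution_def algebra_simps smooth_on_add smooth_on_mult smooth_on_const)
qed

lemma solution_general:
  assumes f: "solution a e h f" and u: "solution a e h u1" "solution a e h u2"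
    and ne: "\<partial>\<^sub>1 u1 0 * \<partial>\<^sub>2 u2 0 - \<partial>\<^sub>2 u1 0 * \<partial>\<^sub>1 u2 0 \<noteq> 0"
  shows "\<exists>\<alpha> \<beta> \<gamma>. f = (\<lambda>p. \<alpha> * u1 p + \<beta> * u2 p + \<gamma>)"
proof -
  let ?d = "\<partial>\<^sub>1 u1 0 * \<partial>\<^sub>2 u2 0 - \<partial>\<^sub>2 u1 0 * \<partial>\<^sub>1 u2 0"
  \<comment> \<open>Cramer's rule matches the gradient of \<open>f\<close> at the origin;
    \<open>\<gamma>\<close> then corrects the value there, since constants are solutions.\<close>
  define \<alpha> where "\<alpha> = (\<partial>\<^sub>1 f 0 * \<partial>\<^sub>2 u2 0 - \<partial>\<^sub>2 f 0 * \<partial>\<^sub>1 u2 0) / ?d"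
  define \<beta> where "\<beta> = (\<partial>\<^sub>1 u1 0 * \<partial>\<^sub>2 f 0 - \<partial>\<^sub>2 u1 0 * \<partial>\<^sub>1 f 0) / ?d"
  define \<gamma> where "\<gamma> = f 0 - \<alpha> * u1 0 - \<beta> * u2 0"
  have jet: "\<partial>\<^sub>1 f 0 = \<alpha> * \<partial>\<^sub>1 u1 0 + \<beta> * \<partial>\<^sub>1 u2 0" "\<partial>\<^sub>2 f 0 = \<alpha> * \<partial>\<^sub>2 u1 0 + \<beta> * \<partial>\<^sub>2 u2 0"
    using ne by (simp_all add: \<alpha>_def \<beta>_def divide_simps) (simp_all add: algebra_simps)
  have s: "smooth_on UNIV f" "smooth_on UNIV u1" "smooth_on UNIV u2" using f u by (auto simp: solution_def)
  let ?w = "\<lambda>p. \<alpha> * u1 p + \<beta> * u2 p + \<gamma>"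
  have w: "solution a e h ?w" by (rule solution_lincomb[OF u])
  have "solution a e h (\<lambda>p. 1 * f p + (-1) * ?w p + 0)" by (rule solution_lincomb[OF f w])
  then have "1 * f p + (-1) * ?w p + 0 = 0" for p
  proof (rule solution_unique)
    have sw: "smooth_on UNIV ?w" using w by (simp add: solution_def)
    show "\<partial>\<^sub>1 (\<lambda>p. 1 * f p + (-1) * ?w p + 0) 0 = 0" "\<partial>\<^sub>2 (\<lambda>p. 1 * f p + (-1) * ?w p + 0) 0 = 0"
      using jet ddir_lincomb_const[OF s(1) sw, of _ 1 "-1" 0 0] ddir_lincomb_const[OF s(2,3), of _ \<alpha> \<beta> \<gamma> 0]
      by simp_all
  qed (simp add: \<gamma>_def)
  then have "f p = ?w p" for p by (simp add: algebra_simps)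
  then show ?thesis by blast
qed

section \<open>Reduction of the Killing equation for the family of models\<close>

abbreviation model :: "real \<Rightarrow> real \<Rightarrow> real \<Rightarrow> real \<Rightarrow> christoffel" where
  "model a c e f \<equiv> const_christoffel a 0 c 0 e f"

lemma chr_model:
  "chr (model a c e f) u v $ 1 = a * u $ 1 * v $ 1 + c * (u $ 1 * v $ 2 + u $ 2 * v $ 1) + e * u $ 2 * v $ 2"
  "chr (model a c e f) u v $ 2 = f * u $ 2 * v $ 2"
  by (simp_all add: chr_nth const_christoffel_def algebra_simps)

lemma killing_model_partials:
  assumes X: "X \<in> killing (\<lambda>_. model a c e F)"
  defines "f \<equiv> \<lambda>p. X p $ 1" and "g \<equiv> \<lambda>p. X p $ 2"
  shows "\<partial>\<^sub>1 (\<partial>\<^sub>1 f) p = - a * \<partial>\<^sub>1 f p - 2 * c * \<partial>\<^sub>1 g p"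
    "\<partial>\<^sub>1 (\<partial>\<^sub>2 f) p = - a * \<partial>\<^sub>2 f p - e * \<partial>\<^sub>1 g p - c * \<partial>\<^sub>2 g p"
    "\<partial>\<^sub>2 (\<partial>\<^sub>2 f) p = e * \<partial>\<^sub>1 f p + (F - 2 * c) * \<partial>\<^sub>2 f p - 2 * e * \<partial>\<^sub>2 g p"
    "\<partial>\<^sub>1 (\<partial>\<^sub>1 g) p = a * \<partial>\<^sub>1 g p"
    "\<partial>\<^sub>1 (\<partial>\<^sub>2 g) p = (c - F) * \<partial>\<^sub>1 g p"
    "\<partial>\<^sub>2 (\<partial>\<^sub>2 g) p = e * \<partial>\<^sub>1 g p - F * \<partial>\<^sub>2 g p"
proof -
  have s: "smooth_on UNIV X" and
    eq: "ddir u (ddir v X) p + chr (model a c e F) (ddir u X p) v + chr (model a c e F) u (ddir v X p)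
      = ddir (chr (model a c e F) u v) X p" for u v
    using X by (auto simp: killing_iff)
  have d: "X differentiable (at p)" by (rule smooth_on_differentiable[OF s UNIV_I])
  have c: "ddir u X p $ 1 = ddir u f p" "ddir u X p $ 2 = ddir u g p"
     "ddir u (ddir v X) p $ 1 = ddir u (ddir v f) p" "ddir u (ddir v X) p $ 2 = ddir u (ddir v g) p" for u v
    unfolding f_def g_def by (simp_all add: ddir_nth[OF d] ddir_ddir_nth[OF open_UNIV UNIV_I s])
  have df: "ddir w f p = w $ 1 * \<partial>\<^sub>1 f p + w $ 2 * \<partial>\<^sub>2 f p" "ddir w g p = w $ 1 * \<partial>\<^sub>1 g p + w $ 2 * \<partial>\<^sub>2 g p" for w
    using arg_cong[OF ddir_plane[OF d, of w], of "\<lambda>z. z $ 1"] arg_cong[OF ddir_plane[OF d, of w], of "\<lambda>z. z $ 2"]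
    by (simp_all add: c)
  have eqs: "ddir u (ddir v f) p + chr (model a c e F) (ddir u X p) v $ 1 + chr (model a c e F) u (ddir v X p) $ 1
      = chr (model a c e F) u v $ 1 * \<partial>\<^sub>1 f p + chr (model a c e F) u v $ 2 * \<partial>\<^sub>2 f p"
     "ddir u (ddir v g) p + chr (model a c e F) (ddir u X p) v $ 2 + chr (model a c e F) u (ddir v X p) $ 2
      = chr (model a c e F) u v $ 1 * \<partial>\<^sub>1 g p + chr (model a c e F) u v $ 2 * \<partial>\<^sub>2 g p" for u v
    using arg_cong[OF eq[of u v], of "\<lambda>z. z $ 1"] arg_cong[OF eq[of u v], of "\<lambda>z. z $ 2"]
    by (simp_all add: c df[of "chr (model a c e F) u v"])
  show "\<partial>\<^sub>1 (\<partial>\<^sub>1 f) p = - a * \<partial>\<^sub>1 f p - 2 * c * \<partial>\<^sub>1 g p" "\<partial>\<^sub>1 (\<partial>\<^sub>1 g) p = a * \<partial>\<^sub>1 g p"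
    using eqs[of e1 e1] by (simp_all add: chr_model c algebra_simps)
  show "\<partial>\<^sub>1 (\<partial>\<^sub>2 f) p = - a * \<partial>\<^sub>2 f p - e * \<partial>\<^sub>1 g p - c * \<partial>\<^sub>2 g p" "\<partial>\<^sub>1 (\<partial>\<^sub>2 g) p = (c - F) * \<partial>\<^sub>1 g p"
    using eqs[of e1 e2] by (simp_all add: chr_model c algebra_simps)
  show "\<partial>\<^sub>2 (\<partial>\<^sub>2 f) p = e * \<partial>\<^sub>1 f p + (F - 2 * c) * \<partial>\<^sub>2 f p - 2 * e * \<partial>\<^sub>2 g p"
    "\<partial>\<^sub>2 (\<partial>\<^sub>2 g) p = e * \<partial>\<^sub>1 g p - F * \<partial>\<^sub>2 g p"
    using eqs[of e2 e2] by (simp_all add: chr_model c algebra_simps)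
qed

text \<open>A Killing field preserves the Ricci tensor, here a nonzero constant multiple of the
  square of the differential of the second coordinate; hence the second component has zero
  differential. In the proof this appears as two integrability conditions for the first component,
  which reduce to the Ricci number times \<open>\<partial>\<^sub>1 g\<close> and twice the Ricci
  number times \<open>\<partial>\<^sub>2 g\<close>.\<close>

lemma killing_model_second_constant:
  assumes X: "X \<in> killing (\<lambda>_. model a c e F)" and r: "e * a + F * c - c\<^sup>2 \<noteq> 0"
  shows "\<partial>\<^sub>1 (\<lambda>p. X p $ 2) p = 0" "\<partial>\<^sub>2 (\<lambda>p. X p $ 2) p = 0"
proof -
  define f where "f = (\<lambda>p. X p $ 1)"
  define g where "g = (\<lambda>p. X p $ 2)"
  note eq = killing_model_partials[OF X, folded f_def g_def]
  have s: "smooth_on UNIV f" "smooth_on UNIV g"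
    using X by (auto simp: killing_def f_def g_def intro: smooth_on_nth)
  note sd = smooth_on_ddir[OF s(1)] smooth_on_ddir[OF s(2)]
  have 1: "\<partial>\<^sub>1 g p = 0" for p
  proof -
    have A: "\<partial>\<^sub>2 (\<partial>\<^sub>1 (\<partial>\<^sub>1 f)) p = - a * \<partial>\<^sub>2 (\<partial>\<^sub>1 f) p + (- 2 * c) * \<partial>\<^sub>2 (\<partial>\<^sub>1 g) p + 0 * \<partial>\<^sub>2 (\<partial>\<^sub>1 g) p"
      by (rule ddir_lincomb[OF open_UNIV UNIV_I _ sd(1) sd(2) sd(2)]) (simp add: eq(1))
    have B: "\<partial>\<^sub>1 (\<partial>\<^sub>1 (\<partial>\<^sub>2 f)) p = - a * \<partial>\<^sub>1 (\<partial>\<^sub>2 f) p + (- e) * \<partial>\<^sub>1 (\<partial>\<^sub>1 g) p + (- c) * \<partial>\<^sub>1 (\<partial>\<^sub>2 g) p"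
      by (rule ddir_lincomb[OF open_UNIV UNIV_I _ sd(1) sd(2) sd(2)]) (simp add: eq(2))
    have "- 2 * c * \<partial>\<^sub>1 (\<partial>\<^sub>2 g) p = - e * \<partial>\<^sub>1 (\<partial>\<^sub>1 g) p - c * \<partial>\<^sub>1 (\<partial>\<^sub>2 g) p"
      using A B ddir_ddir_ddir_commute(1)[of UNIV p f e2 e1, OF open_UNIV UNIV_I s(1)]
        ddir_commute[of UNIV p f e2 e1, OF open_UNIV UNIV_I s(1)] ddir_commute[of UNIV p g e2 e1, OF open_UNIV UNIV_I s(2)]
      by simp
    then have "(e * a + F * c - c\<^sup>2) * \<partial>\<^sub>1 g p = 0"
      by (simp add: eq(4,5) algebra_simps power2_eq_square)
    then show ?thesis using r by simp
  qed
  have "\<partial>\<^sub>2 g p = 0"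
  proof -
    have A: "\<partial>\<^sub>2 (\<partial>\<^sub>1 (\<partial>\<^sub>2 f)) p = - a * \<partial>\<^sub>2 (\<partial>\<^sub>2 f) p + (- c) * \<partial>\<^sub>2 (\<partial>\<^sub>2 g) p + 0 * \<partial>\<^sub>2 (\<partial>\<^sub>1 g) p"
      by (rule ddir_lincomb[OF open_UNIV UNIV_I _ sd(1) sd(2) sd(2)]) (simp add: eq(2) 1)
    have B: "\<partial>\<^sub>1 (\<partial>\<^sub>2 (\<partial>\<^sub>2 f)) p = e * \<partial>\<^sub>1 (\<partial>\<^sub>1 f) p + (F - 2 * c) * \<partial>\<^sub>1 (\<partial>\<^sub>2 f) p + (- 2 * e) * \<partial>\<^sub>1 (\<partial>\<^sub>2 g) p"
      by (rule ddir_lincomb[OF open_UNIV UNIV_I _ sd(1) sd(1) sd(2)]) (simp add: eq(3))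
    have "- a * \<partial>\<^sub>2 (\<partial>\<^sub>2 f) p - c * \<partial>\<^sub>2 (\<partial>\<^sub>2 g) p = e * \<partial>\<^sub>1 (\<partial>\<^sub>1 f) p + (F - 2 * c) * \<partial>\<^sub>1 (\<partial>\<^sub>2 f) p - 2 * e * \<partial>\<^sub>1 (\<partial>\<^sub>2 g) p"
      using A B ddir_ddir_ddir_commute(2)[of UNIV p f e2 e1, OF open_UNIV UNIV_I s(1)] by simp
    then have "2 * ((e * a + F * c - c\<^sup>2) * \<partial>\<^sub>2 g p) = 0"
      by (simp add: eq 1 algebra_simps power2_eq_square)
    then show ?thesis using r by simp
  qed
  then show "\<partial>\<^sub>1 (\<lambda>p. X p $ 2) p = 0" "\<partial>\<^sub>2 (\<lambda>p. X p $ 2) p = 0" using 1 by (simp_all add: g_def)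
qed

lemma killing_model_iff:
  assumes r: "e * a + F * c - c\<^sup>2 \<noteq> 0"
  shows "X \<in> killing (\<lambda>_. model a c e F) \<longleftrightarrow>
    (\<exists>f \<delta>. solution a e (F - 2 * c) f \<and> X = (\<lambda>p. f p *\<^sub>R e1 + \<delta> *\<^sub>R e2))"
proof
  assume X: "X \<in> killing (\<lambda>_. model a c e F)"
  have s: "smooth_on UNIV X" using X by (simp add: killing_def)
  note z = killing_model_second_constant[OF X r]
  have g: "X p $ 2 = X 0 $ 2" for p
    by (rule constant_if_partials_zero[OF smooth_on_nth[OF open_UNIV s]]) (rule z)+
  have "solution a e (F - 2 * c) (\<lambda>p. X p $ 1)"
    unfolding solution_def using killing_model_partials[OF X] z smooth_on_nth[OF open_UNIV s]
    by simp
  moreover have "X = (\<lambda>p. X p $ 1 *\<^sub>R e1 + X 0 $ 2 *\<^sub>R e2)"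
  proof
    show "X p = X p $ 1 *\<^sub>R e1 + X 0 $ 2 *\<^sub>R e2" for p
      by (subst g[of p, symmetric]) (rule plane_basis)
  qed
  ultimately show "\<exists>f \<delta>. solution a e (F - 2 * c) f \<and> X = (\<lambda>p. f p *\<^sub>R e1 + \<delta> *\<^sub>R e2)"
    by blast
next
  assume "\<exists>f \<delta>. solution a e (F - 2 * c) f \<and> X = (\<lambda>p. f p *\<^sub>R e1 + \<delta> *\<^sub>R e2)"
  then obtain f \<delta> where f: "solution a e (F - 2 * c) f" and X: "X = (\<lambda>p. f p *\<^sub>R e1 + \<delta> *\<^sub>R e2)" by blast
  have sf: "smooth_on UNIV f" using f by (simp add: solution_def)
  have s: "smooth_on UNIV X" unfolding X
    by (intro smooth_on_add smooth_on_scaleR smooth_on_const open_UNIV sf)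
  show "X \<in> killing (\<lambda>_. model a c e F)"
    unfolding killing_iff
  proof (intro conjI allI s)
    fix p u v
    have d: "X differentiable (at p)" by (rule smooth_on_differentiable[OF s UNIV_I])
    have Xn: "(\<lambda>p. X p $ 1) = f" "(\<lambda>p. X p $ 2) = (\<lambda>_. \<delta>)" by (simp_all add: X)
    have z: "ddir v (\<lambda>_. k) = (\<lambda>_. 0)" for v :: "real^2" and k :: real by (simp add: fun_eq_iff)
    have c: "ddir u X p $ 1 = ddir u f p" "ddir u X p $ 2 = 0"
     "ddir u (ddir v X) p $ 1 = ddir u (ddir v f) p" "ddir u (ddir v X) p $ 2 = 0" for u v
      by (simp_all add: ddir_nth[OF d] ddir_ddir_nth[OF open_UNIV UNIV_I s] Xn z)
    have df: "ddir w f p = w $ 1 * \<partial>\<^sub>1 f p + w $ 2 * \<partial>\<^sub>2 f p" for w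
      using ddir_plane[of f p w, OF smooth_on_differentiable[OF sf UNIV_I]] by simp
    have w: "ddir u (ddir w f) p = u $ 1 * \<partial>\<^sub>1 (ddir w f) p + u $ 2 * \<partial>\<^sub>2 (ddir w f) p" for w
      using ddir_plane[of _ p u, OF smooth_on_differentiable[OF smooth_on_ddir[OF sf] UNIV_I]] by simp
    have pde: "\<partial>\<^sub>1 (\<partial>\<^sub>1 f) p = - a * \<partial>\<^sub>1 f p" "\<partial>\<^sub>1 (\<partial>\<^sub>2 f) p = - a * \<partial>\<^sub>2 f p"
      "\<partial>\<^sub>2 (\<partial>\<^sub>2 f) p = e * \<partial>\<^sub>1 f p + (F - 2 * c) * \<partial>\<^sub>2 f p" "\<partial>\<^sub>2 (\<partial>\<^sub>1 f) p = - a * \<partial>\<^sub>2 f p"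
      using f ddir_commute[of UNIV p f e2 e1, OF open_UNIV UNIV_I sf] by (simp_all add: solution_def)
    have "ddir u (ddir v f) p = v $ 1 * ddir u (\<partial>\<^sub>1 f) p + v $ 2 * ddir u (\<partial>\<^sub>2 f) p"
      using ddir_ddir_plane[of UNIV p f u v, OF open_UNIV UNIV_I sf] by simp
    also have "\<dots> = v $ 1 * (u $ 1 * (- a * \<partial>\<^sub>1 f p) + u $ 2 * (- a * \<partial>\<^sub>2 f p))
        + v $ 2 * (u $ 1 * (- a * \<partial>\<^sub>2 f p) + u $ 2 * (e * \<partial>\<^sub>1 f p + (F - 2 * c) * \<partial>\<^sub>2 f p))"
      unfolding w[of e1] w[of e2] pde ..
    finally have dd: "ddir u (ddir v f) p = \<dots>" .
    show "ddir u (ddir v X) p + chr (model a c e F) (ddir u X p) v + chr (model a c e F) u (ddir v X p)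
      = ddir (chr (model a c e F) u v) X p"
      by (simp add: vec_eq_iff forall_2 c dd chr_model df[of "chr (model a c e F) u v"] df[of u] df[of v] algebra_simps)
  qed
qed

section \<open>Lie algebra structure of the Killing fields\<close>

definition model_field :: "(real^2 \<Rightarrow> real) \<Rightarrow> (real^2 \<Rightarrow> real) \<Rightarrow> real \<Rightarrow> real \<Rightarrow> real \<Rightarrow> real \<Rightarrow> vfield" where
  "model_field u1 u2 a b c d = (\<lambda>p. (a * u1 p + b * u2 p + c) *\<^sub>R e1 + d *\<^sub>R e2)"

text \<open>Parametrizing \<open>L\<close> by the abstract algebra also transports the Lie algebra
  laws to \<open>L\<close>, so the Jacobi identity for vector fields is inherited from
  \<open>c\<close> and needs no computation with second derivatives.\<close>

lemma lie_isomorphic_if_parametrized: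
  fixes b :: "'a::real_vector \<Rightarrow> 'a \<Rightarrow> 'a" and c :: "'b::real_vector \<Rightarrow> 'b \<Rightarrow> 'b"
  assumes c: "lie_algebra UNIV c" and \<Phi>: "linear \<Phi>" "inj \<Phi>" "range \<Phi> = L"
    and hom: "\<And>x y. b (\<Phi> x) (\<Phi> y) = \<Phi> (c x y)"
  shows "lie_isomorphic L b UNIV c"
proof -
  interpret linear \<Phi> by (rule \<Phi>(1))
  have c': "c (x + y) z = c x z + c y z" "c z (x + y) = c z x + c z y" "c (r *\<^sub>R x) y = r *\<^sub>R c x y"
     "c x (r *\<^sub>R y) = r *\<^sub>R c x y" "c x x = 0" "c x (c y z) + c y (c z x) + c z (c x y) = 0" for x y z r
    using c by (auto simp: lie_algebra_def)
  have L: "(\<forall>x\<in>L. P x) \<longleftrightarrow> (\<forall>x. P (\<Phi> x))" for P using \<Phi>(3) by auto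
  have "subspace L" using linear_subspace_image[OF \<Phi>(1) subspace_UNIV] \<Phi>(3) by simp
  moreover have "\<Phi> x \<in> L" for x using \<Phi>(3) by auto
  ultimately have 1: "lie_algebra L b"
    unfolding lie_algebra_def L hom add[symmetric] scaleR[symmetric]
    by (simp add: hom c' zero flip: add scaleR)
  have inv: "inv \<Phi> (\<Phi> x) = x" for x using \<Phi>(2) by simp
  have "bij_betw (inv \<Phi>) L UNIV"
    using bij_betw_inv_into[of \<Phi> UNIV L] \<Phi>(2,3) by (simp add: bij_betw_def)
  then have "\<exists>f. bij_betw f L UNIV \<and>
       (\<forall>x\<in>L. \<forall>y\<in>L. f (x + y) = f x + f y) \<and>
       (\<forall>r. \<forall>x\<in>L. f (r *\<^sub>R x) = r *\<^sub>R f x) \<and>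
       (\<forall>x\<in>L. \<forall>y\<in>L. f (b x y) = c (f x) (f y))"
    by (intro exI[of _ "inv \<Phi>"]) (simp add: L hom inv flip: add scaleR)
  then show ?thesis using 1 c by (simp add: lie_isomorphic_def)
qed

lemma span_pair: "span {x, y} = {a *\<^sub>R x + b *\<^sub>R y | a b. True}"
proof -
  have "z \<in> span {x, y} \<longleftrightarrow> (\<exists>a b. z - a *\<^sub>R x = b *\<^sub>R y)" for z
    by (simp add: span_breakdown_eq[of z x "{y}"] span_singleton) blast
  then show ?thesis by (auto simp: algebra_simps)
qed

text \<open>\<open>u1\<close>, \<open>u2\<close> and the constant 1 are to be a basis of the
  solution space; \<open>ne\<close> says that the gradients of \<open>u1\<close> and
  \<open>u2\<close> at the origin are independent.\<close>

context
  fixes a c e F :: real and u1 u2 :: "real^2 \<Rightarrow> real"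
  assumes r: "e * a + F * c - c\<^sup>2 \<noteq> 0"
    and u1: "solution a e (F - 2 * c) u1" and u2: "solution a e (F - 2 * c) u2"
    and ne: "\<partial>\<^sub>1 u1 0 * \<partial>\<^sub>2 u2 0 - \<partial>\<^sub>2 u1 0 * \<partial>\<^sub>1 u2 0 \<noteq> 0"
begin

lemma smooth_u: "smooth_on UNIV u1" "smooth_on UNIV u2"
  using u1 u2 by (auto simp: solution_def)

lemma killing_model_eq:
  "killing (\<lambda>_. model a c e F) = {model_field u1 u2 \<alpha> \<beta> \<gamma> \<delta> | \<alpha> \<beta> \<gamma> \<delta>. True}"
proof (intro set_eqI iffI)
  fix X assume "X \<in> killing (\<lambda>_. model a c e F)"
  then obtain f \<delta> where f: "solution a e (F - 2 * c) f" "X = (\<lambda>p. f p *\<^sub>R e1 + \<delta> *\<^sub>R e2)"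
    using killing_model_iff[OF r] by blast
  obtain \<alpha> \<beta> \<gamma> where "f = (\<lambda>p. \<alpha> * u1 p + \<beta> * u2 p + \<gamma>)"
    using solution_general[OF f(1) u1 u2 ne] by blast
  then have "X = model_field u1 u2 \<alpha> \<beta> \<gamma> \<delta>" by (simp add: f(2) model_field_def)
  then show "X \<in> {model_field u1 u2 \<alpha> \<beta> \<gamma> \<delta> | \<alpha> \<beta> \<gamma> \<delta>. True}" by blast
next
  fix X assume "X \<in> {model_field u1 u2 \<alpha> \<beta> \<gamma> \<delta> | \<alpha> \<beta> \<gamma> \<delta>. True}"
  then obtain \<alpha> \<beta> \<gamma> \<delta> where "X = model_field u1 u2 \<alpha> \<beta> \<gamma> \<delta>" by blast
  then show "X \<in> killing (\<lambda>_. model a c e F)"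
    unfolding killing_model_iff[OF r] model_field_def using solution_lincomb[OF u1 u2] by blast
qed

lemma combination_zero:
  assumes "\<And>p. \<alpha> * u1 p + \<beta> * u2 p + \<gamma> = 0"
  shows "\<alpha> = 0 \<and> \<beta> = 0 \<and> \<gamma> = 0"
proof -
  have z: "(\<lambda>p. \<alpha> * u1 p + \<beta> * u2 p + \<gamma>) = (\<lambda>_. 0)" using assms by auto
  have "\<alpha> * ddir v u1 0 + \<beta> * ddir v u2 0 = 0" for v
    using ddir_lincomb_const[OF smooth_u, of v \<alpha> \<beta> \<gamma> 0] unfolding z by simp
  from this[of e1] this[of e2] ne have "\<alpha> = 0 \<and> \<beta> = 0" by algebra
  then show ?thesis using assms[of 0] by simp
qed

lemma model_field_eq_iff:
  "model_field u1 u2 \<alpha> \<beta> \<gamma> \<delta> = model_field u1 u2 \<alpha>' \<beta>' \<gamma>' \<delta>' \<longleftrightarrow> \<alpha> = \<alpha>' \<and> \<beta> = \<beta>' \<and> \<gamma> = \<gamma>' \<and> \<delta> = \<delta>'"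
  (is "?X = ?Y \<longleftrightarrow> _")
proof
  assume eq: "?X = ?Y"
  have "(\<alpha> - \<alpha>') * u1 p + (\<beta> - \<beta>') * u2 p + (\<gamma> - \<gamma>') = 0" for p
    using arg_cong[OF fun_cong[OF eq, of p], of "\<lambda>z. z $ 1"] by (simp add: model_field_def algebra_simps)
  then have "\<alpha> - \<alpha>' = 0 \<and> \<beta> - \<beta>' = 0 \<and> \<gamma> - \<gamma>' = 0" by (rule combination_zero)
  moreover have "\<delta> = \<delta>'"
    using arg_cong[OF fun_cong[OF eq, of 0], of "\<lambda>z. z $ 2"] by (simp add: model_field_def)
  ultimately show "\<alpha> = \<alpha>' \<and> \<beta> = \<beta>' \<and> \<gamma> = \<gamma>' \<and> \<delta> = \<delta>'" by simp
qed simp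

lemma killing_model_direct_sum:
  "is_direct_sum (killing (\<lambda>_. model a c e F)) (span {times_d1 u1, times_d1 u2}) K0"
proof -
  let ?A = "span {times_d1 u1, times_d1 u2}"
  have A: "\<alpha> *\<^sub>R times_d1 u1 + \<beta> *\<^sub>R times_d1 u2 = model_field u1 u2 \<alpha> \<beta> 0 0" for \<alpha> \<beta>
    by (simp add: model_field_def times_d1_def coord_field_def fun_eq_iff scaleR_fun_def algebra_simps)
  have B: "\<gamma> *\<^sub>R coord_field 1 + \<delta> *\<^sub>R coord_field 2 = model_field u1 u2 0 0 \<gamma> \<delta>" for \<gamma> \<delta>
    by (simp add: model_field_def coord_field_def fun_eq_iff scaleR_fun_def)
  have sum: "model_field u1 u2 \<alpha> \<beta> 0 0 + model_field u1 u2 0 0 \<gamma> \<delta> = model_field u1 u2 \<alpha> \<beta> \<gamma> \<delta>" for \<alpha> \<beta> \<gamma> \<delta>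
    by (simp add: model_field_def fun_eq_iff algebra_simps)
  have zero: "0 = model_field u1 u2 0 0 0 0" by (simp add: model_field_def fun_eq_iff)
  have A': "?A = {model_field u1 u2 \<alpha> \<beta> 0 0 | \<alpha> \<beta>. True}" by (simp add: span_pair A)
  have B': "K0 = {model_field u1 u2 0 0 \<gamma> \<delta> | \<gamma> \<delta>. True}" by (simp add: K0_def span_pair B)
  have "killing (\<lambda>_. model a c e F) = {x + y | x y. x \<in> ?A \<and> y \<in> K0}"
  proof -
    have "{x + y | x y. x \<in> ?A \<and> y \<in> K0}
        = {model_field u1 u2 \<alpha> \<beta> 0 0 + model_field u1 u2 0 0 \<gamma> \<delta> | \<alpha> \<beta> \<gamma> \<delta>. True}"
      unfolding A' B' by blast
    then show ?thesis by (simp only: sum killing_model_eq)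
  qed
  moreover have "?A \<inter> K0 = {0}"
    unfolding A' B' zero by (auto simp: model_field_eq_iff)
  moreover have "subspace ?A" "subspace K0" unfolding K0_def by (rule subspace_span)+
  ultimately show ?thesis unfolding is_direct_sum_def by blast
qed

lemma bracket_model_field:
  "bracket (model_field u1 u2 \<alpha> \<beta> \<gamma> \<delta>) (model_field u1 u2 \<alpha>' \<beta>' \<gamma>' \<delta>') p =
     ((\<alpha> * u1 p + \<beta> * u2 p + \<gamma>) * (\<alpha>' * \<partial>\<^sub>1 u1 p + \<beta>' * \<partial>\<^sub>1 u2 p)
      + \<delta> * (\<alpha>' * \<partial>\<^sub>2 u1 p + \<beta>' * \<partial>\<^sub>2 u2 p)
      - (\<alpha>' * u1 p + \<beta>' * u2 p + \<gamma>') * (\<alpha> * \<partial>\<^sub>1 u1 p + \<beta> * \<partial>\<^sub>1 u2 p)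
      - \<delta>' * (\<alpha> * \<partial>\<^sub>2 u1 p + \<beta> * \<partial>\<^sub>2 u2 p)) *\<^sub>R e1"
proof -
  have D: "ddir v (model_field u1 u2 \<alpha> \<beta> \<gamma> \<delta>) p = (v $ 1 * (\<alpha> * \<partial>\<^sub>1 u1 p + \<beta> * \<partial>\<^sub>1 u2 p)
      + v $ 2 * (\<alpha> * \<partial>\<^sub>2 u1 p + \<beta> * \<partial>\<^sub>2 u2 p)) *\<^sub>R e1" for v \<alpha> \<beta> \<gamma> \<delta>
  proof -
    have d: "(u has_derivative (\<lambda>v. v $ 1 *\<^sub>R \<partial>\<^sub>1 u p + v $ 2 *\<^sub>R \<partial>\<^sub>2 u p)) (at p)" if "smooth_on UNIV u" for u :: "real^2 \<Rightarrow> real"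
    proof -
      have "(\<lambda>v. ddir v u p) = (\<lambda>v. v $ 1 *\<^sub>R \<partial>\<^sub>1 u p + v $ 2 *\<^sub>R \<partial>\<^sub>2 u p)"
        by (rule ext, rule ddir_plane[OF smooth_on_differentiable[OF that UNIV_I]])
      then show ?thesis by (rule has_derivative_eq_rhs[OF smooth_on_has_derivative[OF that UNIV_I]])
    qed
    have "(model_field u1 u2 \<alpha> \<beta> \<gamma> \<delta> has_derivative (\<lambda>v. (\<alpha> * (v $ 1 *\<^sub>R \<partial>\<^sub>1 u1 p + v $ 2 *\<^sub>R \<partial>\<^sub>2 u1 p)
       + \<beta> * (v $ 1 *\<^sub>R \<partial>\<^sub>1 u2 p + v $ 2 *\<^sub>R \<partial>\<^sub>2 u2 p) + 0) *\<^sub>R e1 + 0)) (at p)"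
      unfolding model_field_def
      by (intro has_derivative_add has_derivative_scaleR_left has_derivative_mult_right has_derivative_const d smooth_u)
    from ddir_eqI[OF this, of v] show ?thesis by (simp add: algebra_simps)
  qed
  show ?thesis unfolding bracket_eq D
    by (simp add: vec_eq_iff forall_2 model_field_def algebra_simps)
qed

text \<open>\<open>A\<close>, \<open>B\<close>, \<open>C\<close>, \<open>D\<close> give the
  coefficients of the field assigned to a vector along \<open>u1\<close> d/dx1, \<open>u2\<close>
  d/dx1, d/dx1 and d/dx2. The hypotheses \<open>br\<close> and \<open>br0\<close> are the two
  components of the homomorphism property, by \<open>bracket_model_field\<close>.\<close>

lemma killing_model_lie_isomorphic:
  assumes c: "lie_algebra UNIV br"
    and lin: "linear A" "linear B" "linear C" "linear D"
    and inj: "\<And>x. A x = 0 \<Longrightarrow> B x = 0 \<Longrightarrow> C x = 0 \<Longrightarrow> D x = 0 \<Longrightarrow> x = 0"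
    and surj: "\<And>\<alpha> \<beta> \<gamma> \<delta>. \<exists>x. A x = \<alpha> \<and> B x = \<beta> \<and> C x = \<gamma> \<and> D x = \<delta>"
    and br: "\<And>x y p. (A x * u1 p + B x * u2 p + C x) * (A y * \<partial>\<^sub>1 u1 p + B y * \<partial>\<^sub>1 u2 p)
      + D x * (A y * \<partial>\<^sub>2 u1 p + B y * \<partial>\<^sub>2 u2 p)
      - (A y * u1 p + B y * u2 p + C y) * (A x * \<partial>\<^sub>1 u1 p + B x * \<partial>\<^sub>1 u2 p)
      - D y * (A x * \<partial>\<^sub>2 u1 p + B x * \<partial>\<^sub>2 u2 p) = A (br x y) * u1 p + B (br x y) * u2 p + C (br x y)"
    and br0: "\<And>x y. D (br x y) = 0"
  shows "lie_isomorphic (killing (\<lambda>_. model a c e F)) bracket UNIV br"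
proof (rule lie_isomorphic_if_parametrized[OF c])
  let ?\<Phi> = "\<lambda>x. model_field u1 u2 (A x) (B x) (C x) (D x)"
  note l = linear_add[OF lin(1)] linear_add[OF lin(2)] linear_add[OF lin(3)] linear_add[OF lin(4)]
     linear_cmul[OF lin(1)] linear_cmul[OF lin(2)] linear_cmul[OF lin(3)] linear_cmul[OF lin(4)]
  show \<Phi>: "linear ?\<Phi>"
    by (rule linearI) (simp_all add: l model_field_def fun_eq_iff scaleR_fun_def algebra_simps)
  have zero: "0 = model_field u1 u2 0 0 0 0" by (simp add: model_field_def fun_eq_iff)
  show "inj ?\<Phi>"
    unfolding linear_injective_0[OF \<Phi>] zero model_field_eq_iff using inj by blast
  show "range ?\<Phi> = killing (\<lambda>_. model a c e F)"
    unfolding killing_model_eq using surj by (auto simp: image_iff) metis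
  show "bracket (?\<Phi> x) (?\<Phi> y) = ?\<Phi> (br x y)" for x y
    by (rule ext) (simp only: bracket_model_field br, simp add: model_field_def br0)
qed

end

section \<open>Explicit solutions and brackets for the five models\<close>

lemma solutionI:
  assumes s: "smooth_on UNIV f"
    and f: "\<And>p. (f has_derivative (\<lambda>v. f1 p * v $ 1 + f2 p * v $ 2)) (at p)"
    and f1: "\<And>p. (f1 has_derivative (\<lambda>v. - a * f1 p * v $ 1 + - a * f2 p * v $ 2)) (at p)"
    and f2: "\<And>p. (f2 has_derivative (\<lambda>v. - a * f2 p * v $ 1 + (e * f1 p + h * f2 p) * v $ 2)) (at p)"
  shows "solution a e h f \<and> \<partial>\<^sub>1 f = f1 \<and> \<partial>\<^sub>2 f = f2"
proof -
  have d: "\<partial>\<^sub>1 f = f1" "\<partial>\<^sub>2 f = f2" using ddir_eqI[OF f] by (auto simp: fun_eq_iff)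
  moreover have "solution a e h f"
    unfolding solution_def d using s ddir_eqI[OF f1] ddir_eqI[OF f2] by simp
  ultimately show ?thesis by blast
qed

lemma has_derivative_nth: "((\<lambda>x :: real^'n. x $ i) has_derivative (\<lambda>v. v $ i)) F"
  by (rule bounded_linear_imp_has_derivative[OF bounded_linear_vec_nth])

lemma axis_nth_4 [simp]:
  "axis i (1::real) $ j = (if i = j then 1 else 0)" for i j :: 4
  by (simp add: axis_def)

lemma lie_algebra_A2_A2: "lie_algebra UNIV bracket_A2_A2"
  unfolding lie_algebra_def bracket_A2_A2_def wedge_def
  apply (intro conjI ballI allI subspace_UNIV)
       apply (simp_all add: vec_eq_iff forall_4)
    apply (simp_all add: algebra_simps)
  done

lemma lie_algebra_A4_9_0: "lie_algebra UNIV bracket_A4_9_0"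
  unfolding lie_algebra_def bracket_A4_9_0_def wedge_def
  apply (intro conjI ballI allI subspace_UNIV)
       apply (simp_all add: vec_eq_iff forall_4)
    apply (simp_all add: algebra_simps)
  done

lemma lie_algebra_A4_12: "lie_algebra UNIV bracket_A4_12"
  unfolding lie_algebra_def bracket_A4_12_def wedge_def
  apply (intro conjI ballI allI subspace_UNIV)
       apply (simp_all add: vec_eq_iff forall_4)
    apply (simp_all add: algebra_simps)
  done

lemma bracket_nth:
  "bracket_A2_A2 x y $ 1 = 0" "bracket_A2_A2 x y $ 2 = wedge 1 2 x y"
  "bracket_A2_A2 x y $ 3 = 0" "bracket_A2_A2 x y $ 4 = wedge 3 4 x y"
  "bracket_A4_9_0 x y $ 1 = wedge 2 3 x y + wedge 1 4 x y" "bracket_A4_9_0 x y $ 2 = wedge 2 4 x y"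
  "bracket_A4_9_0 x y $ 3 = 0" "bracket_A4_9_0 x y $ 4 = 0"
  "bracket_A4_12 x y $ 1 = wedge 1 3 x y + wedge 2 4 x y" "bracket_A4_12 x y $ 2 = wedge 2 3 x y - wedge 1 4 x y"
  "bracket_A4_12 x y $ 3 = 0" "bracket_A4_12 x y $ 4 = 0"
  by (simp_all add: bracket_A2_A2_def bracket_A4_9_0_def bracket_A4_12_def)

definition vec4 :: "real \<Rightarrow> real \<Rightarrow> real \<Rightarrow> real \<Rightarrow> real^4" where
  "vec4 a b c d = (\<chi> i. if i = 1 then a else if i = 2 then b else if i = 3 then c else d)"

lemma vec4_nth [simp]: "vec4 a b c d $ 1 = a" "vec4 a b c d $ 2 = b" "vec4 a b c d $ 3 = c" "vec4 a b c d $ 4 = d"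
  by (simp_all add: vec4_def)

lemma vec4_zero: "x = 0 \<longleftrightarrow> x $ 1 = 0 \<and> x $ 2 = 0 \<and> x $ 3 = 0 \<and> x $ 4 = 0" for x :: "real^4"
  by (simp add: vec_eq_iff forall_4)

lemma killing_M1:
  "is_direct_sum (killing (\<lambda>_. M1)) (span {times_d1 (\<lambda>x. exp (x $ 1)), times_d1 (\<lambda>x. x $ 2 * exp (x $ 1))}) K0 \<and>
   lie_isomorphic (killing (\<lambda>_. M1)) bracket UNIV bracket_A4_9_0"
proof -
  let ?u = "\<lambda>x :: real^2. exp (x $ 1)" and ?v = "\<lambda>x :: real^2. x $ 2 * exp (x $ 1)"
  have "solution (-1) 0 (2 - 2 * 1) ?u \<and> \<partial>\<^sub>1 ?u = (\<lambda>p. exp (p $ 1)) \<and> \<partial>\<^sub>2 ?u = (\<lambda>p. 0)"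
    by (rule solutionI; auto intro!: derivative_eq_intros has_derivative_nth smooth_intros simp: algebra_simps)
  then have u: "solution (-1) 0 (2 - 2 * 1) ?u" "\<partial>\<^sub>1 ?u = (\<lambda>p. exp (p $ 1))" "\<partial>\<^sub>2 ?u = (\<lambda>p. 0)" by blast+
  have "solution (-1) 0 (2 - 2 * 1) ?v \<and> \<partial>\<^sub>1 ?v = (\<lambda>p. p $ 2 * exp (p $ 1)) \<and> \<partial>\<^sub>2 ?v = (\<lambda>p. exp (p $ 1))"
    by (rule solutionI; auto intro!: derivative_eq_intros has_derivative_nth smooth_intros simp: algebra_simps)
  then have v: "solution (-1) 0 (2 - 2 * 1) ?v" "\<partial>\<^sub>1 ?v = (\<lambda>p. p $ 2 * exp (p $ 1))" "\<partial>\<^sub>2 ?v = (\<lambda>p. exp (p $ 1))" by blast+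
  have r: "0 * -1 + 2 * 1 - (1::real)\<^sup>2 \<noteq> 0" by simp
  have ne: "\<partial>\<^sub>1 ?u 0 * \<partial>\<^sub>2 ?v 0 - \<partial>\<^sub>2 ?u 0 * \<partial>\<^sub>1 ?v 0 \<noteq> 0" by (simp add: u v)
  \<comment> \<open>The four functionals encode e1 = exp(x1) d/dx1, e2 = x2 exp(x1) d/dx1, e3 =
    -d/dx2, e4 = -d/dx1.\<close>
  have "lie_isomorphic (killing (\<lambda>_. model (-1) 1 0 2)) bracket UNIV bracket_A4_9_0"
  proof (rule killing_model_lie_isomorphic[OF r u(1) v(1) ne lie_algebra_A4_9_0,
        of "\<lambda>x. x $ 1" "\<lambda>x. x $ 2" "\<lambda>x. - x $ 4" "\<lambda>x. - x $ 3"])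
    show "\<exists>x :: real^4. x $ 1 = \<alpha> \<and> x $ 2 = \<beta> \<and> - x $ 4 = \<gamma> \<and> - x $ 3 = \<delta>" for \<alpha> \<beta> \<gamma> \<delta>
      by (rule exI[of _ "vec4 \<alpha> \<beta> (- \<delta>) (- \<gamma>)"]) simp
  qed (unfold u(2,3) v(2,3), auto intro!: linearI simp: vec4_zero bracket_nth wedge_def algebra_simps)
  then show ?thesis
    unfolding M1_def using killing_model_direct_sum[OF r u(1) v(1) ne] by blast
qed

lemma killing_M2:
  assumes "c\<^sup>2 + c \<noteq> 0"
  shows "is_direct_sum (killing (\<lambda>_. M2 c)) (span {times_d1 (\<lambda>x. exp (x $ 1)), times_d1 (\<lambda>x. exp (x $ 1 + x $ 2))}) K0 \<and>
   lie_isomorphic (killing (\<lambda>_. M2 c)) bracket UNIV bracket_A2_A2"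
proof -
  let ?u = "\<lambda>x :: real^2. exp (x $ 1)" and ?v = "\<lambda>x :: real^2. exp (x $ 1 + x $ 2)"
  have "solution (-1) 0 (1 + 2 * c - 2 * c) ?u \<and> \<partial>\<^sub>1 ?u = (\<lambda>p. exp (p $ 1)) \<and> \<partial>\<^sub>2 ?u = (\<lambda>p. 0)"
    by (rule solutionI; auto intro!: derivative_eq_intros has_derivative_nth smooth_intros simp: algebra_simps)
  then have u: "solution (-1) 0 (1 + 2 * c - 2 * c) ?u" "\<partial>\<^sub>1 ?u = (\<lambda>p. exp (p $ 1))" "\<partial>\<^sub>2 ?u = (\<lambda>p. 0)" by blast+
  have "solution (-1) 0 (1 + 2 * c - 2 * c) ?v \<and> \<partial>\<^sub>1 ?v = (\<lambda>p. exp (p $ 1 + p $ 2)) \<and> \<partial>\<^sub>2 ?v = (\<lambda>p. exp (p $ 1 + p $ 2))"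
    by (rule solutionI; auto intro!: derivative_eq_intros has_derivative_nth smooth_intros simp: algebra_simps)
  then have v: "solution (-1) 0 (1 + 2 * c - 2 * c) ?v" "\<partial>\<^sub>1 ?v = (\<lambda>p. exp (p $ 1 + p $ 2))" "\<partial>\<^sub>2 ?v = (\<lambda>p. exp (p $ 1 + p $ 2))" by blast+
  have r: "0 * -1 + (1 + 2 * c) * c - c\<^sup>2 \<noteq> 0" using assms by (simp add: algebra_simps power2_eq_square)
  have ne: "\<partial>\<^sub>1 ?u 0 * \<partial>\<^sub>2 ?v 0 - \<partial>\<^sub>2 ?u 0 * \<partial>\<^sub>1 ?v 0 \<noteq> 0" by (simp add: u v)
  \<comment> \<open>Here e1 = d/dx1 - d/dx2, e2 = exp(x1) d/dx1, e3 = d/dx2, e4 = exp(x1 + x2)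
    d/dx1. The difference in e1 makes it commute with e4.\<close>
  have "lie_isomorphic (killing (\<lambda>_. model (-1) c 0 (1 + 2 * c))) bracket UNIV bracket_A2_A2"
  proof (rule killing_model_lie_isomorphic[OF r u(1) v(1) ne lie_algebra_A2_A2,
        of "\<lambda>x. x $ 2" "\<lambda>x. x $ 4" "\<lambda>x. x $ 1" "\<lambda>x. x $ 3 - x $ 1"])
    show "\<exists>x :: real^4. x $ 2 = \<alpha> \<and> x $ 4 = \<beta> \<and> x $ 1 = \<gamma> \<and> x $ 3 - x $ 1 = \<delta>" for \<alpha> \<beta> \<gamma> \<delta>
      by (rule exI[of _ "vec4 \<gamma> \<alpha> (\<delta> + \<gamma>) \<beta>"]) simp
  qed (unfold u(2,3) v(2,3), auto intro!: linearI simp: vec4_zero bracket_nth wedge_def algebra_simps)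
  then show ?thesis
    unfolding M2_def using killing_model_direct_sum[OF r u(1) v(1) ne] by blast
qed

lemma killing_M3:
  assumes "c\<^sup>2 + c \<noteq> 0"
  shows "is_direct_sum (killing (\<lambda>_. M3 c)) (span {times_d1 (\<lambda>x. exp (x $ 2)), times_d1 (\<lambda>x. x $ 1)}) K0 \<and>
   lie_isomorphic (killing (\<lambda>_. M3 c)) bracket UNIV bracket_A2_A2"
proof -
  let ?u = "\<lambda>x :: real^2. exp (x $ 2)" and ?v = "\<lambda>x :: real^2. x $ 1"
  have "solution 0 0 (1 + 2 * c - 2 * c) ?u \<and> \<partial>\<^sub>1 ?u = (\<lambda>p. 0) \<and> \<partial>\<^sub>2 ?u = (\<lambda>p. exp (p $ 2))"
    by (rule solutionI; auto intro!: derivative_eq_intros has_derivative_nth smooth_intros simp: algebra_simps)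
  then have u: "solution 0 0 (1 + 2 * c - 2 * c) ?u" "\<partial>\<^sub>1 ?u = (\<lambda>p. 0)" "\<partial>\<^sub>2 ?u = (\<lambda>p. exp (p $ 2))" by blast+
  have "solution 0 0 (1 + 2 * c - 2 * c) ?v \<and> \<partial>\<^sub>1 ?v = (\<lambda>p. 1) \<and> \<partial>\<^sub>2 ?v = (\<lambda>p. 0)"
    by (rule solutionI; auto intro!: derivative_eq_intros has_derivative_nth smooth_intros simp: algebra_simps)
  then have v: "solution 0 0 (1 + 2 * c - 2 * c) ?v" "\<partial>\<^sub>1 ?v = (\<lambda>p. 1)" "\<partial>\<^sub>2 ?v = (\<lambda>p. 0)" by blast+
  have r: "0 * 0 + (1 + 2 * c) * c - c\<^sup>2 \<noteq> 0" using assms by (simp add: algebra_simps power2_eq_square)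
  have ne: "\<partial>\<^sub>1 ?u 0 * \<partial>\<^sub>2 ?v 0 - \<partial>\<^sub>2 ?u 0 * \<partial>\<^sub>1 ?v 0 \<noteq> 0" by (simp add: u v)
  \<comment> \<open>Here e1 = d/dx2, e2 = exp(x2) d/dx1, e3 = -x1 d/dx1 - d/dx2, e4 = d/dx1. The
    part -d/dx2 makes e3 commute with e2.\<close>
  have "lie_isomorphic (killing (\<lambda>_. model 0 c 0 (1 + 2 * c))) bracket UNIV bracket_A2_A2"
  proof (rule killing_model_lie_isomorphic[OF r u(1) v(1) ne lie_algebra_A2_A2,
        of "\<lambda>x. x $ 2" "\<lambda>x. - x $ 3" "\<lambda>x. x $ 4" "\<lambda>x. x $ 1 - x $ 3"])
    show "\<exists>x :: real^4. x $ 2 = \<alpha> \<and> - x $ 3 = \<beta> \<and> x $ 4 = \<gamma> \<and> x $ 1 - x $ 3 = \<delta>" for \<alpha> \<beta> \<gamma> \<delta>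
      by (rule exI[of _ "vec4 (\<delta> - \<beta>) \<alpha> (- \<beta>) \<gamma>"]) simp
  qed (unfold u(2,3) v(2,3), auto intro!: linearI simp: vec4_zero bracket_nth wedge_def algebra_simps)
  then show ?thesis
    unfolding M3_def using killing_model_direct_sum[OF r u(1) v(1) ne] by blast
qed

lemma killing_M4:
  "is_direct_sum (killing (\<lambda>_. M4 c)) (span {times_d1 (\<lambda>x. x $ 2), times_d1 (\<lambda>x. c * (x $ 2)\<^sup>2 + 2 * x $ 1)}) K0 \<and>
   lie_isomorphic (killing (\<lambda>_. M4 c)) bracket UNIV bracket_A4_9_0"
proof -
  let ?u = "\<lambda>x :: real^2. x $ 2" and ?v = "\<lambda>x :: real^2. c * (x $ 2)\<^sup>2 + 2 * x $ 1"
  have "solution 0 c (2 - 2 * 1) ?u \<and> \<partial>\<^sub>1 ?u = (\<lambda>p. 0) \<and> \<partial>\<^sub>2 ?u = (\<lambda>p. 1)"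
    by (rule solutionI; auto intro!: derivative_eq_intros has_derivative_nth smooth_intros simp: algebra_simps)
  then have u: "solution 0 c (2 - 2 * 1) ?u" "\<partial>\<^sub>1 ?u = (\<lambda>p. 0)" "\<partial>\<^sub>2 ?u = (\<lambda>p. 1)" by blast+
  have "solution 0 c (2 - 2 * 1) ?v \<and> \<partial>\<^sub>1 ?v = (\<lambda>p. 2) \<and> \<partial>\<^sub>2 ?v = (\<lambda>p. 2 * c * p $ 2)"
    by (rule solutionI; auto intro!: derivative_eq_intros has_derivative_nth smooth_intros simp: algebra_simps)
  then have v: "solution 0 c (2 - 2 * 1) ?v" "\<partial>\<^sub>1 ?v = (\<lambda>p. 2)" "\<partial>\<^sub>2 ?v = (\<lambda>p. 2 * c * p $ 2)" by blast+
  have r: "c * 0 + 2 * 1 - (1::real)\<^sup>2 \<noteq> 0" by simp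
  have ne: "\<partial>\<^sub>1 ?u 0 * \<partial>\<^sub>2 ?v 0 - \<partial>\<^sub>2 ?u 0 * \<partial>\<^sub>1 ?v 0 \<noteq> 0" by (simp add: u v)
  \<comment> \<open>Here e1 = d/dx1, e2 = x2 d/dx1, e3 = c x2 d/dx1 - d/dx2, e4 = (x1 + c x2^2 / 2)
    d/dx1. The correction c x2 d/dx1 makes e3 commute with e4.\<close>
  have "lie_isomorphic (killing (\<lambda>_. model 0 1 c 2)) bracket UNIV bracket_A4_9_0"
  proof (rule killing_model_lie_isomorphic[OF r u(1) v(1) ne lie_algebra_A4_9_0,
        of "\<lambda>x. x $ 2 + c * x $ 3" "\<lambda>x. x $ 4 / 2" "\<lambda>x. x $ 1" "\<lambda>x. - x $ 3"])
    show "\<exists>x :: real^4. x $ 2 + c * x $ 3 = \<alpha> \<and> x $ 4 / 2 = \<beta> \<and> x $ 1 = \<gamma> \<and> - x $ 3 = \<delta>" for \<alpha> \<beta> \<gamma> \<delta>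
      by (rule exI[of _ "vec4 \<gamma> (\<alpha> + c * \<delta>) (- \<delta>) (2 * \<beta>)"]) simp
  qed (unfold u(2,3) v(2,3), auto intro!: linearI simp: vec4_zero bracket_nth wedge_def field_simps power2_eq_square)
  then show ?thesis
    unfolding M4_def using killing_model_direct_sum[OF r u(1) v(1) ne] by blast
qed

lemma killing_M5:
  "is_direct_sum (killing (\<lambda>_. M5 c)) (span {times_d1 (\<lambda>x. exp (x $ 1) * cos (x $ 2)), times_d1 (\<lambda>x. exp (x $ 1) * sin (x $ 2))}) K0 \<and>
   lie_isomorphic (killing (\<lambda>_. M5 c)) bracket UNIV bracket_A4_12"
proof -
  let ?u = "\<lambda>x :: real^2. exp (x $ 1) * cos (x $ 2)" and ?v = "\<lambda>x :: real^2. exp (x $ 1) * sin (x $ 2)"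
  have "solution (-1) (-1) (2 * c - 2 * c) ?u \<and> \<partial>\<^sub>1 ?u = (\<lambda>p. ?u p) \<and> \<partial>\<^sub>2 ?u = (\<lambda>p. - ?v p)"
    by (rule solutionI; auto intro!: derivative_eq_intros has_derivative_nth smooth_intros simp: algebra_simps)
  then have u: "solution (-1) (-1) (2 * c - 2 * c) ?u" "\<partial>\<^sub>1 ?u = (\<lambda>p. ?u p)" "\<partial>\<^sub>2 ?u = (\<lambda>p. - ?v p)" by blast+
  have "solution (-1) (-1) (2 * c - 2 * c) ?v \<and> \<partial>\<^sub>1 ?v = (\<lambda>p. ?v p) \<and> \<partial>\<^sub>2 ?v = (\<lambda>p. ?u p)"
    by (rule solutionI; auto intro!: derivative_eq_intros has_derivative_nth smooth_intros simp: algebra_simps)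
  then have v: "solution (-1) (-1) (2 * c - 2 * c) ?v" "\<partial>\<^sub>1 ?v = (\<lambda>p. ?v p)" "\<partial>\<^sub>2 ?v = (\<lambda>p. ?u p)" by blast+
  have r: "(-1) * (-1) + 2 * c * c - c\<^sup>2 \<noteq> 0"
    using zero_le_power2[of c] by (simp add: power2_eq_square) (metis add_nonneg_eq_0_iff zero_le_one zero_le_square zero_neq_one)
  have ne: "\<partial>\<^sub>1 ?u 0 * \<partial>\<^sub>2 ?v 0 - \<partial>\<^sub>2 ?u 0 * \<partial>\<^sub>1 ?v 0 \<noteq> 0" by (simp add: u v)
  \<comment> \<open>Here e1 and e2 are the cosine and sine fields, e3 = -d/dx1 and e4 = -d/dx2,
    which rotates e1 and e2.\<close>
  have "lie_isomorphic (killing (\<lambda>_. model (-1) c (-1) (2 * c))) bracket UNIV bracket_A4_12"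
  proof (rule killing_model_lie_isomorphic[OF r u(1) v(1) ne lie_algebra_A4_12,
        of "\<lambda>x. x $ 1" "\<lambda>x. x $ 2" "\<lambda>x. - x $ 3" "\<lambda>x. - x $ 4"])
    show "\<exists>x :: real^4. x $ 1 = \<alpha> \<and> x $ 2 = \<beta> \<and> - x $ 3 = \<gamma> \<and> - x $ 4 = \<delta>" for \<alpha> \<beta> \<gamma> \<delta>
      by (rule exI[of _ "vec4 \<alpha> \<beta> (- \<gamma>) (- \<delta>)"]) simp
  qed (unfold u(2,3) v(2,3), auto intro!: linearI simp: vec4_zero bracket_nth wedge_def algebra_simps)
  then show ?thesis
    unfolding M5_def using killing_model_direct_sum[OF r u(1) v(1) ne] by blast
qed

subsection \<open>Surfaces of Type \<open>\<B>\<close>\<close>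

lemma torsion_free_const_iff: "torsion_free UNIV (\<lambda>_. G) \<longleftrightarrow> (\<forall>i j k. G i j k = G j i k)"
proof
  assume T: "torsion_free UNIV (\<lambda>_. G)"
  have "cov (\<lambda>_. G) (\<lambda>_. u) (\<lambda>_. v) 0 - cov (\<lambda>_. G) (\<lambda>_. v) (\<lambda>_. u) 0 = bracket (\<lambda>_. u) (\<lambda>_. v) 0" for u v
    using T by (simp add: torsion_free_def smooth_on_const)
  then have c: "chr G u v = chr G v u" for u v by (simp add: cov_eq bracket_eq)
  have "G 1 2 k = G 2 1 k" for k
    using arg_cong[OF c[of e1 e2], of "\<lambda>z. z $ k"] by (simp add: chr_nth)
  then show "\<forall>i j k. G i j k = G j i k" by (simp add: forall_2)
next
  assume "\<forall>i j k. G i j k = G j i k"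
  then have "chr G u v = chr G v u" for u v
    unfolding vec_eq_iff chr_nth by (metis (no_types, opaque_lifting) add.commute add.left_commute add.assoc mult.commute mult.left_commute mult.assoc)
  then show "torsion_free UNIV (\<lambda>_. G)" by (simp add: torsion_free_def cov_eq bracket_eq)
qed

lemma cov_const: "cov (\<lambda>_. G) (\<lambda>_. u) (\<lambda>_. v) = (\<lambda>_. chr G u v)"
  by (simp add: fun_eq_iff cov_eq)

lemma curvature_const:
  "curvature (\<lambda>_. G) (\<lambda>_. u) (\<lambda>_. v) (\<lambda>_. w) p = chr G u (chr G v w) - chr G v (chr G u w)"
proof -
  have "bracket (\<lambda>_. u) (\<lambda>_. v) = (\<lambda>_. 0)" by (simp add: fun_eq_iff bracket_eq)
  then show ?thesis by (simp add: curvature_def cov_const chr.zero_left)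
qed

text \<open>R(d/dx1, d/dx2) d/dx2 is the Ricci number times d/dx1.\<close>

lemma not_flat_model:
  assumes "e * a + F * c - c\<^sup>2 \<noteq> 0"
  shows "\<not> flat UNIV (\<lambda>_. model a c e F)"
proof
  assume "flat UNIV (\<lambda>_. model a c e F)"
  then have "curvature (\<lambda>_. model a c e F) (\<lambda>_. e1) (\<lambda>_. e2) (\<lambda>_. e2) 0 = 0"
    by (simp add: flat_def smooth_on_const)
  from arg_cong[OF this, of "\<lambda>z. z $ 1"] show False
    using assms by (simp add: curvature_const chr_model algebra_simps power2_eq_square)
qed

lemma affine_surface_const:
  assumes "\<forall>i j k. G i j k = G j i k"
  shows "affine_surface UNIV (\<lambda>_. G)"
  using assms by (simp add: affine_surface_def torsion_free_const_iff smooth_on_const)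

lemma diffeo_onI:
  assumes "open U" "open V" "smooth_on U \<phi>" "smooth_on V \<psi>"
    and "\<And>p. p \<in> U \<Longrightarrow> \<phi> p \<in> V \<and> \<psi> (\<phi> p) = p" "\<And>q. q \<in> V \<Longrightarrow> \<psi> q \<in> U \<and> \<phi> (\<psi> q) = q"
  shows "diffeo_on U V \<phi>"
proof -
  have inj: "inj_on \<phi> U" using assms(5) by (metis inj_onI)
  have img: "\<phi> ` U = V" using assms(5,6) by force
  have "inv_into U \<phi> q = \<psi> q" if "q \<in> V" for q
    using inv_into_f_f[OF inj, of "\<psi> q"] assms(6)[OF that] by simp
  then have "smooth_on V (inv_into U \<phi>)"
    using smooth_on_cong[OF assms(2) _ assms(4), of "inv_into U \<phi>"] by simp
  then show ?thesis using assms inj img by (simp add: diffeo_on_def bij_betw_def)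
qed

text \<open>Translations preserve constant symbols and act transitively.\<close>

lemma locally_homogeneous_const: "locally_homogeneous UNIV (\<lambda>_. G)"
  unfolding locally_homogeneous_def
proof (intro ballI)
  fix p q :: "real^2"
  let ?\<phi> = "\<lambda>x. x + (q - p)"
  have s: "smooth_on UNIV (\<lambda>x :: real^2. x + w)" for w
    by (intro smooth_on_add smooth_on_const smooth_on_bounded_linear bounded_linear_ident open_UNIV)
  have "diffeo_on UNIV UNIV ?\<phi>"
    by (rule diffeo_onI[where \<psi> = "\<lambda>x. x + (p - q)"]) (simp_all add: s)
  moreover have d: "ddir v ?\<phi> = (\<lambda>_. v)" for v
  proof
    have "(?\<phi> has_derivative (\<lambda>v. v + 0)) (at x)" for x
      by (intro has_derivative_add has_derivative_ident has_derivative_const)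
    from ddir_eqI[OF this] show "ddir v ?\<phi> x = v" for x by simp
  qed
  ultimately have "affine_diffeo UNIV (\<lambda>_. G) UNIV (\<lambda>_. G) ?\<phi>"
    by (simp add: affine_diffeo_iff d)
  then show "\<exists>V W \<phi>. p \<in> V \<and> V \<subseteq> UNIV \<and> q \<in> W \<and> W \<subseteq> UNIV \<and> affine_diffeo V (\<lambda>_. G) W (\<lambda>_. G) \<phi> \<and> \<phi> p = q"
    by (intro exI[of _ UNIV] exI[of _ ?\<phi>]) simp
qed

section \<open>Charts of Type B for the first four models\<close>

text \<open>An ansatz wide enough for \<open>M1\<close> to \<open>M4\<close>: a global chart
  (\<open>y\<close>, \<open>z\<close>) in which only \<open>C\<^sub>1\<^sub>1\<^sup>1 = A\<close>
  and \<open>C\<^sub>1\<^sub>2\<^sup>2 = B\<close> survive. \<open>eqs\<close> is the transformation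
  law of \<open>affine_diffeo_iff\<close>, with the derivatives supplied in closed form.\<close>

lemma type_B_if_chart:
  assumes r: "e * a + F * c - c\<^sup>2 \<noteq> 0"
    and d: "diffeo_on UNIV W (\<lambda>x. y x *\<^sub>R e1 + z x *\<^sub>R e2)" and W: "W \<subseteq> {x. x $ 1 \<noteq> 0}"
    and y: "\<And>p. (y has_derivative (\<lambda>v. y' v p)) (at p)" "\<And>v p. (y' v has_derivative (\<lambda>u. y'' u v p)) (at p)"
    and z: "\<And>p. (z has_derivative (\<lambda>v. z' v p)) (at p)" "\<And>v p. (z' v has_derivative (\<lambda>u. z'' u v p)) (at p)"
    and eqs: "\<And>p u v. y'' u v p + A * y' u p * y' v p / y p = y' (chr (model a c e F) u v) p"
      "\<And>p u v. z'' u v p + B * (y' u p * z' v p + z' u p * y' v p) / y p = z' (chr (model a c e F) u v) p"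
  shows "type_B UNIV (\<lambda>_. model a c e F)"
proof -
  let ?G = "model a c e F" and ?C = "const_christoffel A 0 0 B 0 0"
  let ?\<phi> = "\<lambda>x. y x *\<^sub>R e1 + z x *\<^sub>R e2"
  have d1: "ddir v ?\<phi> = (\<lambda>p. y' v p *\<^sub>R e1 + z' v p *\<^sub>R e2)" for v
  proof
    show "ddir v ?\<phi> p = y' v p *\<^sub>R e1 + z' v p *\<^sub>R e2" for p
      by (rule ddir_eqI[of _ "\<lambda>v. y' v p *\<^sub>R e1 + z' v p *\<^sub>R e2"]) (intro has_derivative_add has_derivative_scaleR_left y z)
  qed
  have d2: "ddir u (\<lambda>p. y' v p *\<^sub>R e1 + z' v p *\<^sub>R e2) p = y'' u v p *\<^sub>R e1 + z'' u v p *\<^sub>R e2" for u v p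
    by (rule ddir_eqI[of _ "\<lambda>u. y'' u v p *\<^sub>R e1 + z'' u v p *\<^sub>R e2"]) (intro has_derivative_add has_derivative_scaleR_left y z)
  have chrC: "chr (\<lambda>i j k. ?C i j k / t) u v = (A * u $ 1 * v $ 1 / t) *\<^sub>R e1 + (B * (u $ 1 * v $ 2 + u $ 2 * v $ 1) / t) *\<^sub>R e2" for t u v
    by (simp add: vec_eq_iff forall_2 chr_nth const_christoffel_def add_divide_distrib algebra_simps)
  have "affine_diffeo UNIV (\<lambda>_. ?G) W (\<lambda>x i j k. ?C i j k / x $ 1) ?\<phi>"
    unfolding affine_diffeo_iff
    using d eqs by (simp add: d1 d2 chrC vec_eq_iff forall_2)
  moreover have "?C i j k = ?C j i k" for i j k by (simp add: const_christoffel_def)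
  ultimately have "\<exists>V W \<phi>. \<exists>C :: christoffel.
       p \<in> V \<and> V \<subseteq> UNIV \<and> W \<subseteq> {x. x $ 1 \<noteq> 0} \<and> (\<forall>i j k. C i j k = C j i k) \<and>
       affine_diffeo V (\<lambda>_. ?G) W (\<lambda>x i j k. C i j k / x $ 1) \<phi>" for p
    using W by (intro exI[of _ UNIV] exI[of _ W] exI[of _ ?\<phi>] exI[of _ ?C]) simp
  moreover have "affine_surface UNIV (\<lambda>_. ?G)"
    by (rule affine_surface_const) (simp add: const_christoffel_def forall_2)
  ultimately show ?thesis
    unfolding type_B_def using locally_homogeneous_const not_flat_model[OF r] by blast
qed

lemma open_halfplanes:
  "open {x :: real^2. 0 < x $ i}" "open {x :: real^2. x $ i < 0}"
  using open_halfspace_component_gt_cart[of 0 i] open_halfspace_component_lt_cart[of i 0] by simp_all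

text \<open>
  The charts below straighten Killing fields \<open>X\<close>, \<open>Y\<close> with \<open>[X, Y] = X\<close> to \<open>\<partial>\<^sub>2\<close> and
  \<open>x\<^sup>1 \<partial>\<^sub>1 + x\<^sup>2 \<partial>\<^sub>2\<close>, which are Killing fields of every connection \<open>C / x\<^sup>1\<close>.
\<close>

lemma type_B_exp:
  assumes "F * c - c\<^sup>2 \<noteq> 0"
  shows "type_B UNIV (\<lambda>_. model (-1) c 0 F)"
proof -
  let ?W = "{q :: real^2. 0 < q $ 1} \<inter> {q. q $ 2 < 0}"
  \<comment> \<open>This straightens X = exp(x1) d/dx1 and Y = d/dx2 - d/dx1.\<close>
  let ?y = "\<lambda>x :: real^2. exp (x $ 2)" and ?z = "\<lambda>x :: real^2. - exp (- x $ 1)"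
  have W: "open ?W" by (intro open_Int open_halfplanes)
  have "diffeo_on UNIV ?W (\<lambda>x. ?y x *\<^sub>R e1 + ?z x *\<^sub>R e2)"
  proof (rule diffeo_onI[where \<psi> = "\<lambda>q. (- ln (- q $ 2)) *\<^sub>R e1 + ln (q $ 1) *\<^sub>R e2"])
    show "smooth_on ?W (\<lambda>q. (- ln (- q $ 2)) *\<^sub>R e1 + ln (q $ 1) *\<^sub>R e2)"
      using W by (auto intro!: smooth_intros)
  qed (use W in \<open>auto intro!: smooth_intros simp: vec_eq_iff forall_2\<close>)
  then show ?thesis
    \<comment> \<open>The coefficients are forced: the equation for \<open>y\<close> requires 1 + A
      = F, and the mixed terms in the equation for \<open>z\<close> require B = c.\<close>
    by (rule type_B_if_chart[where A = "F - 1" and B = c and y' = "\<lambda>v p. v $ 2 * exp (p $ 2)"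
          and y'' = "\<lambda>u v p. u $ 2 * v $ 2 * exp (p $ 2)" and z' = "\<lambda>v p. v $ 1 * exp (- p $ 1)"
          and z'' = "\<lambda>u v p. - (u $ 1 * v $ 1) * exp (- p $ 1)", rotated])
      (use assms in \<open>auto intro!: derivative_eq_intros has_derivative_nth simp: chr_model field_simps\<close>)
qed

lemma type_B_M1: "type_B UNIV (\<lambda>_. M1)"
  unfolding M1_def by (rule type_B_exp) simp

lemma type_B_M2: "c\<^sup>2 + c \<noteq> 0 \<Longrightarrow> type_B UNIV (\<lambda>_. M2 c)"
  unfolding M2_def by (rule type_B_exp) (simp add: algebra_simps power2_eq_square)

lemma type_B_M3:
  assumes "c\<^sup>2 + c \<noteq> 0"
  shows "type_B UNIV (\<lambda>_. M3 c)"
proof -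
  let ?W = "{q :: real^2. 0 < q $ 1}"
  \<comment> \<open>This straightens X = exp(x2) d/dx1 and Y = -d/dx2.\<close>
  let ?y = "\<lambda>x :: real^2. exp (- x $ 2)" and ?z = "\<lambda>x :: real^2. x $ 1 * exp (- x $ 2)"
  have W: "open ?W" by (rule open_halfplanes)
  have "diffeo_on UNIV ?W (\<lambda>x. ?y x *\<^sub>R e1 + ?z x *\<^sub>R e2)"
  proof (rule diffeo_onI[where \<psi> = "\<lambda>q. (q $ 2 * inverse (q $ 1)) *\<^sub>R e1 + (- ln (q $ 1)) *\<^sub>R e2"])
    show "smooth_on ?W (\<lambda>q. (q $ 2 * inverse (q $ 1)) *\<^sub>R e1 + (- ln (q $ 1)) *\<^sub>R e2)"
      using W by (auto intro!: smooth_intros)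
  qed (use W in \<open>auto intro!: smooth_intros simp: vec_eq_iff forall_2 exp_minus ln_inverse\<close>)
  then show ?thesis unfolding M3_def
    by (rule type_B_if_chart[where A = "- 2 - 2 * c" and B = "- 1 - c" and y' = "\<lambda>v p. - v $ 2 * exp (- p $ 2)"
          and y'' = "\<lambda>u v p. u $ 2 * v $ 2 * exp (- p $ 2)" and z' = "\<lambda>v p. (v $ 1 - p $ 1 * v $ 2) * exp (- p $ 2)"
          and z'' = "\<lambda>u v p. (- u $ 1 * v $ 2 - u $ 2 * v $ 1 + p $ 1 * u $ 2 * v $ 2) * exp (- p $ 2)", rotated])
      (use assms in \<open>auto intro!: derivative_eq_intros has_derivative_nth simp: chr_model field_simps power2_eq_square\<close>)
qed

lemma smooth_on_divide_const: "open U \<Longrightarrow> smooth_on U f \<Longrightarrow> smooth_on U (\<lambda>p. f p / (k :: real))"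
  by (rule smooth_on_compose_bounded_linear[OF _ bounded_linear_divide])

lemma type_B_M4: "type_B UNIV (\<lambda>_. M4 c)"
proof -
  let ?W = "{q :: real^2. 0 < q $ 1}"
  \<comment> \<open>The polynomial solution of h - h' = c t^2 / 2. With it the chart straightens X =
    d/dx1 and Y = (x1 + c x2^2 / 2) d/dx1 + d/dx2.\<close>
  let ?h = "\<lambda>t :: real. c / 2 * (t\<^sup>2 + 2 * t + 2)"
  let ?y = "\<lambda>x :: real^2. exp (x $ 2)" and ?z = "\<lambda>x :: real^2. x $ 1 + ?h (x $ 2)"
  have W: "open ?W" by (rule open_halfplanes)
  have "diffeo_on UNIV ?W (\<lambda>x. ?y x *\<^sub>R e1 + ?z x *\<^sub>R e2)"
  proof (rule diffeo_onI[where \<psi> = "\<lambda>q. (q $ 2 - ?h (ln (q $ 1))) *\<^sub>R e1 + ln (q $ 1) *\<^sub>R e2"])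
    show "smooth_on ?W (\<lambda>q. (q $ 2 - ?h (ln (q $ 1))) *\<^sub>R e1 + ln (q $ 1) *\<^sub>R e2)"
      using W by (auto intro!: smooth_intros smooth_on_divide_const)
  qed (use W in \<open>auto intro!: smooth_intros smooth_on_divide_const simp: vec_eq_iff forall_2\<close>)
  then show ?thesis unfolding M4_def
    by (rule type_B_if_chart[where A = 1 and B = 1 and y' = "\<lambda>v p. v $ 2 * exp (p $ 2)"
          and y'' = "\<lambda>u v p. u $ 2 * v $ 2 * exp (p $ 2)" and z' = "\<lambda>v p. v $ 1 + c * (p $ 2 + 1) * v $ 2"
          and z'' = "\<lambda>u v p. c * u $ 2 * v $ 2", rotated])
      (auto intro!: derivative_eq_intros has_derivative_nth simp: chr_model field_simps power2_eq_square)
qed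

section \<open>Nonexistence of Type B charts for the fifth model\<close>

text \<open>
  With \<open>C\<^sub>i\<close> the matrix \<open>v \<mapsto> C(\<partial>\<^sub>i, v)\<close>, the curvature of \<open>C / x\<^sup>1\<close> is \<open>(x\<^sup>1)\<^sup>-\<^sup>2\<close> times
  \<open>K = - C\<^sub>2 + C\<^sub>1 C\<^sub>2 - C\<^sub>2 C\<^sub>1\<close>.  For \<open>w = y\<close> and \<open>w = z\<close> the coefficients in the next two
  conclusions are the rows of \<open>K\<close>; \<open>i\<close> stands for \<open>1 / y\<close>.
\<close>

lemma compatibility_identity_1:
  fixes i c A B D E G H P Q R :: real
  assumes "y11 = - y1 - i * (A * y1 * y1 + B * (y1 * z1 + z1 * y1) + D * z1 * z1)"
    "y12 = c * y1 - i * (A * y1 * y2 + B * (y1 * z2 + z1 * y2) + D * z1 * z2)"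
    "z11 = - z1 - i * (E * y1 * y1 + G * (y1 * z1 + z1 * y1) + H * z1 * z1)"
    "z12 = c * z1 - i * (E * y1 * y2 + G * (y1 * z2 + z1 * y2) + H * z1 * z2)"
    "w11 = - w1 - i * (P * y1 * y1 + Q * (y1 * z1 + z1 * y1) + R * z1 * z1)"
    "w12 = c * w1 - i * (P * y1 * y2 + Q * (y1 * z2 + z1 * y2) + R * z1 * z2)"
    and "- w12 + i * i * y2 * (P * y1 * y1 + Q * (y1 * z1 + z1 * y1) + R * z1 * z1)
       - i * (P * (y12 * y1 + y1 * y12) + Q * (y12 * z1 + y1 * z12 + (z12 * y1 + z1 * y12)) + R * (z12 * z1 + z1 * z12))
     = c * w11 + i * i * y1 * (P * y1 * y2 + Q * (y1 * z2 + z1 * y2) + R * z1 * z2)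
       - i * (P * (y11 * y2 + y1 * y12) + Q * (y11 * z2 + y1 * z12 + (z11 * y2 + z1 * y12)) + R * (z11 * z2 + z1 * z12))"
  shows "i * i * (y1 * z2 - y2 * z1) * ((- Q + P * B + Q * G - Q * A - R * E) * y1
     + (- R + P * D + Q * H - Q * B - R * G) * z1) = 0"
  using assms(7) unfolding assms(1-6) by algebra

lemma compatibility_identity_2:
  fixes i c A B D E G H P Q R :: real
  assumes "y12 = c * y1 - i * (A * y1 * y2 + B * (y1 * z2 + z1 * y2) + D * z1 * z2)"
    "y22 = - y1 + 2 * c * y2 - i * (A * y2 * y2 + B * (y2 * z2 + z2 * y2) + D * z2 * z2)"
    "z12 = c * z1 - i * (E * y1 * y2 + G * (y1 * z2 + z1 * y2) + H * z1 * z2)"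
    "z22 = - z1 + 2 * c * z2 - i * (E * y2 * y2 + G * (y2 * z2 + z2 * y2) + H * z2 * z2)"
    "w11 = - w1 - i * (P * y1 * y1 + Q * (y1 * z1 + z1 * y1) + R * z1 * z1)"
    "w12 = c * w1 - i * (P * y1 * y2 + Q * (y1 * z2 + z1 * y2) + R * z1 * z2)"
    and "c * w12 + i * i * y2 * (P * y1 * y2 + Q * (y1 * z2 + z1 * y2) + R * z1 * z2)
       - i * (P * (y12 * y2 + y1 * y22) + Q * (y12 * z2 + y1 * z22 + (z12 * y2 + z1 * y22)) + R * (z12 * z2 + z1 * z22))
     = - w11 + 2 * c * w12 + i * i * y1 * (P * y2 * y2 + Q * (y2 * z2 + z2 * y2) + R * z2 * z2)
       - i * (P * (y12 * y2 + y2 * y12) + Q * (y12 * z2 + y2 * z12 + (z12 * y2 + z2 * y12)) + R * (z12 * z2 + z2 * z12))"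
  shows "i * i * (y1 * z2 - y2 * z1) * ((- Q + P * B + Q * G - Q * A - R * E) * y2
     + (- R + P * D + Q * H - Q * B - R * G) * z2) = (1 + c\<^sup>2) * w1"
  using assms(7) unfolding assms(1-6) by algebra

text \<open>Differentiates a right-hand side of the chart equations once more: \<open>s\<close> and
  \<open>t\<close> will be the first derivatives of the component considered, \<open>f\<close>,
  \<open>f'\<close> those of \<open>y\<close> and \<open>g\<close>, \<open>g'\<close> those of
  \<open>z\<close>.\<close>

lemma ddir_quadratic_over:
  fixes y f g f' g' s t :: "'a::real_normed_vector \<Rightarrow> real"
  assumes U: "open U" "p \<in> U" and y: "\<And>q. q \<in> U \<Longrightarrow> y q \<noteq> 0"
    and sm: "smooth_on U y" "smooth_on U f" "smooth_on U g" "smooth_on U f'" "smooth_on U g'"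
      "smooth_on U s" "smooth_on U t"
    and h: "\<And>q. q \<in> U \<Longrightarrow> h q = \<alpha> * s q + \<beta> * t q
      - inverse (y q) * (P * f q * f' q + Q * (f q * g' q + g q * f' q) + R * g q * g' q)"
  shows "ddir v h p = \<alpha> * ddir v s p + \<beta> * ddir v t p
    + inverse (y p) * inverse (y p) * ddir v y p * (P * f p * f' p + Q * (f p * g' p + g p * f' p) + R * g p * g' p)
    - inverse (y p) * (P * (ddir v f p * f' p + f p * ddir v f' p)
      + Q * (ddir v f p * g' p + f p * ddir v g' p + (ddir v g p * f' p + g p * ddir v f' p))
      + R * (ddir v g p * g' p + g p * ddir v g' p))"
proof -
  note d = sm[THEN smooth_on_has_derivative, OF U(2)]
  have "ddir v h p = ddir v (\<lambda>q. \<alpha> * s q + \<beta> * t q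
      - inverse (y q) * (P * f q * f' q + Q * (f q * g' q + g q * f' q) + R * g q * g' q)) p"
    by (rule ddir_cong[OF U h])
  also have "\<dots> = \<alpha> * ddir v s p + \<beta> * ddir v t p
    + inverse (y p) * inverse (y p) * ddir v y p * (P * f p * f' p + Q * (f p * g' p + g p * f' p) + R * g p * g' p)
    - inverse (y p) * (P * (ddir v f p * f' p + f p * ddir v f' p)
      + Q * (ddir v f p * g' p + f p * ddir v g' p + (ddir v g p * f' p + g p * ddir v f' p))
      + R * (ddir v g p * g' p + g p * ddir v g' p))"
    by (rule ddir_eqI, rule has_derivative_eq_rhs, (rule derivative_intros d y U(2))+)
       (simp add: fun_eq_iff algebra_simps)
  finally show ?thesis .
qed

text \<open>
  The law by which \<open>(y, z)\<close> transforms \<open>M5 c\<close> into \<open>C / x\<^sup>1\<close>, where \<open>(A, B, D)\<close> and \<open>(E, G, H)\<close> are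
  \<open>(C\<^sub>1\<^sub>1\<^sup>k, C\<^sub>1\<^sub>2\<^sup>k, C\<^sub>2\<^sub>2\<^sup>k)\<close> for \<open>k = 1\<close> and \<open>k = 2\<close>.
\<close>

locale chart_equations =
  fixes U :: "(real^2) set" and y z :: "real^2 \<Rightarrow> real" and c A B D E G H :: real
  assumes U: "open U" and sy: "smooth_on U y" and sz: "smooth_on U z"
    and y0: "\<And>p. p \<in> U \<Longrightarrow> y p \<noteq> 0"
    and J0: "\<And>p. p \<in> U \<Longrightarrow> \<partial>\<^sub>1 y p * \<partial>\<^sub>2 z p - \<partial>\<^sub>2 y p * \<partial>\<^sub>1 z p \<noteq> 0"
    and y11: "\<And>p. p \<in> U \<Longrightarrow> \<partial>\<^sub>1 (\<partial>\<^sub>1 y) p = - \<partial>\<^sub>1 y p - inverse (y p) *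
        (A * \<partial>\<^sub>1 y p * \<partial>\<^sub>1 y p + B * (\<partial>\<^sub>1 y p * \<partial>\<^sub>1 z p + \<partial>\<^sub>1 z p * \<partial>\<^sub>1 y p) + D * \<partial>\<^sub>1 z p * \<partial>\<^sub>1 z p)"
    and y12: "\<And>p. p \<in> U \<Longrightarrow> \<partial>\<^sub>1 (\<partial>\<^sub>2 y) p = c * \<partial>\<^sub>1 y p - inverse (y p) *
        (A * \<partial>\<^sub>1 y p * \<partial>\<^sub>2 y p + B * (\<partial>\<^sub>1 y p * \<partial>\<^sub>2 z p + \<partial>\<^sub>1 z p * \<partial>\<^sub>2 y p) + D * \<partial>\<^sub>1 z p * \<partial>\<^sub>2 z p)"
    and y22: "\<And>p. p \<in> U \<Longrightarrow> \<partial>\<^sub>2 (\<partial>\<^sub>2 y) p = - \<partial>\<^sub>1 y p + 2 * c * \<partial>\<^sub>2 y p - inverse (y p) *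
        (A * \<partial>\<^sub>2 y p * \<partial>\<^sub>2 y p + B * (\<partial>\<^sub>2 y p * \<partial>\<^sub>2 z p + \<partial>\<^sub>2 z p * \<partial>\<^sub>2 y p) + D * \<partial>\<^sub>2 z p * \<partial>\<^sub>2 z p)"
    and z11: "\<And>p. p \<in> U \<Longrightarrow> \<partial>\<^sub>1 (\<partial>\<^sub>1 z) p = - \<partial>\<^sub>1 z p - inverse (y p) *
        (E * \<partial>\<^sub>1 y p * \<partial>\<^sub>1 y p + G * (\<partial>\<^sub>1 y p * \<partial>\<^sub>1 z p + \<partial>\<^sub>1 z p * \<partial>\<^sub>1 y p) + H * \<partial>\<^sub>1 z p * \<partial>\<^sub>1 z p)"
    and z12: "\<And>p. p \<in> U \<Longrightarrow> \<partial>\<^sub>1 (\<partial>\<^sub>2 z) p = c * \<partial>\<^sub>1 z p - inverse (y p) *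
        (E * \<partial>\<^sub>1 y p * \<partial>\<^sub>2 y p + G * (\<partial>\<^sub>1 y p * \<partial>\<^sub>2 z p + \<partial>\<^sub>1 z p * \<partial>\<^sub>2 y p) + H * \<partial>\<^sub>1 z p * \<partial>\<^sub>2 z p)"
    and z22: "\<And>p. p \<in> U \<Longrightarrow> \<partial>\<^sub>2 (\<partial>\<^sub>2 z) p = - \<partial>\<^sub>1 z p + 2 * c * \<partial>\<^sub>2 z p - inverse (y p) *
        (E * \<partial>\<^sub>2 y p * \<partial>\<^sub>2 y p + G * (\<partial>\<^sub>2 y p * \<partial>\<^sub>2 z p + \<partial>\<^sub>2 z p * \<partial>\<^sub>2 y p) + H * \<partial>\<^sub>2 z p * \<partial>\<^sub>2 z p)"
begin

text \<open>Equality of curvatures, for \<open>w = y\<close> or \<open>w = z\<close> with the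
  matching row of C. On \<open>M5 c\<close> one has R(d/dx1, d/dx2) d/dx1 = 0 and R(d/dx1, d/dx2)
  d/dx2 = (1 + c^2) d/dx1; this gives the two right-hand sides. The Jacobian enters because the
  curvature is skew in its first two arguments; in the first equation it is divided out.\<close>

lemma compatibility:
  fixes w :: "real^2 \<Rightarrow> real" and P Q R :: real
  assumes p: "p \<in> U" and sw: "smooth_on U w"
    and w11: "\<And>p. p \<in> U \<Longrightarrow> \<partial>\<^sub>1 (\<partial>\<^sub>1 w) p = - \<partial>\<^sub>1 w p - inverse (y p) *
        (P * \<partial>\<^sub>1 y p * \<partial>\<^sub>1 y p + Q * (\<partial>\<^sub>1 y p * \<partial>\<^sub>1 z p + \<partial>\<^sub>1 z p * \<partial>\<^sub>1 y p) + R * \<partial>\<^sub>1 z p * \<partial>\<^sub>1 z p)"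
    and w12: "\<And>p. p \<in> U \<Longrightarrow> \<partial>\<^sub>1 (\<partial>\<^sub>2 w) p = c * \<partial>\<^sub>1 w p - inverse (y p) *
        (P * \<partial>\<^sub>1 y p * \<partial>\<^sub>2 y p + Q * (\<partial>\<^sub>1 y p * \<partial>\<^sub>2 z p + \<partial>\<^sub>1 z p * \<partial>\<^sub>2 y p) + R * \<partial>\<^sub>1 z p * \<partial>\<^sub>2 z p)"
    and w22: "\<And>p. p \<in> U \<Longrightarrow> \<partial>\<^sub>2 (\<partial>\<^sub>2 w) p = - \<partial>\<^sub>1 w p + 2 * c * \<partial>\<^sub>2 w p - inverse (y p) *
        (P * \<partial>\<^sub>2 y p * \<partial>\<^sub>2 y p + Q * (\<partial>\<^sub>2 y p * \<partial>\<^sub>2 z p + \<partial>\<^sub>2 z p * \<partial>\<^sub>2 y p) + R * \<partial>\<^sub>2 z p * \<partial>\<^sub>2 z p)"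
  shows "(- Q + P * B + Q * G - Q * A - R * E) * \<partial>\<^sub>1 y p + (- R + P * D + Q * H - Q * B - R * G) * \<partial>\<^sub>1 z p = 0"
    (is ?one)
    and "(\<partial>\<^sub>1 y p * \<partial>\<^sub>2 z p - \<partial>\<^sub>2 y p * \<partial>\<^sub>1 z p) * ((- Q + P * B + Q * G - Q * A - R * E) * \<partial>\<^sub>2 y p
      + (- R + P * D + Q * H - Q * B - R * G) * \<partial>\<^sub>2 z p) = (1 + c\<^sup>2) * (y p)\<^sup>2 * \<partial>\<^sub>1 w p" (is ?two)
proof -
  let ?i = "inverse (y p)"
  note s = sy smooth_on_ddir[OF sy, of e1] smooth_on_ddir[OF sy, of e2]
    smooth_on_ddir[OF sz, of e1] smooth_on_ddir[OF sz, of e2]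
    smooth_on_ddir[OF sw, of e1] smooth_on_ddir[OF sw, of e2]
  have c12: "\<partial>\<^sub>2 (\<partial>\<^sub>1 y) p = \<partial>\<^sub>1 (\<partial>\<^sub>2 y) p" "\<partial>\<^sub>2 (\<partial>\<^sub>1 z) p = \<partial>\<^sub>1 (\<partial>\<^sub>2 z) p" "\<partial>\<^sub>2 (\<partial>\<^sub>1 w) p = \<partial>\<^sub>1 (\<partial>\<^sub>2 w) p"
    by (rule ddir_commute[OF U p sy] ddir_commute[OF U p sz] ddir_commute[OF U p sw])+
  \<comment> \<open>The summands with factor 0 keep the exact shape of
    \<open>ddir_quadratic_over\<close>; the \<open>simp only\<close> calls below remove them so that
    the polynomial identities apply verbatim.\<close>
  have 211: "\<partial>\<^sub>2 (\<partial>\<^sub>1 (\<partial>\<^sub>1 w)) p = (-1) * \<partial>\<^sub>2 (\<partial>\<^sub>1 w) p + 0 * \<partial>\<^sub>2 (\<partial>\<^sub>2 w) p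
     + ?i * ?i * \<partial>\<^sub>2 y p * (P * \<partial>\<^sub>1 y p * \<partial>\<^sub>1 y p + Q * (\<partial>\<^sub>1 y p * \<partial>\<^sub>1 z p + \<partial>\<^sub>1 z p * \<partial>\<^sub>1 y p) + R * \<partial>\<^sub>1 z p * \<partial>\<^sub>1 z p)
     - ?i * (P * (\<partial>\<^sub>2 (\<partial>\<^sub>1 y) p * \<partial>\<^sub>1 y p + \<partial>\<^sub>1 y p * \<partial>\<^sub>2 (\<partial>\<^sub>1 y) p)
       + Q * (\<partial>\<^sub>2 (\<partial>\<^sub>1 y) p * \<partial>\<^sub>1 z p + \<partial>\<^sub>1 y p * \<partial>\<^sub>2 (\<partial>\<^sub>1 z) p + (\<partial>\<^sub>2 (\<partial>\<^sub>1 z) p * \<partial>\<^sub>1 y p + \<partial>\<^sub>1 z p * \<partial>\<^sub>2 (\<partial>\<^sub>1 y) p))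
       + R * (\<partial>\<^sub>2 (\<partial>\<^sub>1 z) p * \<partial>\<^sub>1 z p + \<partial>\<^sub>1 z p * \<partial>\<^sub>2 (\<partial>\<^sub>1 z) p))"
    by (rule ddir_quadratic_over[OF U p y0 s(1,2,4,2,4,6,7)]) (simp_all add: w11)
  have 112: "\<partial>\<^sub>1 (\<partial>\<^sub>1 (\<partial>\<^sub>2 w)) p = c * \<partial>\<^sub>1 (\<partial>\<^sub>1 w) p + 0 * \<partial>\<^sub>1 (\<partial>\<^sub>2 w) p
     + ?i * ?i * \<partial>\<^sub>1 y p * (P * \<partial>\<^sub>1 y p * \<partial>\<^sub>2 y p + Q * (\<partial>\<^sub>1 y p * \<partial>\<^sub>2 z p + \<partial>\<^sub>1 z p * \<partial>\<^sub>2 y p) + R * \<partial>\<^sub>1 z p * \<partial>\<^sub>2 z p)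
     - ?i * (P * (\<partial>\<^sub>1 (\<partial>\<^sub>1 y) p * \<partial>\<^sub>2 y p + \<partial>\<^sub>1 y p * \<partial>\<^sub>1 (\<partial>\<^sub>2 y) p)
       + Q * (\<partial>\<^sub>1 (\<partial>\<^sub>1 y) p * \<partial>\<^sub>2 z p + \<partial>\<^sub>1 y p * \<partial>\<^sub>1 (\<partial>\<^sub>2 z) p + (\<partial>\<^sub>1 (\<partial>\<^sub>1 z) p * \<partial>\<^sub>2 y p + \<partial>\<^sub>1 z p * \<partial>\<^sub>1 (\<partial>\<^sub>2 y) p))
       + R * (\<partial>\<^sub>1 (\<partial>\<^sub>1 z) p * \<partial>\<^sub>2 z p + \<partial>\<^sub>1 z p * \<partial>\<^sub>1 (\<partial>\<^sub>2 z) p))"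
    by (rule ddir_quadratic_over[OF U p y0 s(1,2,4,3,5,6,7)]) (simp_all add: w12)
  have 212: "\<partial>\<^sub>2 (\<partial>\<^sub>1 (\<partial>\<^sub>2 w)) p = c * \<partial>\<^sub>2 (\<partial>\<^sub>1 w) p + 0 * \<partial>\<^sub>2 (\<partial>\<^sub>2 w) p
     + ?i * ?i * \<partial>\<^sub>2 y p * (P * \<partial>\<^sub>1 y p * \<partial>\<^sub>2 y p + Q * (\<partial>\<^sub>1 y p * \<partial>\<^sub>2 z p + \<partial>\<^sub>1 z p * \<partial>\<^sub>2 y p) + R * \<partial>\<^sub>1 z p * \<partial>\<^sub>2 z p)
     - ?i * (P * (\<partial>\<^sub>2 (\<partial>\<^sub>1 y) p * \<partial>\<^sub>2 y p + \<partial>\<^sub>1 y p * \<partial>\<^sub>2 (\<partial>\<^sub>2 y) p)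
       + Q * (\<partial>\<^sub>2 (\<partial>\<^sub>1 y) p * \<partial>\<^sub>2 z p + \<partial>\<^sub>1 y p * \<partial>\<^sub>2 (\<partial>\<^sub>2 z) p + (\<partial>\<^sub>2 (\<partial>\<^sub>1 z) p * \<partial>\<^sub>2 y p + \<partial>\<^sub>1 z p * \<partial>\<^sub>2 (\<partial>\<^sub>2 y) p))
       + R * (\<partial>\<^sub>2 (\<partial>\<^sub>1 z) p * \<partial>\<^sub>2 z p + \<partial>\<^sub>1 z p * \<partial>\<^sub>2 (\<partial>\<^sub>2 z) p))"
    by (rule ddir_quadratic_over[OF U p y0 s(1,2,4,3,5,6,7)]) (simp_all add: w12)
  have 122: "\<partial>\<^sub>1 (\<partial>\<^sub>2 (\<partial>\<^sub>2 w)) p = (-1) * \<partial>\<^sub>1 (\<partial>\<^sub>1 w) p + 2 * c * \<partial>\<^sub>1 (\<partial>\<^sub>2 w) p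
     + ?i * ?i * \<partial>\<^sub>1 y p * (P * \<partial>\<^sub>2 y p * \<partial>\<^sub>2 y p + Q * (\<partial>\<^sub>2 y p * \<partial>\<^sub>2 z p + \<partial>\<^sub>2 z p * \<partial>\<^sub>2 y p) + R * \<partial>\<^sub>2 z p * \<partial>\<^sub>2 z p)
     - ?i * (P * (\<partial>\<^sub>1 (\<partial>\<^sub>2 y) p * \<partial>\<^sub>2 y p + \<partial>\<^sub>2 y p * \<partial>\<^sub>1 (\<partial>\<^sub>2 y) p)
       + Q * (\<partial>\<^sub>1 (\<partial>\<^sub>2 y) p * \<partial>\<^sub>2 z p + \<partial>\<^sub>2 y p * \<partial>\<^sub>1 (\<partial>\<^sub>2 z) p + (\<partial>\<^sub>1 (\<partial>\<^sub>2 z) p * \<partial>\<^sub>2 y p + \<partial>\<^sub>2 z p * \<partial>\<^sub>1 (\<partial>\<^sub>2 y) p))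
       + R * (\<partial>\<^sub>1 (\<partial>\<^sub>2 z) p * \<partial>\<^sub>2 z p + \<partial>\<^sub>2 z p * \<partial>\<^sub>1 (\<partial>\<^sub>2 z) p))"
    by (rule ddir_quadratic_over[OF U p y0 s(1,3,5,3,5,6,7)]) (simp_all add: w22)
  have "?i * ?i * (\<partial>\<^sub>1 y p * \<partial>\<^sub>2 z p - \<partial>\<^sub>2 y p * \<partial>\<^sub>1 z p) * ((- Q + P * B + Q * G - Q * A - R * E) * \<partial>\<^sub>1 y p
     + (- R + P * D + Q * H - Q * B - R * G) * \<partial>\<^sub>1 z p) = 0"
    by (rule compatibility_identity_1[OF y11[OF p] y12[OF p] z11[OF p] z12[OF p] w11[OF p] w12[OF p]])
       (use 211 112 ddir_ddir_ddir_commute(1)[OF U p sw, of e2 e1] in \<open>simp only: c12 mult_minus1 mult_zero_left add_0_right\<close>)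
  then show ?one using y0[OF p] J0[OF p] by simp
  have "?i * ?i * (\<partial>\<^sub>1 y p * \<partial>\<^sub>2 z p - \<partial>\<^sub>2 y p * \<partial>\<^sub>1 z p) * ((- Q + P * B + Q * G - Q * A - R * E) * \<partial>\<^sub>2 y p
     + (- R + P * D + Q * H - Q * B - R * G) * \<partial>\<^sub>2 z p) = (1 + c\<^sup>2) * \<partial>\<^sub>1 w p"
    by (rule compatibility_identity_2[OF y12[OF p] y22[OF p] z12[OF p] z22[OF p] w11[OF p] w12[OF p]])
       (use 212 122 ddir_ddir_ddir_commute(2)[OF U p sw, of e2 e1] in \<open>simp only: c12 mult_minus1 mult_zero_left add_0_right\<close>)
  then show ?two using y0[OF p] by (simp add: divide_simps power2_eq_square)
qed

text \<open>Only the conditions for \<open>w = y\<close> enter. Where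
  \<open>\<partial>\<^sub>1 y\<close> is nonzero they make the square of \<open>m\<close> a fixed
  nonzero multiple of the square of \<open>y\<close>, although \<open>\<partial>\<^sub>1 m\<close>
  vanishes and \<open>\<partial>\<^sub>1 y\<close> does not.\<close>

lemma first_partial_zero:
  assumes p: "p \<in> U"
  shows "\<partial>\<^sub>1 y p = 0"
proof (rule ccontr)
  assume n: "\<partial>\<^sub>1 y p \<noteq> 0"
  \<comment> \<open>(\<open>k\<close>, \<open>l\<close>) is the first row of the matrix K, left
    unsimplified to match \<open>compatibility\<close>.\<close>
  define k where "k = - B + A * B + B * G - B * A - D * E"
  define l where "l = - D + A * D + B * H - B * B - D * G"
  define \<sigma> where "\<sigma> = l * (1 + c\<^sup>2)"
  have one: "k * \<partial>\<^sub>1 y q + l * \<partial>\<^sub>1 z q = 0"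
    and two: "(\<partial>\<^sub>1 y q * \<partial>\<^sub>2 z q - \<partial>\<^sub>2 y q * \<partial>\<^sub>1 z q) * (k * \<partial>\<^sub>2 y q + l * \<partial>\<^sub>2 z q) = (1 + c\<^sup>2) * (y q)\<^sup>2 * \<partial>\<^sub>1 y q"
    if "q \<in> U" for q
    using compatibility[OF that sy y11 y12 y22] by (simp_all add: k_def l_def)
  have s: "1 + c\<^sup>2 \<noteq> 0" using zero_le_power2[of c] by linarith
  have l: "l \<noteq> 0"
  proof
    assume "l = 0"
    then have "k = 0" using one[OF p] n by simp
    then show False using two[OF p] \<open>l = 0\<close> n s y0[OF p] by simp
  qed
  define m where "m = (\<lambda>q. k * \<partial>\<^sub>2 y q + l * \<partial>\<^sub>2 z q)"
  \<comment> \<open>By \<open>one\<close>, \<open>l\<close> times the Jacobian equals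
    \<open>\<partial>\<^sub>1 y\<close> times \<open>m\<close>; multiplying \<open>two\<close> by
    \<open>l\<close> gives the claim.\<close>
  have m: "((m q)\<^sup>2 - \<sigma> * (y q)\<^sup>2) * \<partial>\<^sub>1 y q = 0" if "q \<in> U" for q
    using one[OF that] two[OF that] unfolding m_def \<sigma>_def by algebra
  have sm: "smooth_on U m" unfolding m_def
    by (intro smooth_on_add smooth_on_mult smooth_on_const smooth_on_ddir U sy sz)
  \<comment> \<open>Commuting derivatives, \<open>\<partial>\<^sub>1 m\<close> is the
    \<open>\<partial>\<^sub>2\<close>-derivative of the left-hand side of
    \<open>one\<close>.\<close>
  have "\<partial>\<^sub>1 m p = k * \<partial>\<^sub>1 (\<partial>\<^sub>2 y) p + l * \<partial>\<^sub>1 (\<partial>\<^sub>2 z) p + 0 * \<partial>\<^sub>1 (\<partial>\<^sub>2 z) p"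
    by (rule ddir_lincomb[OF U p]) (simp_all add: m_def smooth_on_ddir sy sz)
  also have "\<dots> = k * \<partial>\<^sub>2 (\<partial>\<^sub>1 y) p + l * \<partial>\<^sub>2 (\<partial>\<^sub>1 z) p + 0 * \<partial>\<^sub>2 (\<partial>\<^sub>1 z) p"
    by (simp add: ddir_commute[OF U p sy, of e1 e2] ddir_commute[OF U p sz, of e1 e2])
  also have "\<dots> = \<partial>\<^sub>2 (\<lambda>_. 0) p"
    by (rule ddir_lincomb[OF U p, symmetric]) (simp_all add: one smooth_on_ddir sy sz)
  finally have m1: "\<partial>\<^sub>1 m p = 0" by simp
  \<comment> \<open>The whole product is differentiated because it vanishes on all of
    \<open>U\<close>, while the first factor is known to vanish only where
    \<open>\<partial>\<^sub>1 y\<close> does not. At \<open>p\<close> the only term left is -2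
    \<open>\<sigma>\<close> y times the square of \<open>\<partial>\<^sub>1 y\<close>.\<close>
  have "((\<lambda>q. (m q * m q - \<sigma> * (y q * y q)) * \<partial>\<^sub>1 y q) has_derivative
      (\<lambda>v. (m p * m p - \<sigma> * (y p * y p)) * ddir v (\<partial>\<^sub>1 y) p
        + ((m p * ddir v m p + ddir v m p * m p) - \<sigma> * (y p * ddir v y p + ddir v y p * y p)) * \<partial>\<^sub>1 y p)) (at p)"
    by (intro has_derivative_mult has_derivative_diff has_derivative_mult_right
        smooth_on_has_derivative[OF _ p] sm sy smooth_on_ddir)
  from ddir_eqI[OF this, of e1] have "\<partial>\<^sub>1 (\<lambda>q. (m q * m q - \<sigma> * (y q * y q)) * \<partial>\<^sub>1 y q) p
     = (m p * m p - \<sigma> * (y p * y p)) * \<partial>\<^sub>1 (\<partial>\<^sub>1 y) p - \<sigma> * (2 * y p * \<partial>\<^sub>1 y p) * \<partial>\<^sub>1 y p"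
    by (simp add: m1)
  moreover have "\<partial>\<^sub>1 (\<lambda>q. (m q * m q - \<sigma> * (y q * y q)) * \<partial>\<^sub>1 y q) p = \<partial>\<^sub>1 (\<lambda>_. 0) p"
    by (rule ddir_cong[OF U p]) (use m in \<open>simp add: power2_eq_square\<close>)
  moreover have "m p * m p - \<sigma> * (y p * y p) = 0" using m[OF p] n by (simp add: power2_eq_square)
  ultimately show False using l s n y0[OF p] by (simp add: \<sigma>_def)
qed

lemma inconsistent:
  assumes p: "p \<in> U"
  shows False
proof -
  have y1: "\<partial>\<^sub>1 y q = 0" if "q \<in> U" for q by (rule first_partial_zero[OF that])
  have y1v: "ddir v (\<partial>\<^sub>1 y) q = 0" if "q \<in> U" for v q
    using ddir_cong[OF U that, of "\<partial>\<^sub>1 y" "\<lambda>_. 0" v] y1 by simp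
  have z1: "\<partial>\<^sub>1 z q \<noteq> 0" and y2: "\<partial>\<^sub>2 y q \<noteq> 0" if "q \<in> U" for q
    using J0[OF that] y1[OF that] by auto
  \<comment> \<open>With \<open>\<partial>\<^sub>1 y = 0\<close> on \<open>U\<close>, the equations
    for \<open>y11\<close> and \<open>y12\<close> and the first condition for \<open>z\<close> each
    reduce to one coefficient times nonzero factors, which kills \<open>D\<close>, \<open>B\<close>
    and \<open>H\<close> in turn.\<close>
  have D: "D = 0" using y11[OF p] y1[OF p] y1v[OF p] z1[OF p] y0[OF p] by simp
  have "\<partial>\<^sub>1 (\<partial>\<^sub>2 y) p = 0" using ddir_commute[OF U p sy, of e1 e2] y1v[OF p] by simp
  then have B: "B = 0" using y12[OF p] y1[OF p] z1[OF p] y2[OF p] y0[OF p] by (simp add: D)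
  have H: "H = 0"
    using compatibility(1)[OF p sz z11 z12 z22] y1[OF p] z1[OF p] by (simp add: D B)
  define k where "k = - G + G * G - G * A"
  have two: "k * (\<partial>\<^sub>2 y q)\<^sup>2 = - (1 + c\<^sup>2) * (y q)\<^sup>2" if "q \<in> U" for q
  proof -
    have "\<partial>\<^sub>1 z q * (k * (\<partial>\<^sub>2 y q)\<^sup>2 + (1 + c\<^sup>2) * (y q)\<^sup>2) = 0"
      using compatibility(2)[OF that sz z11 z12 z22] y1[OF that] D B H unfolding k_def by algebra
    then have "k * (\<partial>\<^sub>2 y q)\<^sup>2 + (1 + c\<^sup>2) * (y q)\<^sup>2 = 0"
      using z1[OF that] by (simp only: mult_eq_0_iff) simp
    then show ?thesis by algebra
  qed
  \<comment> \<open>Differentiating \<open>two\<close> along \<open>e2\<close> and cancelling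
    \<open>\<partial>\<^sub>2 y\<close> gives a second relation, to be compared with
    \<open>y22\<close>.\<close>
  have "((\<lambda>q. k * (\<partial>\<^sub>2 y q * \<partial>\<^sub>2 y q) + (1 + c\<^sup>2) * (y q * y q)) has_derivative
      (\<lambda>v. k * (\<partial>\<^sub>2 y p * ddir v (\<partial>\<^sub>2 y) p + ddir v (\<partial>\<^sub>2 y) p * \<partial>\<^sub>2 y p) + (1 + c\<^sup>2) * (y p * ddir v y p + ddir v y p * y p))) (at p)"
    by (intro has_derivative_mult has_derivative_add has_derivative_mult_right
        smooth_on_has_derivative[OF _ p] sy smooth_on_ddir)
  from ddir_eqI[OF this, of e2] have "\<partial>\<^sub>2 (\<lambda>q. k * (\<partial>\<^sub>2 y q * \<partial>\<^sub>2 y q) + (1 + c\<^sup>2) * (y q * y q)) p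
     = 2 * \<partial>\<^sub>2 y p * (k * \<partial>\<^sub>2 (\<partial>\<^sub>2 y) p + (1 + c\<^sup>2) * y p)"
    by (simp add: algebra_simps)
  moreover have "\<partial>\<^sub>2 (\<lambda>q. k * (\<partial>\<^sub>2 y q * \<partial>\<^sub>2 y q) + (1 + c\<^sup>2) * (y q * y q)) p = \<partial>\<^sub>2 (\<lambda>_. 0) p"
    by (rule ddir_cong[OF U p]) (use two in \<open>simp add: power2_eq_square algebra_simps\<close>)
  ultimately have "\<partial>\<^sub>2 y p * (k * \<partial>\<^sub>2 (\<partial>\<^sub>2 y) p + (1 + c\<^sup>2) * y p) = 0" by simp
  then have "k * \<partial>\<^sub>2 (\<partial>\<^sub>2 y) p + (1 + c\<^sup>2) * y p = 0"
    using y2[OF p] by (simp only: mult_eq_0_iff) simp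
  then have k22: "k * \<partial>\<^sub>2 (\<partial>\<^sub>2 y) p = - (1 + c\<^sup>2) * y p" by algebra
  \<comment> \<open>Passing to the logarithmic derivative turns both relations into polynomial
    equations in the number \<open>t\<close>.\<close>
  define t where "t = \<partial>\<^sub>2 y p / y p"
  have t: "t \<noteq> 0" "\<partial>\<^sub>2 y p = t * y p" using y2[OF p] y0[OF p] by (simp_all add: t_def)
  have y22': "\<partial>\<^sub>2 (\<partial>\<^sub>2 y) p = (2 * c * t - A * t\<^sup>2) * y p"
    using y22[OF p] y1[OF p] y0[OF p] by (simp add: D B t(2) power2_eq_square field_simps)
  have 1: "k * t\<^sup>2 = - (1 + c\<^sup>2)"
    using two[OF p] y0[OF p] by (simp add: t(2) power_mult_distrib flip: mult.assoc)
  have 2: "k * (2 * c * t - A * t\<^sup>2) = - (1 + c\<^sup>2)"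
    using k22 y0[OF p] by (simp add: y22' flip: mult.assoc)
  have s: "1 + c\<^sup>2 > 0" using zero_le_power2[of c] by linarith
  have k0: "k \<noteq> 0" using 1 s by auto
  have "k * t * (2 * c - A * t - t) = 0" using 1 2 by (simp add: power2_eq_square algebra_simps)
  then have "2 * c - A * t - t = 0" using k0 t(1) by (simp only: mult_eq_0_iff) simp
  then have 3: "2 * c = (1 + A) * t" by algebra
  \<comment> \<open>By \<open>3\<close>, \<open>k * t\<^sup>2\<close> equals (Gt)^2 - 2c(Gt);
    completing the square and using \<open>1\<close> gives the claim, so \<open>G * t\<close> is the
    real number s of the overview.\<close>
  have "(G * t - c)\<^sup>2 + 1 = 0" using 1 3 unfolding k_def by algebra
  then show False using zero_le_power2[of "G * t - c"] by linarith
qed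

end

text \<open>The chart equations are contradictory on any nonempty open set, so the chart around the
  origin already gives the contradiction.\<close>

lemma not_type_B_M5: "\<not> type_B UNIV (\<lambda>_. M5 c)"
proof
  assume "type_B UNIV (\<lambda>_. M5 c)"
  then obtain V W \<phi> and C :: christoffel where V: "0 \<in> V" and W: "W \<subseteq> {x. x $ 1 \<noteq> 0}"
    and C: "\<And>i j k. C i j k = C j i k" and aff: "affine_diffeo V (\<lambda>_. M5 c) W (\<lambda>x i j k. C i j k / x $ 1) \<phi>"
    unfolding type_B_def by blast
  have dif: "diffeo_on V W \<phi>" and eq: "ddir u (ddir v \<phi>) p + chr (\<lambda>i j k. C i j k / \<phi> p $ 1) (ddir u \<phi> p) (ddir v \<phi> p)
        = ddir (chr (M5 c) u v) \<phi> p" if "p \<in> V" for p u v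
    using aff that by (auto simp: affine_diffeo_iff)
  have V': "open V" and s: "smooth_on V \<phi>" and img: "\<phi> ` V = W"
    using dif[OF V] by (auto simp: diffeo_on_def bij_betw_def)
  let ?y = "\<lambda>p. \<phi> p $ 1" and ?z = "\<lambda>p. \<phi> p $ 2"
  have n: "ddir v \<phi> p $ i = ddir v (\<lambda>p. \<phi> p $ i) p" "ddir u (ddir v \<phi>) p $ i = ddir u (ddir v (\<lambda>p. \<phi> p $ i)) p"
    if "p \<in> V" for p u v i
    using ddir_nth[OF smooth_on_differentiable[OF s that]] ddir_ddir_nth[OF V' that s] by auto
  have pl: "ddir w \<phi> p $ i = w $ 1 * \<partial>\<^sub>1 (\<lambda>p. \<phi> p $ i) p + w $ 2 * \<partial>\<^sub>2 (\<lambda>p. \<phi> p $ i) p" if "p \<in> V" for p w i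
    using arg_cong[OF ddir_plane[OF smooth_on_differentiable[OF s that], of w], of "\<lambda>z. z $ i"] by (simp add: n[OF that])
  have pl': "ddir w (\<lambda>p. \<phi> p $ i) p = w $ 1 * \<partial>\<^sub>1 (\<lambda>p. \<phi> p $ i) p + w $ 2 * \<partial>\<^sub>2 (\<lambda>p. \<phi> p $ i) p" if "p \<in> V" for p w i
    using pl[OF that, of w i] n(1)[OF that, of w i] by simp
  have chrC: "chr (\<lambda>i j k. C i j k / t) u v $ i = inverse t * (C 1 1 i * u $ 1 * v $ 1
      + C 1 2 i * (u $ 1 * v $ 2 + u $ 2 * v $ 1) + C 2 2 i * u $ 2 * v $ 2)" for t u v i
    by (simp add: chr_nth C[of 2 1] divide_inverse algebra_simps)
  have eqs: "ddir u (ddir v (\<lambda>p. \<phi> p $ i)) p = chr (M5 c) u v $ 1 * \<partial>\<^sub>1 (\<lambda>p. \<phi> p $ i) p + chr (M5 c) u v $ 2 * \<partial>\<^sub>2 (\<lambda>p. \<phi> p $ i) p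
     - inverse (?y p) * (C 1 1 i * ddir u ?y p * ddir v ?y p + C 1 2 i * (ddir u ?y p * ddir v ?z p + ddir u ?z p * ddir v ?y p)
        + C 2 2 i * ddir u ?z p * ddir v ?z p)" if "p \<in> V" for p u v i
    using arg_cong[OF eq[OF that, of u v], of "\<lambda>z. z $ i"]
    by (simp only: chrC vector_add_component pl'[OF that, of "chr (M5 c) u v"] n[OF that])
  have J: "\<partial>\<^sub>1 ?y p * \<partial>\<^sub>2 ?z p - \<partial>\<^sub>2 ?y p * \<partial>\<^sub>1 ?z p \<noteq> 0" if p: "p \<in> V" for p
  proof
    assume J: "\<partial>\<^sub>1 ?y p * \<partial>\<^sub>2 ?z p - \<partial>\<^sub>2 ?y p * \<partial>\<^sub>1 ?z p = 0"
    have inj: "inj (\<lambda>u. ddir u \<phi> p)" by (rule inj_ddir_diffeo[OF dif[OF p] p])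
    have zero: "u = 0" if "ddir u \<phi> p = 0" for u
      using injD[OF inj, of u 0] that smooth_on_differentiable[OF s p] by simp
    \<comment> \<open>Each vector is annihilated by one row of the Jacobian matrix, and by the other
      row when the determinant is 0. Injectivity makes both vanish, and then \<open>e1\<close> lies
      in the kernel.\<close>
    let ?u = "\<partial>\<^sub>2 ?y p *\<^sub>R e1 - \<partial>\<^sub>1 ?y p *\<^sub>R e2" and ?v = "\<partial>\<^sub>2 ?z p *\<^sub>R e1 - \<partial>\<^sub>1 ?z p *\<^sub>R e2"
    have "ddir ?u \<phi> p = 0" "ddir ?v \<phi> p = 0"
      using J by (simp_all add: vec_eq_iff forall_2 pl[OF p, of ?u] pl[OF p, of ?v] algebra_simps)
    then have "?u = 0" "?v = 0" using zero[of ?u] zero[of ?v] by simp_all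
    then have "\<partial>\<^sub>1 ?y p = 0" "\<partial>\<^sub>1 ?z p = 0" by (simp_all add: vec_eq_iff forall_2)
    then have "ddir e1 \<phi> p = 0" by (simp add: vec_eq_iff forall_2 n[OF p])
    then show False using zero[of e1] by (simp add: vec_eq_iff forall_2)
  qed
  have y0: "?y p \<noteq> 0" if "p \<in> V" for p using that img W by auto
  have chrM: "chr (M5 c) e1 e1 $ 1 = - 1" "chr (M5 c) e1 e1 $ 2 = 0" "chr (M5 c) e1 e2 $ 1 = c" "chr (M5 c) e1 e2 $ 2 = 0"
     "chr (M5 c) e2 e2 $ 1 = - 1" "chr (M5 c) e2 e2 $ 2 = 2 * c"
    by (simp_all add: M5_def chr_model)
  interpret chart_equations V ?y ?z c "C 1 1 1" "C 1 2 1" "C 2 2 1" "C 1 1 2" "C 1 2 2" "C 2 2 2"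
    by unfold_locales (simp_all add: V' smooth_on_nth s y0 J[simplified] eqs chrM)
  show False by (rule inconsistent[OF V])
qed

subsection \<open>Linear equivalence\<close>

lemma ddir_matrix: "ddir v ((*v) T) = (\<lambda>_. T *v v)" for T :: "real^'n^'m"
proof
  show "ddir v ((*v) T) p = T *v v" for p
    by (rule ddir_eqI) (rule linear_imp_has_derivative, rule matrix_vector_mul_linear)
qed

text \<open>The columns of \<open>S\<close> are a basis in which the product of \<open>G\<close> has
  the symbols \<open>H\<close>; the linear map required by \<open>linearly_equivalent\<close> is the
  inverse of \<open>S\<close>.\<close>

lemma linearly_equivalentI:
  assumes "invertible S" and S: "\<And>u v. chr G (S *v u) (S *v v) = S *v chr H u v"
  shows "linearly_equivalent G H"
proof -
  obtain T where T: "S ** T = mat 1" "T ** S = mat 1" using assms(1) by (auto simp: invertible_def)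
  have TS: "T *v (S *v u) = u" and ST: "S *v (T *v u) = u" for u
    by (simp_all add: matrix_vector_mul_assoc T)
  have sm: "smooth_on UNIV ((*v) A)" for A :: "real^2^2"
    by (rule smooth_on_bounded_linear) (rule matrix_vector_mul_bounded_linear)
  have "diffeo_on UNIV UNIV ((*v) T)"
  proof -
    have "bij ((*v) T)" by (rule o_bij[of "(*v) S"]) (simp_all add: fun_eq_iff TS ST)
    moreover have "inv ((*v) T) = (*v) S" by (rule inv_unique_comp) (simp_all add: fun_eq_iff TS ST)
    ultimately show ?thesis by (simp add: diffeo_on_def sm)
  qed
  moreover have "chr H (T *v u) (T *v v) = T *v chr G u v" for u v
    using arg_cong[OF S[of "T *v u" "T *v v"], of "(*v) T"] by (simp add: ST TS)
  ultimately have "affine_diffeo UNIV (\<lambda>_. G) UNIV (\<lambda>_. H) ((*v) T)"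
    by (simp add: affine_diffeo_iff ddir_matrix)
  moreover have "invertible T" using T by (auto simp: invertible_def)
  ultimately show ?thesis unfolding linearly_equivalent_def by blast
qed

section \<open>Changes of basis and normal forms\<close>

text \<open>The determinant with columns \<open>u\<close> and \<open>v\<close>. It tests for a basis
  and yields coordinates and traces in that basis by Cramer's rule.\<close>

definition area :: "real^2 \<Rightarrow> real^2 \<Rightarrow> real" where
  "area u v = u $ 1 * v $ 2 - u $ 2 * v $ 1"

lemma chr_commute:
  assumes "\<And>i j k. G i j k = G j i k"
  shows "chr G u v = chr G v u"
  by (simp add: vec_eq_iff chr_nth assms[of 2 1] algebra_simps)

lemma linearly_equivalent_model:
  assumes G: "\<And>i j k. G i j k = G j i k" and f: "area f1 f2 \<noteq> 0"
    and eq: "chr G f1 f1 = a *\<^sub>R f1" "chr G f1 f2 = c *\<^sub>R f1" "chr G f2 f2 = e *\<^sub>R f1 + F *\<^sub>R f2"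
  shows "linearly_equivalent G (model a c e F)"
proof (rule linearly_equivalentI)
  let ?S = "transpose (vector [f1, f2]) :: real^2^2"
  have S: "?S *v u = u $ 1 *\<^sub>R f1 + u $ 2 *\<^sub>R f2" for u
    by (simp add: vec_eq_iff matrix_vector_mult_def transpose_def sum_2 mult.commute)
  have "det ?S = area f1 f2" by (simp add: det_2 area_def transpose_def)
  then show "invertible ?S" using f by (simp add: invertible_det_nz del: det_transpose)
  show "chr G (?S *v u) (?S *v v) = ?S *v chr (model a c e F) u v" for u v
    using chr_commute[of G f2 f1, OF G]
    by (simp only: S) (simp add: chr.add_left chr.add_right chr.scaleR_left chr.scaleR_right eq chr_model algebra_simps)
qed

text \<open>The changes of basis that preserve the line of \<open>f1\<close>: replace
  \<open>f1\<close> by \<open>\<alpha>\<close> f1 and \<open>f2\<close> by \<open>\<beta>\<close> f2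
  + \<open>\<gamma>\<close> f1. The third equation of \<open>new\<close> is multiplied by
  \<open>\<alpha>\<close> to avoid a division.\<close>

lemma linearly_equivalent_model_rescale:
  assumes G: "\<And>i j k. G i j k = G j i k" and f: "area f1 f2 \<noteq> 0"
    and eq: "chr G f1 f1 = a *\<^sub>R f1" "chr G f1 f2 = c *\<^sub>R f1" "chr G f2 f2 = e *\<^sub>R f1 + F *\<^sub>R f2"
    and ne: "\<alpha> \<noteq> 0" "\<beta> \<noteq> 0"
    and new: "a' = \<alpha> * a" "c' = \<beta> * c + \<gamma> * a" "\<alpha> * e' = \<beta>\<^sup>2 * e + 2 * \<beta> * \<gamma> * c + \<gamma>\<^sup>2 * a - \<beta> * \<gamma> * F" "F' = \<beta> * F"
  shows "linearly_equivalent G (model a' c' e' F')"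
proof (rule linearly_equivalent_model[OF G])
  let ?f1 = "\<alpha> *\<^sub>R f1" and ?f2 = "\<beta> *\<^sub>R f2 + \<gamma> *\<^sub>R f1"
  have c: "chr G f2 f1 = c *\<^sub>R f1" using chr_commute[of G f2 f1, OF G] eq(2) by simp
  have "area ?f1 ?f2 = \<alpha> * \<beta> * area f1 f2" by (simp add: area_def algebra_simps)
  then show "area ?f1 ?f2 \<noteq> 0" using f ne by simp
  show "chr G ?f1 ?f1 = a' *\<^sub>R ?f1" "chr G ?f1 ?f2 = c' *\<^sub>R ?f1"
    by (simp_all add: chr.add_right chr.scaleR_left chr.scaleR_right eq new algebra_simps)
  have "chr G ?f2 ?f2 $ i = (e' *\<^sub>R ?f1 + F' *\<^sub>R ?f2) $ i" for i
  proof -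
    have "chr G ?f2 ?f2 $ i = \<beta>\<^sup>2 * (e * f1 $ i + F * f2 $ i) + 2 * \<beta> * \<gamma> * c * f1 $ i + \<gamma>\<^sup>2 * a * f1 $ i"
      by (simp add: chr.add_right chr.add_left chr.scaleR_left chr.scaleR_right eq c power2_eq_square
          distrib_left)
    also have "\<dots> = (\<alpha> * e') * f1 $ i + \<beta> * F * (\<beta> * f2 $ i + \<gamma> * f1 $ i)"
      unfolding new(3) by algebra
    also have "\<dots> = (e' *\<^sub>R ?f1 + F' *\<^sub>R ?f2) $ i" by (simp add: new(4))
    finally show ?thesis .
  qed
  then show "chr G ?f2 ?f2 = e' *\<^sub>R ?f1 + F' *\<^sub>R ?f2" by (simp add: vec_eq_iff)
qed

text \<open>Under these changes \<open>a\<close> is scaled by \<open>\<alpha>\<close>,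
  \<open>F\<close> by \<open>\<beta>\<close>, and the number in \<open>r\<close> by the square of
  \<open>\<beta>\<close>. So the vanishing of \<open>a\<close> and the sign of d = F^2 - 4r = (F -
  2c)^2 - 4ea are invariant. If \<open>a = 0\<close>, then d = 0 gives \<open>M4\<close> and d > 0
  gives \<open>M3\<close>; otherwise d = 0, d > 0, d < 0 give \<open>M1\<close>, \<open>M2\<close>,
  \<open>M5\<close>.\<close>

lemma classification_from_basis:
  assumes G: "\<And>i j k. G i j k = G j i k" and f: "area f1 f2 \<noteq> 0"
    and eq: "chr G f1 f1 = a *\<^sub>R f1" "chr G f1 f2 = c *\<^sub>R f1" "chr G f2 f2 = e *\<^sub>R f1 + F *\<^sub>R f2"
    and r: "e * a + F * c - c\<^sup>2 \<noteq> 0"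
  shows "linearly_equivalent G M1 \<or>
         (\<exists>c. c\<^sup>2 + c \<noteq> 0 \<and> linearly_equivalent G (M2 c)) \<or>
         (\<exists>c. c\<^sup>2 + c \<noteq> 0 \<and> linearly_equivalent G (M3 c)) \<or>
         (\<exists>c. linearly_equivalent G (M4 c)) \<or>
         (\<exists>c. linearly_equivalent G (M5 c))"
proof -
  note le = linearly_equivalent_model_rescale[OF G f eq]
  show ?thesis
  proof (cases "a = 0")
    case True
    have r': "c * (F - c) \<noteq> 0" using r True by (simp add: algebra_simps power2_eq_square)
    show ?thesis
    proof (cases "F = 2 * c")
      case True
      have "c \<noteq> 0" using r' by auto
      then have "linearly_equivalent G (M4 (e / c\<^sup>2))" unfolding M4_def
        by (intro le[where \<alpha> = 1 and \<beta> = "1 / c" and \<gamma> = 0])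
           (simp_all add: True \<open>a = 0\<close> power_divide)
      then show ?thesis by blast
    next
      case False
      \<comment> \<open>This normalizes F' - 2c' to 1. Then the new \<open>e\<close> is
        \<open>\<beta>\<^sup>2 * e - \<gamma>\<close>, hence the shear
        \<open>\<beta>\<^sup>2 * e\<close> below.\<close>
      define \<beta> where "\<beta> = 1 / (F - 2 * c)"
      have \<beta>: "\<beta> \<noteq> 0" "\<beta> * (F - 2 * c) = 1" using False by (simp_all add: \<beta>_def)
      have F: "\<beta> * F = 1 + 2 * (\<beta> * c)" using \<beta>(2) by (simp add: algebra_simps)
      have "linearly_equivalent G (M3 (\<beta> * c))" unfolding M3_def
      proof (rule le[where \<alpha> = 1 and \<beta> = \<beta> and \<gamma> = "\<beta>\<^sup>2 * e"])
        show "1 * 0 = \<beta>\<^sup>2 * e + 2 * \<beta> * (\<beta>\<^sup>2 * e) * c + (\<beta>\<^sup>2 * e)\<^sup>2 * a - \<beta> * (\<beta>\<^sup>2 * e) * F"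
          using \<beta>(2) True by algebra
      qed (use \<beta> True F in simp_all)
      moreover have "(\<beta> * c)\<^sup>2 + \<beta> * c = \<beta>\<^sup>2 * (c * (F - c))" using F by algebra
      then have "(\<beta> * c)\<^sup>2 + \<beta> * c \<noteq> 0" using r' \<beta> by simp
      ultimately show ?thesis by blast
    qed
  next
    case False
    \<comment> \<open>the discriminant of the quadratic equation for the shear that removes \<open>e\<close>\<close>
    define d where "d = F\<^sup>2 - 4 * (e * a + F * c - c\<^sup>2)"
    consider "d = 0" | "d > 0" | "d < 0" by linarith
    then show ?thesis
    proof cases
      case 1
      have "F \<noteq> 0" using 1 r by (auto simp: d_def)
      \<comment> \<open>Scaled so that the new \<open>F\<close> is 2. The shear
        \<open>\<gamma>\<close> is the vertex of the quadratic in \<open>\<gamma>\<close> on the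
        right of \<open>new(3)\<close>, here its double root.\<close>
      define \<beta> where "\<beta> = 2 / F"
      define \<gamma> where "\<gamma> = \<beta> * (F - 2 * c) / (2 * a)"
      have \<gamma>: "2 * (\<gamma> * a) = \<beta> * (F - 2 * c)" using False by (simp add: \<gamma>_def)
      have \<beta>: "\<beta> \<noteq> 0" "\<beta> * F = 2" using \<open>F \<noteq> 0\<close> by (simp_all add: \<beta>_def)
      have "linearly_equivalent G M1" unfolding M1_def
      proof (rule le[where \<alpha> = "- 1 / a" and \<beta> = \<beta> and \<gamma> = \<gamma>])
        have "2 * (\<beta> * c + \<gamma> * a) = 2" using \<gamma> \<beta>(2) by algebra
        then show "1 = \<beta> * c + \<gamma> * a" by simp
        have "4 * (a * (\<beta>\<^sup>2 * e + 2 * \<beta> * \<gamma> * c + \<gamma>\<^sup>2 * a - \<beta> * \<gamma> * F)) = 0"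
          using \<gamma> 1 unfolding d_def by algebra
        then show "- 1 / a * 0 = \<beta>\<^sup>2 * e + 2 * \<beta> * \<gamma> * c + \<gamma>\<^sup>2 * a - \<beta> * \<gamma> * F"
          using False by simp
      qed (use False \<beta> in simp_all)
      then show ?thesis by blast
    next
      case 2
      define s where "s = sqrt d"
      have s: "s \<noteq> 0" "s\<^sup>2 = d" using 2 by (simp_all add: s_def)
      \<comment> \<open>Scaled so that the discriminant becomes 1; \<open>x\<close> below is a root
        of the quadratic \<open>quad\<close>, and the shear it defines removes
        \<open>e\<close>.\<close>
      define \<beta> where "\<beta> = 1 / s"
      define x where "x = (F - 2 * c - s) / 2"
      define \<gamma> where "\<gamma> = \<beta> * x / a"
      have \<gamma>: "\<gamma> * a = \<beta> * x" using False by (simp add: \<gamma>_def)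
      have \<beta>: "\<beta> \<noteq> 0" "\<beta> * s = 1" using s by (simp_all add: \<beta>_def)
      have x: "2 * x = F - 2 * c - s" by (simp add: x_def)
      define c' where "c' = \<beta> * c + \<gamma> * a"
      have F: "\<beta> * F = 1 + 2 * c'" using x \<beta>(2) \<gamma> unfolding c'_def by algebra
      have quad: "x\<^sup>2 + (2 * c - F) * x + a * e = 0"
      proof -
        have "4 * (x\<^sup>2 + (2 * c - F) * x + a * e) = 0" using x s(2) unfolding d_def by algebra
        then show ?thesis by simp
      qed
      have "linearly_equivalent G (M2 c')" unfolding M2_def
      proof (rule le[where \<alpha> = "- 1 / a" and \<beta> = \<beta> and \<gamma> = \<gamma>])
        have "a * (\<beta>\<^sup>2 * e + 2 * \<beta> * \<gamma> * c + \<gamma>\<^sup>2 * a - \<beta> * \<gamma> * F) = 0"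
          using quad \<gamma> by algebra
        then show "- 1 / a * 0 = \<beta>\<^sup>2 * e + 2 * \<beta> * \<gamma> * c + \<gamma>\<^sup>2 * a - \<beta> * \<gamma> * F"
          using False by simp
      qed (use False \<beta> F in \<open>simp_all add: c'_def\<close>)
      moreover have "c'\<^sup>2 + c' = \<beta>\<^sup>2 * (e * a + F * c - c\<^sup>2)"
        using F quad \<gamma> unfolding c'_def by algebra
      then have "c'\<^sup>2 + c' \<noteq> 0" using r \<beta> by simp
      ultimately show ?thesis by blast
    next
      case 3
      define s where "s = sqrt (- d)"
      have s: "s \<noteq> 0" "s\<^sup>2 = - d" using 3 by (simp_all add: s_def)
      \<comment> \<open>No real shear removes \<open>e\<close>. The vertex leaves
        -(\<open>\<beta>\<close> squared) d / 4 for \<open>a\<close> times the quadratic; the choice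
        2 / s makes this 1, so the new \<open>e\<close> is -1.\<close>
      define \<beta> where "\<beta> = 2 / s"
      define \<gamma> where "\<gamma> = \<beta> * (F - 2 * c) / (2 * a)"
      have \<gamma>: "2 * (\<gamma> * a) = \<beta> * (F - 2 * c)" using False by (simp add: \<gamma>_def)
      have \<beta>: "\<beta> \<noteq> 0" "\<beta> * s = 2" using s by (simp_all add: \<beta>_def)
      define c' where "c' = \<beta> * c + \<gamma> * a"
      have F: "\<beta> * F = 2 * c'" using \<gamma> unfolding c'_def by algebra
      have "linearly_equivalent G (M5 c')" unfolding M5_def
      proof (rule le[where \<alpha> = "- 1 / a" and \<beta> = \<beta> and \<gamma> = \<gamma>])
        have "4 * (a * (\<beta>\<^sup>2 * e + 2 * \<beta> * \<gamma> * c + \<gamma>\<^sup>2 * a - \<beta> * \<gamma> * F)) = 4"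
          using \<gamma> s(2) \<beta>(2) unfolding d_def by algebra
        then show "- 1 / a * - 1 = \<beta>\<^sup>2 * e + 2 * \<beta> * \<gamma> * c + \<gamma>\<^sup>2 * a - \<beta> * \<gamma> * F"
          using False by (simp add: field_simps)
      qed (use False \<beta> F in \<open>simp_all add: c'_def\<close>)
      then show ?thesis by blast
    qed
  qed
qed

section \<open>The Ricci tensor in an adapted basis\<close>

text \<open>The derivative of the determinant along \<open>L\<close>. It computes the trace in an
  arbitrary basis, so Ricci components can be read off from the product table of \<open>f1\<close>,
  \<open>f2\<close>.\<close>

lemma trace_area:
  assumes "linear L"
  shows "trace (matrix L) * area u v = area (L u) v + area u (L v)"
proof -
  have L: "L w = w $ 1 *\<^sub>R L e1 + w $ 2 *\<^sub>R L e2" for w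
    by (subst plane_basis[of w]) (simp only: linear_add[OF assms] linear_cmul[OF assms])
  have t: "trace (matrix L) = L e1 $ 1 + L e2 $ 2" by (simp add: trace_def matrix_def sum_2)
  show ?thesis unfolding t area_def L[of u] L[of v] by (simp add: algebra_simps)
qed

lemma ricci_area:
  "ricci (\<lambda>_. G) p u v * area f1 f2 =
     area (chr G f1 (chr G u v) - chr G u (chr G f1 v)) f2 + area f1 (chr G f2 (chr G u v) - chr G u (chr G f2 v))"
proof -
  have "linear (\<lambda>w. chr G w (chr G u v) - chr G u (chr G w v))"
    by (rule linearI) (simp_all add: chr.add_left chr.add_right chr.scaleR_left chr.scaleR_right algebra_simps)
  from trace_area[OF this] show ?thesis unfolding ricci_def curvature_const .
qed

lemma linear_ricci: "linear (\<lambda>u. ricci (\<lambda>_. G) p u v)" "linear (\<lambda>v. ricci (\<lambda>_. G) p u v)"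
proof -
  have r: "ricci (\<lambda>_. G) p u v = area (chr G e1 (chr G u v) - chr G u (chr G e1 v)) e2
      + area e1 (chr G e2 (chr G u v) - chr G u (chr G e2 v))" for u v
    using ricci_area[of G p u v e1 e2] by (simp add: area_def)
  show "linear (\<lambda>u. ricci (\<lambda>_. G) p u v)" "linear (\<lambda>v. ricci (\<lambda>_. G) p u v)"
    by (rule linearI; simp add: r area_def chr.add_left chr.add_right chr.scaleR_left chr.scaleR_right algebra_simps)+
qed

lemma area_combination:
  "area (x *\<^sub>R f1 + y *\<^sub>R f2) f2 = x * area f1 f2" "area f1 (x *\<^sub>R f1 + y *\<^sub>R f2) = y * area f1 f2"
  by (simp_all add: area_def algebra_simps)

lemma area_basis:
  assumes "area f1 f2 \<noteq> 0"
  shows "\<exists>x y. w = x *\<^sub>R f1 + y *\<^sub>R f2"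
proof (intro exI)
  show "w = (area w f2 / area f1 f2) *\<^sub>R f1 + (area f1 w / area f1 f2) *\<^sub>R f2"
    using assms by (simp add: vec_eq_iff forall_2 area_def divide_simps) (simp add: algebra_simps)
qed

lemma classification:
  assumes T: "torsion_free UNIV (\<lambda>_. G)" and rank: "rank (ricci_matrix (\<lambda>_. G) p) = 1"
  shows "linearly_equivalent G M1 \<or>
         (\<exists>c. c\<^sup>2 + c \<noteq> 0 \<and> linearly_equivalent G (M2 c)) \<or>
         (\<exists>c. c\<^sup>2 + c \<noteq> 0 \<and> linearly_equivalent G (M3 c)) \<or>
         (\<exists>c. linearly_equivalent G (M4 c)) \<or>
         (\<exists>c. linearly_equivalent G (M5 c))"
proof -
  have G: "G i j k = G j i k" for i j k using T unfolding torsion_free_const_iff by blast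
  let ?M = "ricci_matrix (\<lambda>_. G) p" and ?r = "ricci (\<lambda>_. G) p"
  note lin = linear_add[OF linear_ricci(1)] linear_cmul[OF linear_ricci(1)]
    linear_add[OF linear_ricci(2)] linear_cmul[OF linear_ricci(2)]
  have "\<not> inj ((*v) ?M)" using rank by (simp flip: less_rank_noninjective)
  then obtain f1 where f1: "f1 \<noteq> 0" "?M *v f1 = 0"
    unfolding linear_injective_0[OF matrix_vector_mul_linear] by blast
  have right: "?r u v = v $ 1 * ?r u e1 + v $ 2 * ?r u e2" for u v
    by (subst plane_basis[of v]) (simp only: lin real_scaleR_def)
  have left: "?r u v = u $ 1 * ?r e1 v + u $ 2 * ?r e2 v" for u v
    by (subst plane_basis[of u]) (simp only: lin real_scaleR_def)
  have "?r e1 f1 = (?M *v f1) $ 1" "?r e2 f1 = (?M *v f1) $ 2"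
    unfolding right[of e1 f1] right[of e2 f1]
    by (simp_all add: matrix_vector_mult_def sum_2 ricci_matrix_def mult.commute)
  then have ker: "?r u f1 = 0" for u
    unfolding left[of u f1] f1(2) by simp
  \<comment> \<open>\<open>f1\<close> rotated by a right angle, so that \<open>area f1 f2\<close> is
    the squared length of \<open>f1\<close>.\<close>
  define f2 where "f2 = (- f1 $ 2) *\<^sub>R e1 + f1 $ 1 *\<^sub>R e2"
  have "area f1 f2 = f1 $ 1 * f1 $ 1 + f1 $ 2 * f1 $ 2" by (simp add: area_def f2_def)
  then have A: "area f1 f2 \<noteq> 0" using f1(1) by (simp add: vec_eq_iff forall_2)
  obtain a b where 11: "chr G f1 f1 = a *\<^sub>R f1 + b *\<^sub>R f2" using area_basis[OF A] by blast
  obtain c d where 12: "chr G f1 f2 = c *\<^sub>R f1 + d *\<^sub>R f2" using area_basis[OF A] by blast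
  obtain e F where 22: "chr G f2 f2 = e *\<^sub>R f1 + F *\<^sub>R f2" using area_basis[OF A] by blast
  have 21: "chr G f2 f1 = c *\<^sub>R f1 + d *\<^sub>R f2" using 12 chr_commute[of G f2 f1, OF G] by simp
  have comb: "chr G f1 (x *\<^sub>R f1 + y *\<^sub>R f2) = (x * a + y * c) *\<^sub>R f1 + (x * b + y * d) *\<^sub>R f2"
    "chr G f2 (x *\<^sub>R f1 + y *\<^sub>R f2) = (x * c + y * e) *\<^sub>R f1 + (x * d + y * F) *\<^sub>R f2" for x y
    by (simp_all add: chr.add_right chr.scaleR_right 11 12 21 22 algebra_simps)
  have diff: "(x *\<^sub>R f1 + y *\<^sub>R f2) - (x' *\<^sub>R f1 + y' *\<^sub>R f2) = (x - x') *\<^sub>R f1 + (y - y') *\<^sub>R f2" for x y x' y'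
    by (simp add: algebra_simps)
  have r11: "?r f1 f1 = d * (a - d) + b * (F - c)" and r21: "?r f2 f1 = c * d - b * e"
    and r12: "?r f1 f2 = c * d - b * e" and r22: "?r f2 f2 = e * (a - d) + c * (F - c)"
  proof -
    have "?r u v * area f1 f2 = k * area f1 f2 \<Longrightarrow> ?r u v = k" for u v k using A by simp
    note I = this
    show "?r f1 f1 = d * (a - d) + b * (F - c)" "?r f2 f1 = c * d - b * e"
      "?r f1 f2 = c * d - b * e" "?r f2 f2 = e * (a - d) + c * (F - c)"
      by (rule I, simp only: ricci_area 11 12 21 22 comb diff area_combination, simp add: algebra_simps)+
  qed
  \<comment> \<open>By \<open>r12\<close> and \<open>r21\<close> the Ricci tensor is symmetric, so
    \<open>f1\<close> is in its kernel on both sides; if this last component vanished too, the rank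
    would be 0.\<close>
  have "?r f2 f2 \<noteq> 0"
  proof
    assume z: "?r f2 f2 = 0"
    have "?r f1 f2 = 0" using r12 r21 ker[of f2] by simp
    then have zero: "?r (x *\<^sub>R f1 + y *\<^sub>R f2) (x' *\<^sub>R f1 + y' *\<^sub>R f2) = 0" for x y x' y'
      by (simp add: lin z ker)
    have "?r u v = 0" for u v
      using area_basis[OF A, of u] area_basis[OF A, of v] zero by metis
    then have "?M = 0" by (simp add: ricci_matrix_def vec_eq_iff)
    then show False using rank by simp
  qed
  then have r: "e * (a - d) + c * (F - c) \<noteq> 0" using r22 by simp
  have s: "d * (a - d) + b * (F - c) = 0" "c * d - b * e = 0" using ker r11 r21 by simp_all
  \<comment> \<open>Both products are combinations of the two equations in \<open>s\<close>;
    dividing by the nonzero Ricci component gives the vanishing of \<open>d\<close> and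
    \<open>b\<close>.\<close>
  have "d * (e * (a - d) + c * (F - c)) = 0" "b * (e * (a - d) + c * (F - c)) = 0" using s by algebra+
  then have "d = 0" "b = 0" using r by simp_all
  then show ?thesis
    using classification_from_basis[of G f1 f2 a c e F, OF G A] 11 12 22 r by (simp add: algebra_simps power2_eq_square)
qed

theorem lemma3p6:
  shows
   "(\<forall>G :: christoffel.
       torsion_free UNIV (\<lambda>_. G) \<and> \<not> flat UNIV (\<lambda>_. G) \<and>
       (\<forall>p. rank (ricci_matrix (\<lambda>_. G) p) = 1) \<longrightarrow>
         linearly_equivalent G M1 \<or>
         (\<exists>c. c\<^sup>2 + c \<noteq> 0 \<and> linearly_equivalent G (M2 c)) \<or>
         (\<exists>c. c\<^sup>2 + c \<noteq> 0 \<and> linearly_equivalent G (M3 c)) \<or>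
         (\<exists>c. linearly_equivalent G (M4 c)) \<or>
         (\<exists>c. linearly_equivalent G (M5 c))) \<and>
    (is_direct_sum (killing (\<lambda>_. M1))
       (span {times_d1 (\<lambda>x. exp (x $ 1)), times_d1 (\<lambda>x. x $ 2 * exp (x $ 1))}) K0 \<and>
     lie_isomorphic (killing (\<lambda>_. M1)) bracket UNIV bracket_A4_9_0) \<and>
    (\<forall>c. c\<^sup>2 + c \<noteq> 0 \<longrightarrow>
     is_direct_sum (killing (\<lambda>_. M2 c))
       (span {times_d1 (\<lambda>x. exp (x $ 1)), times_d1 (\<lambda>x. exp (x $ 1 + x $ 2))}) K0 \<and>
     lie_isomorphic (killing (\<lambda>_. M2 c)) bracket UNIV bracket_A2_A2) \<and>
    (\<forall>c. c\<^sup>2 + c \<noteq> 0 \<longrightarrow>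
     is_direct_sum (killing (\<lambda>_. M3 c))
       (span {times_d1 (\<lambda>x. exp (x $ 2)), times_d1 (\<lambda>x. x $ 1)}) K0 \<and>
     lie_isomorphic (killing (\<lambda>_. M3 c)) bracket UNIV bracket_A2_A2) \<and>
    (\<forall>c.
     is_direct_sum (killing (\<lambda>_. M4 c))
       (span {times_d1 (\<lambda>x. x $ 2), times_d1 (\<lambda>x. c * (x $ 2)\<^sup>2 + 2 * x $ 1)}) K0 \<and>
     lie_isomorphic (killing (\<lambda>_. M4 c)) bracket UNIV bracket_A4_9_0) \<and>
    (\<forall>c.
     is_direct_sum (killing (\<lambda>_. M5 c))
       (span {times_d1 (\<lambda>x. exp (x $ 1) * cos (x $ 2)),
              times_d1 (\<lambda>x. exp (x $ 1) * sin (x $ 2))}) K0 \<and>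
     lie_isomorphic (killing (\<lambda>_. M5 c)) bracket UNIV bracket_A4_12) \<and>
    (type_B UNIV (\<lambda>_. M1) \<and>
     (\<forall>c. c\<^sup>2 + c \<noteq> 0 \<longrightarrow> type_B UNIV (\<lambda>_. M2 c)) \<and>
     (\<forall>c. c\<^sup>2 + c \<noteq> 0 \<longrightarrow> type_B UNIV (\<lambda>_. M3 c)) \<and>
     (\<forall>c. type_B UNIV (\<lambda>_. M4 c)) \<and>
     (\<forall>c. \<not> type_B UNIV (\<lambda>_. M5 c)))"
  using classification killing_M1 killing_M2 killing_M3 killing_M4 killing_M5
    type_B_M1 type_B_M2 type_B_M3 type_B_M4 not_type_B_M5
  by meson

end
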